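(* Let $H$ be a Hopf algebra, $\delta$ a character on $H$ with $S_\delta^2=\mathrm{Id}$, $V$ an $H$-module, and $R=T(V)$ its non-unital tensor algebra with the diagonal $H$-action. Then $$X^0_\delta(R)\cong T(V)_\delta,\qquad X^1_\delta(R)\cong T(V)_\delta,$$ and under these identifications the boundaries have the same description as those of $X(R)$: $b:X^1_\delta(R)\to X^0_\delta(R)$ is $t-1$ and $d:X^0_\delta(R)\to X^1_\delta(R)$ is $N$ (both of which descend to $T(V)_\delta$). The same holds when $V$ is a graded $H$-module, provided the backward-shift cyclic permutation $t$ is replaced by its graded (signed) version.
   Context: $H$ is a Hopf algebra over $\mathbb{C}$ with counit $\epsilon$, antipode $S$, coproduct $\Delta(h)=\sum h_0\otimes h_1$; a character is a non-zero algebra map $\delta:H\to\mathbb{C}$; $S_\delta(h)=\sum\delta(h_0)S(h_1)$. For an $H$-module $M$, coinvariants means $\mathrm{span}\{hm-\delta(h)m\}$ and $M_\delta$ is the quotient of $M$ by it. $T(V)=\bigoplus_{n\ge1}V^{\otimes n}$. $t$ is the backward-shift cyclic permutation $v_0\otimes v_1\otimes\cdots\otimes v_n\mapsto v_1\otimes\cdots\otimes v_n\otimes v_0$ (graded version: with sign $(-1)^{|v_0|(|v_1|+\cdots+|v_n|)}$), and $N=\sum_{i=0}^nt^i$ on $V^{\otimes(n+1)}$. For an algebra $R$ with an $H$-action satisfying $h(xy)=\sum h_0(x)h_1(y)$, $\Omega^1(R)=\tilde R\otimes R$ ($\tilde R$ = $R$ with unit adjoined, $h\cdot1=\epsilon(h)1$)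 is the bimodule of non-commutative 1-forms $x\,dy$ with diagonal $H$-action, and $\Omega^1(R)_{\natural,\delta}=\Omega^1(R)/([\Omega^1(R),R]+\text{coinvariants})$. The localized $X$-complex $X_\delta(R)$ is the super-complex with $X^0_\delta(R)=R_\delta$, $X^1_\delta(R)=\Omega^1(R)_{\natural,\delta}$, $d(x)=dx$, $b(x\,dy)=[x,y]$ (graded commutators in the graded case). The usual $X$-complex $X(R)$ is the analogous super-complex $R\rightleftarrows\Omega^1(R)/[\Omega^1(R),R]$ without dividing by coinvariants; for $R=T(V)$ both terms identify with $T(V)$, with $b=t-1$, $d=N$. *)

theory Defs
  imports Complex_Main "HOL-Library.Poly_Mapping" "HOL-Library.Set_Algebras"
begin

section \<open>Complex vector spaces and algebras\<close>

class scaleC =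
  fixes scaleC :: "complex \<Rightarrow> 'a \<Rightarrow> 'a"  (infixr \<open>*\<^sub>C\<close> 75)

class complex_vector = ab_group_add + scaleC +
  assumes scaleC_add_right: "c *\<^sub>C (x + y) = c *\<^sub>C x + c *\<^sub>C y"
    and scaleC_add_left: "(c + d) *\<^sub>C x = c *\<^sub>C x + d *\<^sub>C x"
    and scaleC_scaleC: "c *\<^sub>C d *\<^sub>C x = (c * d) *\<^sub>C x"
    and scaleC_one: "1 *\<^sub>C x = x"

class complex_algebra = complex_vector + ring +
  assumes mult_scaleC_left: "(c *\<^sub>C x) * y = c *\<^sub>C (x * y)"
    and mult_scaleC_right: "x * (c *\<^sub>C y) = c *\<^sub>C (x * y)"

class complex_algebra_1 = complex_algebra + ring_1

instantiation complex :: complex_algebra_1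
begin
definition scaleC_complex :: "complex \<Rightarrow> complex \<Rightarrow> complex"
  where "scaleC_complex c x = c * x"
instance
  by standard (simp_all add: scaleC_complex_def algebra_simps)
end

global_interpretation complex_vector: vector_space "scaleC :: complex \<Rightarrow> 'a \<Rightarrow> 'a::complex_vector"
  defines csubspace = complex_vector.subspace
    and cspan = complex_vector.span
  by unfold_locales (simp_all add: scaleC_add_right scaleC_add_left scaleC_scaleC scaleC_one)

abbreviation clinear :: "('a::complex_vector \<Rightarrow> 'b::complex_vector) \<Rightarrow> bool"
  where "clinear \<equiv> Vector_Spaces.linear scaleC scaleC"

global_interpretation complex_vector_pair: vector_space_pair
  "scaleC :: complex \<Rightarrow> 'a \<Rightarrow> 'a::complex_vector" "scaleC :: complex \<Rightarrow> 'b \<Rightarrow> 'b::complex_vector"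
  by unfold_locales

definition cbilinear :: "('a::complex_vector \<Rightarrow> 'b::complex_vector \<Rightarrow> 'c::complex_vector) \<Rightarrow> bool"
  where "cbilinear B \<longleftrightarrow> (\<forall>a. clinear (B a)) \<and> (\<forall>b. clinear (\<lambda>a. B a b))"

lemma clinearI:
  assumes "\<And>x y. f (x + y) = f x + f y" and "\<And>c x. f (c *\<^sub>C x) = c *\<^sub>C f x"
  shows "clinear f"
  using assms by (simp add: Vector_Spaces.linear_iff complex_vector.vector_space_axioms)

lemma clinear_add: "clinear f \<Longrightarrow> f (x + y) = f x + f y"
  and clinear_scale: "clinear f \<Longrightarrow> f (c *\<^sub>C x) = c *\<^sub>C f x"
  by (simp_all add: Vector_Spaces.linear_iff)

lemma clinear_compose: "clinear f \<Longrightarrow> clinear g \<Longrightarrow> clinear (\<lambda>x. g (f x))"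
  by (intro clinearI) (simp_all add: clinear_add clinear_scale)

lemma clinear_const_0: "clinear (\<lambda>x. 0)"
  by (intro clinearI) simp_all

lemma clinear_times:
  fixes a :: "'a::complex_algebra"
  shows "clinear (\<lambda>x. a * x)" "clinear (\<lambda>x. x * a)"
  by (auto intro!: clinearI simp: distrib_left distrib_right mult_scaleC_left mult_scaleC_right)


section \<open>The free vector space on a set\<close>

instantiation poly_mapping :: (type, complex_vector) complex_vector
begin

lift_definition scaleC_poly_mapping :: "complex \<Rightarrow> ('a \<Rightarrow>\<^sub>0 'b) \<Rightarrow> 'a \<Rightarrow>\<^sub>0 'b"
  is "\<lambda>c f k. c *\<^sub>C f k"
  by (erule rev_finite_subset) auto

instance
  by standard (transfer, simp add: fun_eq_iff scaleC_add_right scaleC_add_left scaleC_scaleC scaleC_one)+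

end

lemma lookup_scaleC: "Poly_Mapping.lookup (c *\<^sub>C f) k = c *\<^sub>C Poly_Mapping.lookup f k"
  by transfer simp

abbreviation free :: "'a \<Rightarrow> 'a \<Rightarrow>\<^sub>0 complex"
  where "free k \<equiv> Poly_Mapping.single k 1"

definition free_lift :: "('a \<Rightarrow> 'b::complex_vector) \<Rightarrow> ('a \<Rightarrow>\<^sub>0 complex) \<Rightarrow> 'b"
  where "free_lift F f = (\<Sum>k\<in>Poly_Mapping.keys f. Poly_Mapping.lookup f k *\<^sub>C F k)"

lemma free_lift_superset:
  assumes "finite A" "Poly_Mapping.keys f \<subseteq> A"
  shows "free_lift F f = (\<Sum>k\<in>A. Poly_Mapping.lookup f k *\<^sub>C F k)"
  unfolding free_lift_def using assms
  by (intro sum.mono_neutral_left) (auto simp: in_keys_iff)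

lemma clinear_free_lift: "clinear (free_lift F)"
proof (intro clinearI)
  fix f g :: "'a \<Rightarrow>\<^sub>0 complex"
  let ?A = "Poly_Mapping.keys f \<union> Poly_Mapping.keys g"
  have "free_lift F (f + g) = (\<Sum>k\<in>?A. Poly_Mapping.lookup (f + g) k *\<^sub>C F k)"
    by (rule free_lift_superset) (simp_all add: Poly_Mapping.keys_add)
  also have "\<dots> = (\<Sum>k\<in>?A. Poly_Mapping.lookup f k *\<^sub>C F k) + (\<Sum>k\<in>?A. Poly_Mapping.lookup g k *\<^sub>C F k)"
    by (simp add: lookup_add scaleC_add_left sum.distrib)
  also have "\<dots> = free_lift F f + free_lift F g"
    by (subst (1 2) free_lift_superset[of ?A]) auto
  finally show "free_lift F (f + g) = free_lift F f + free_lift F g" .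
next
  fix c :: complex and f :: "'a \<Rightarrow>\<^sub>0 complex"
  have "free_lift F (c *\<^sub>C f) = (\<Sum>k\<in>Poly_Mapping.keys f. Poly_Mapping.lookup (c *\<^sub>C f) k *\<^sub>C F k)"
    by (rule free_lift_superset) (auto simp: in_keys_iff lookup_scaleC)
  then show "free_lift F (c *\<^sub>C f) = c *\<^sub>C free_lift F f"
    by (simp add: free_lift_def lookup_scaleC complex_vector.scale_sum_right scaleC_scaleC
        scaleC_complex_def)
qed

lemma free_lift_free [simp]: "free_lift F (free k) = F k"
  by (simp add: free_lift_def scaleC_one)

lemma free_expansion: "f = free_lift free f"
proof (rule poly_mapping_eqI)
  fix k
  have *: "Poly_Mapping.lookup (\<Sum>i\<in>A. Poly_Mapping.lookup f i *\<^sub>C free i) k = (\<Sum>i\<in>A. Poly_Mapping.lookup (Poly_Mapping.lookup f i *\<^sub>C free i) k)" for A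
    by (induction A rule: infinite_finite_induct) (simp_all add: lookup_add)
  have "Poly_Mapping.lookup (free_lift free f) k = (\<Sum>i\<in>Poly_Mapping.keys f. if i = k then Poly_Mapping.lookup f i else 0)"
    unfolding free_lift_def * by (rule sum.cong) (auto simp: lookup_scaleC lookup_single scaleC_complex_def)
  also have "\<dots> = Poly_Mapping.lookup f k"
    by (simp add: in_keys_iff)
  finally show "Poly_Mapping.lookup f k = Poly_Mapping.lookup (free_lift free f) k" by simp
qed

lemma free_lift_compose:
  assumes "clinear g" shows "g (free_lift F f) = free_lift (\<lambda>k. g (F k)) f"
  unfolding free_lift_def
  by (simp add: complex_vector_pair.linear_sum[OF assms] clinear_scale[OF assms])

lemma clinear_eq_0_on_cspan:
  assumes "clinear f" "\<And>r. r \<in> R \<Longrightarrow> f r = 0" "x \<in> cspan R"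
  shows "f x = 0"
  using complex_vector_pair.linear_eq_0_on_span[OF assms(1,2)] assms(3) by blast


section \<open>Tensor products\<close>

definition tensor_relations :: "('a::complex_vector \<times> 'b::complex_vector \<Rightarrow>\<^sub>0 complex) set"
  where "tensor_relations = cspan (
    {free (a + a', b) - free (a, b) - free (a', b) | a a' b. True} \<union>
    {free (a, b + b') - free (a, b) - free (a, b') | a b b'. True} \<union>
    {free (c *\<^sub>C a, b) - c *\<^sub>C free (a, b) | c a b. True} \<union>
    {free (a, c *\<^sub>C b) - c *\<^sub>C free (a, b) | c a b. True})"

lemma equivp_cspan: "equivp (\<lambda>x y. x - y \<in> cspan R)"
proof (rule equivpI)
  show "reflp (\<lambda>x y. x - y \<in> cspan R)"
    by (simp add: reflp_def complex_vector.span_zero)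
  show "symp (\<lambda>x y. x - y \<in> cspan R)"
    using complex_vector.span_neg by (fastforce simp: symp_def)
  show "transp (\<lambda>x y. x - y \<in> cspan R)"
    using complex_vector.span_add by (fastforce simp: transp_def)
qed

quotient_type (overloaded) ('a, 'b) tensor (infixr \<open>\<otimes>\<^sub>t\<close> 75) =
  "'a::complex_vector \<times> 'b::complex_vector \<Rightarrow>\<^sub>0 complex" / "\<lambda>x y. x - y \<in> tensor_relations"
  unfolding tensor_relations_def by (rule equivp_cspan)

lemma cspan_diff_add:
  "x - x' \<in> cspan R \<Longrightarrow> y - y' \<in> cspan R \<Longrightarrow> (x + y) - (x' + y') \<in> cspan R"
  using complex_vector.span_add by (fastforce simp: algebra_simps)

lemma cspan_diff_minus:
  "x - x' \<in> cspan R \<Longrightarrow> y - y' \<in> cspan R \<Longrightarrow> (x - y) - (x' - y') \<in> cspan R"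
  using complex_vector.span_diff[of "x - x'" R "y - y'"] by (simp add: algebra_simps)

lemma cspan_diff_scale:
  "x - x' \<in> cspan R \<Longrightarrow> c *\<^sub>C x - c *\<^sub>C x' \<in> cspan R"
  using complex_vector.span_scale[of "x - x'" R c] by (simp add: complex_vector.scale_right_diff_distrib)

lemma cspan_diff_uminus:
  "x - x' \<in> cspan R \<Longrightarrow> - x - - x' \<in> cspan R"
  using complex_vector.span_neg[of "x - x'" R] by simp

instantiation tensor :: (complex_vector, complex_vector) complex_vector
begin

lift_definition zero_tensor :: "'a \<otimes>\<^sub>t 'b" is 0 .

lift_definition plus_tensor :: "'a \<otimes>\<^sub>t 'b \<Rightarrow> 'a \<otimes>\<^sub>t 'b \<Rightarrow> 'a \<otimes>\<^sub>t 'b" is "(+)"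
  unfolding tensor_relations_def by (rule cspan_diff_add)

lift_definition minus_tensor :: "'a \<otimes>\<^sub>t 'b \<Rightarrow> 'a \<otimes>\<^sub>t 'b \<Rightarrow> 'a \<otimes>\<^sub>t 'b" is "(-)"
  unfolding tensor_relations_def by (rule cspan_diff_minus)

lift_definition uminus_tensor :: "'a \<otimes>\<^sub>t 'b \<Rightarrow> 'a \<otimes>\<^sub>t 'b" is uminus
  unfolding tensor_relations_def by (rule cspan_diff_uminus)

lift_definition scaleC_tensor :: "complex \<Rightarrow> 'a \<otimes>\<^sub>t 'b \<Rightarrow> 'a \<otimes>\<^sub>t 'b" is scaleC
  unfolding tensor_relations_def by (rule cspan_diff_scale)

instance
  by standard (transfer; simp add: tensor_relations_def complex_vector.span_zero algebra_simps
      scaleC_add_right scaleC_add_left scaleC_scaleC scaleC_one)+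

end

lift_definition pure_tensor :: "'a::complex_vector \<Rightarrow> 'b::complex_vector \<Rightarrow> 'a \<otimes>\<^sub>t 'b"
  (infixr \<open>\<otimes>\<close> 75) is "\<lambda>a b. free (a, b)" .

text \<open>The linear map on the tensor product induced by a bilinear map; for bilinear arguments it does
  not depend on the representative.\<close>

definition tensor_lift ::
    "('a::complex_vector \<Rightarrow> 'b::complex_vector \<Rightarrow> 'c::complex_vector) \<Rightarrow> 'a \<otimes>\<^sub>t 'b \<Rightarrow> 'c"
  where "tensor_lift B x = free_lift (\<lambda>(a, b). B a b) (rep_tensor x)"

lemma cbilinear_pure_tensor: "cbilinear (\<otimes>)"
  unfolding cbilinear_def
proof (intro conjI allI clinearI)
  fix a a' :: 'a and b b' :: 'b and c :: complex
  show "a \<otimes> (b + b') = a \<otimes> b + a \<otimes> b'"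
    by transfer (unfold tensor_relations_def diff_diff_eq[symmetric], rule complex_vector.span_base, blast)
  show "(a + a') \<otimes> b = a \<otimes> b + a' \<otimes> b"
    by transfer (unfold tensor_relations_def diff_diff_eq[symmetric], rule complex_vector.span_base, blast)
  show "a \<otimes> (c *\<^sub>C b) = c *\<^sub>C (a \<otimes> b)"
    by transfer (unfold tensor_relations_def, rule complex_vector.span_base, blast)
  show "(c *\<^sub>C a) \<otimes> b = c *\<^sub>C (a \<otimes> b)"
    by transfer (unfold tensor_relations_def, rule complex_vector.span_base, blast)
qed

lemma tensor_lift_abs:
  assumes "cbilinear B"
  shows "tensor_lift B (abs_tensor f) = free_lift (\<lambda>(a, b). B a b) f"
proof -
  let ?L = "free_lift (\<lambda>(a, b). B a b)"
  have lin: "clinear ?L" by (rule clinear_free_lift)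
  have B: "clinear (B a)" "clinear (\<lambda>a. B a b)" for a b
    using assms by (auto simp: cbilinear_def)
  have "rep_tensor (abs_tensor f) - f \<in> tensor_relations"
    by (rule Quotient3_rep_abs[OF Quotient3_tensor equivp_reflp[OF tensor_equivp]])
  then have "?L (rep_tensor (abs_tensor f) - f) = 0"
    unfolding tensor_relations_def
    by (rule clinear_eq_0_on_cspan[OF lin, rotated])
      (auto simp: complex_vector_pair.linear_diff[OF lin] clinear_scale[OF lin]
        clinear_add[OF B(1)] clinear_add[OF B(2)] clinear_scale[OF B(1)] clinear_scale[OF B(2)])
  then show ?thesis
    by (simp add: tensor_lift_def complex_vector_pair.linear_diff[OF lin])
qed

lemma tensor_lift_pure [simp]: "cbilinear B \<Longrightarrow> tensor_lift B (a \<otimes> b) = B a b"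
  by (simp add: pure_tensor.abs_eq tensor_lift_abs)

lemma clinear_tensor_lift:
  assumes "cbilinear B" shows "clinear (tensor_lift B)"
proof (rule clinearI)
  show "tensor_lift B (x + y) = tensor_lift B x + tensor_lift B y" for x y
    by (induct x; induct y) (simp add: plus_tensor.abs_eq tensor_lift_abs assms clinear_add clinear_free_lift)
  show "tensor_lift B (c *\<^sub>C x) = c *\<^sub>C tensor_lift B x" for c x
    by (induct x) (simp add: scaleC_tensor.abs_eq tensor_lift_abs assms clinear_scale clinear_free_lift)
qed

definition tensor_map ::
    "('a::complex_vector \<Rightarrow> 'c::complex_vector) \<Rightarrow> ('b::complex_vector \<Rightarrow> 'd::complex_vector)
      \<Rightarrow> 'a \<otimes>\<^sub>t 'b \<Rightarrow> 'c \<otimes>\<^sub>t 'd"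
  where "tensor_map f g = tensor_lift (\<lambda>a b. f a \<otimes> g b)"

definition tensor_assoc ::
    "('a::complex_vector \<otimes>\<^sub>t 'b::complex_vector) \<otimes>\<^sub>t 'c::complex_vector \<Rightarrow> 'a \<otimes>\<^sub>t 'b \<otimes>\<^sub>t 'c"
  where "tensor_assoc = tensor_lift (\<lambda>x c. tensor_lift (\<lambda>a b. a \<otimes> b \<otimes> c) x)"

definition tensor_mult ::
    "'a::complex_algebra \<otimes>\<^sub>t 'b::complex_algebra \<Rightarrow> 'a \<otimes>\<^sub>t 'b \<Rightarrow> 'a \<otimes>\<^sub>t 'b"
  where "tensor_mult x y = tensor_lift (\<lambda>a b. tensor_lift (\<lambda>a' b'. (a * a') \<otimes> (b * b')) y) x"


section \<open>Hopf algebras, characters, modules, coinvariants\<close>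

definition hopf_algebra ::
    "('h::complex_algebra_1 \<Rightarrow> 'h \<otimes>\<^sub>t 'h) \<Rightarrow> ('h \<Rightarrow> complex) \<Rightarrow> ('h \<Rightarrow> 'h) \<Rightarrow> bool"
  where "hopf_algebra \<Delta> \<epsilon> S \<longleftrightarrow>
    clinear \<Delta> \<and> clinear \<epsilon> \<and> clinear S \<and>
    \<Delta> 1 = 1 \<otimes> 1 \<and> (\<forall>g h. \<Delta> (g * h) = tensor_mult (\<Delta> g) (\<Delta> h)) \<and>
    \<epsilon> 1 = 1 \<and> (\<forall>g h. \<epsilon> (g * h) = \<epsilon> g * \<epsilon> h) \<and>
    (\<forall>h. tensor_assoc (tensor_map \<Delta> id (\<Delta> h)) = tensor_map id \<Delta> (\<Delta> h)) \<and>
    (\<forall>h. tensor_lift (\<lambda>a b. \<epsilon> a *\<^sub>C b) (\<Delta> h) = h) \<and>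
    (\<forall>h. tensor_lift (\<lambda>a b. \<epsilon> b *\<^sub>C a) (\<Delta> h) = h) \<and>
    (\<forall>h. tensor_lift (\<lambda>a b. S a * b) (\<Delta> h) = \<epsilon> h *\<^sub>C 1) \<and>
    (\<forall>h. tensor_lift (\<lambda>a b. a * S b) (\<Delta> h) = \<epsilon> h *\<^sub>C 1)"

definition character :: "('h::complex_algebra_1 \<Rightarrow> complex) \<Rightarrow> bool"
  where "character \<delta> \<longleftrightarrow> clinear \<delta> \<and> (\<forall>g h. \<delta> (g * h) = \<delta> g * \<delta> h) \<and> (\<exists>h. \<delta> h \<noteq> 0)"

definition twisted_antipode ::
    "('h::complex_algebra_1 \<Rightarrow> 'h \<otimes>\<^sub>t 'h) \<Rightarrow> ('h \<Rightarrow> 'h) \<Rightarrow> ('h \<Rightarrow> complex) \<Rightarrow> 'h \<Rightarrow> 'h"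
  where "twisted_antipode \<Delta> S \<delta> h = tensor_lift (\<lambda>a b. \<delta> a *\<^sub>C S b) (\<Delta> h)"

definition hmodule :: "('h::complex_algebra_1 \<Rightarrow> 'm::complex_vector \<Rightarrow> 'm) \<Rightarrow> bool"
  where "hmodule \<rho> \<longleftrightarrow> cbilinear \<rho> \<and> (\<forall>m. \<rho> 1 m = m) \<and> (\<forall>g h m. \<rho> (g * h) m = \<rho> g (\<rho> h m))"

definition coinvariants ::
    "('h \<Rightarrow> complex) \<Rightarrow> ('h::complex_algebra_1 \<Rightarrow> 'm::complex_vector \<Rightarrow> 'm) \<Rightarrow> 'm set"
  where "coinvariants \<delta> \<rho> = cspan {\<rho> h m - \<delta> h *\<^sub>C m | h m. True}"

definition diagonal_action ::
    "('h::complex_algebra_1 \<Rightarrow> 'h \<otimes>\<^sub>t 'h) \<Rightarrow> ('h \<Rightarrow> 'm::complex_vector \<Rightarrow> 'm)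
      \<Rightarrow> ('h \<Rightarrow> 'n::complex_vector \<Rightarrow> 'n) \<Rightarrow> 'h \<Rightarrow> 'm \<otimes>\<^sub>t 'n \<Rightarrow> 'm \<otimes>\<^sub>t 'n"
  where "diagonal_action \<Delta> \<rho> \<sigma> h x = tensor_lift (\<lambda>a b. tensor_map (\<rho> a) (\<sigma> b) x) (\<Delta> h)"


section \<open>Quotient spaces\<close>

text \<open>For a subspace \<open>U\<close> the quotient is the set of its cosets; addition of cosets is addition of
  sets, and a linear map \<open>f\<close> with \<open>f ` U \<subseteq> W\<close> induces \<open>x + U \<mapsto> f x + W\<close>, which as a
  set is \<open>f ` (x + U) + W\<close>. Adding \<open>W\<close> makes the formula correct for non-surjective \<open>f\<close>, in
  particular for scaling by \<open>0\<close>.\<close>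

definition quotient_space :: "'a::complex_vector set \<Rightarrow> 'a set set"
  where "quotient_space U = range (\<lambda>x. x +o U)"

definition quotient_map ::
    "('a::complex_vector \<Rightarrow> 'b::complex_vector) \<Rightarrow> 'b set \<Rightarrow> 'a set \<Rightarrow> 'b set"
  where "quotient_map f W A = f ` A + W"

definition quotient_iso ::
    "'a::complex_vector set \<Rightarrow> 'b::complex_vector set \<Rightarrow> ('a set \<Rightarrow> 'b set) \<Rightarrow> bool"
  where "quotient_iso U W \<Phi> \<longleftrightarrow>
    bij_betw \<Phi> (quotient_space U) (quotient_space W) \<and>
    (\<forall>A \<in> quotient_space U. \<forall>B \<in> quotient_space U. \<Phi> (A + B) = \<Phi> A + \<Phi> B) \<and>
    (\<forall>c. \<forall>A \<in> quotient_space U.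
      \<Phi> (quotient_map (scaleC c) U A) = quotient_map (scaleC c) W (\<Phi> A))"


section \<open>Gradings\<close>

definition is_grading :: "(int \<Rightarrow> 'a::complex_vector set) \<Rightarrow> bool"
  where "is_grading G \<longleftrightarrow> (\<forall>p. csubspace (G p)) \<and>
    (\<forall>x. \<exists>!f. (\<forall>p. f p \<in> G p) \<and> finite {p. f p \<noteq> 0} \<and> x = (\<Sum>p | f p \<noteq> 0. f p))"

definition component :: "(int \<Rightarrow> 'a::complex_vector set) \<Rightarrow> 'a \<Rightarrow> int \<Rightarrow> 'a"
  where "component G x =
    (THE f. (\<forall>p. f p \<in> G p) \<and> finite {p. f p \<noteq> 0} \<and> x = (\<Sum>p | f p \<noteq> 0. f p))"

abbreviation koszul :: "int \<Rightarrow> int \<Rightarrow> complex"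
  where "koszul p q \<equiv> (-1) powi (p * q)"

text \<open>The Hopf algebra itself carries no grading: it acts by operators of degree \<open>0\<close>.\<close>

definition graded_hmodule ::
    "('h::complex_algebra_1 \<Rightarrow> 'm::complex_vector \<Rightarrow> 'm) \<Rightarrow> (int \<Rightarrow> 'm set) \<Rightarrow> bool"
  where "graded_hmodule \<rho> G \<longleftrightarrow> hmodule \<rho> \<and> is_grading G \<and> (\<forall>h p. \<rho> h ` G p \<subseteq> G p)"


section \<open>The non-unital tensor algebra\<close>

text \<open>The non-unital tensor algebra is the free vector space on words over \<open>V\<close>, modulo multilinearity
  in each letter; the empty word is set to zero, so only the tensor powers of positive degree
  survive.\<close>

definition word_relations :: "('v::complex_vector list \<Rightarrow>\<^sub>0 complex) set"
  where "word_relations = cspan (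
    {free []} \<union>
    {free (us @ (v + v') # ws) - free (us @ v # ws) - free (us @ v' # ws) | us v v' ws. True} \<union>
    {free (us @ (c *\<^sub>C v) # ws) - c *\<^sub>C free (us @ v # ws) | c us v ws. True})"

quotient_type (overloaded) 'v tensor_algebra =
  "'v::complex_vector list \<Rightarrow>\<^sub>0 complex" / "\<lambda>x y. x - y \<in> word_relations"
  unfolding word_relations_def by (rule equivp_cspan)

instantiation tensor_algebra :: (complex_vector) complex_vector
begin

lift_definition zero_tensor_algebra :: "'a tensor_algebra" is 0 .

lift_definition plus_tensor_algebra :: "'a tensor_algebra \<Rightarrow> 'a tensor_algebra \<Rightarrow> 'a tensor_algebra"
  is "(+)"
  unfolding word_relations_def by (rule cspan_diff_add)

lift_definition minus_tensor_algebra :: "'a tensor_algebra \<Rightarrow> 'a tensor_algebra \<Rightarrow> 'a tensor_algebra"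
  is "(-)"
  unfolding word_relations_def by (rule cspan_diff_minus)

lift_definition uminus_tensor_algebra :: "'a tensor_algebra \<Rightarrow> 'a tensor_algebra" is uminus
  unfolding word_relations_def by (rule cspan_diff_uminus)

lift_definition scaleC_tensor_algebra :: "complex \<Rightarrow> 'a tensor_algebra \<Rightarrow> 'a tensor_algebra"
  is scaleC
  unfolding word_relations_def by (rule cspan_diff_scale)

instance
  by standard (transfer; simp add: word_relations_def complex_vector.span_zero algebra_simps
      scaleC_add_right scaleC_add_left scaleC_scaleC scaleC_one)+

end

text \<open>\<open>word [v\<^sub>0, \<dots>, v\<^sub>n]\<close> is the elementary tensor of its letters.\<close>

lift_definition word :: "'v::complex_vector list \<Rightarrow> 'v tensor_algebra" is free .

definition multilinear :: "('v::complex_vector list \<Rightarrow> 'b::complex_vector) \<Rightarrow> bool"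
  where "multilinear F \<longleftrightarrow> F [] = 0 \<and> (\<forall>us ws. clinear (\<lambda>v. F (us @ v # ws)))"

definition word_lift :: "('v::complex_vector list \<Rightarrow> 'b::complex_vector) \<Rightarrow> 'v tensor_algebra \<Rightarrow> 'b"
  where "word_lift F x = free_lift F (rep_tensor_algebra x)"

lemma multilinear_word: "multilinear word"
  unfolding multilinear_def
proof (intro conjI allI clinearI)
  show "word [] = (0 :: 'a tensor_algebra)"
    by transfer (simp add: word_relations_def complex_vector.span_base)
  fix us ws :: "'a list" and v v' and c
  show "word (us @ (v + v') # ws) = word (us @ v # ws) + word (us @ v' # ws)"
    by transfer (unfold word_relations_def diff_diff_eq[symmetric], rule complex_vector.span_base, blast)
  show "word (us @ (c *\<^sub>C v) # ws) = c *\<^sub>C word (us @ v # ws)"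
    by transfer (unfold word_relations_def, rule complex_vector.span_base, blast)
qed

lemma word_Nil [simp]: "word [] = 0"
  using multilinear_word unfolding multilinear_def by blast

lemma word_lift_abs:
  assumes "multilinear F"
  shows "word_lift F (abs_tensor_algebra f) = free_lift F f"
proof -
  have lin: "clinear (free_lift F)" by (rule clinear_free_lift)
  have F: "F [] = 0" "clinear (\<lambda>v. F (us @ v # ws))" for us ws
    using assms by (auto simp: multilinear_def)
  have "rep_tensor_algebra (abs_tensor_algebra f) - f \<in> word_relations"
    by (rule Quotient3_rep_abs[OF Quotient3_tensor_algebra equivp_reflp[OF tensor_algebra_equivp]])
  then have "free_lift F (rep_tensor_algebra (abs_tensor_algebra f) - f) = 0"
    unfolding word_relations_def
    by (rule clinear_eq_0_on_cspan[OF lin, rotated])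
      (auto simp: complex_vector_pair.linear_diff[OF lin] clinear_scale[OF lin] F(1)
        clinear_add[OF F(2)] clinear_scale[OF F(2)])
  then show ?thesis
    by (simp add: word_lift_def complex_vector_pair.linear_diff[OF lin])
qed

lemma word_lift_word [simp]: "multilinear F \<Longrightarrow> word_lift F (word vs) = F vs"
  by (simp add: word.abs_eq word_lift_abs)

lemma clinear_word_lift:
  assumes "multilinear F" shows "clinear (word_lift F)"
proof (rule clinearI)
  show "word_lift F (x + y) = word_lift F x + word_lift F y" for x y
    by (induct x; induct y)
      (simp add: plus_tensor_algebra.abs_eq word_lift_abs assms clinear_add clinear_free_lift)
  show "word_lift F (c *\<^sub>C x) = c *\<^sub>C word_lift F x" for c x
    by (induct x)
      (simp add: scaleC_tensor_algebra.abs_eq word_lift_abs assms clinear_scale clinear_free_lift)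
qed

lemma clinear_abs_tensor_algebra: "clinear abs_tensor_algebra"
  by (rule clinearI) (simp_all add: plus_tensor_algebra.abs_eq scaleC_tensor_algebra.abs_eq)

lemma tensor_algebra_expansion: "x = word_lift word x"
proof (induct x)
  fix f :: "'a list \<Rightarrow>\<^sub>0 complex"
  have "abs_tensor_algebra f = abs_tensor_algebra (free_lift free f)"
    using free_expansion[of f] by simp
  also have "\<dots> = free_lift word f"
    by (simp add: free_lift_compose[OF clinear_abs_tensor_algebra] word.abs_eq[abs_def])
  also have "\<dots> = word_lift word (abs_tensor_algebra f)"
    by (simp add: word_lift_abs multilinear_word)
  finally show "abs_tensor_algebra f = word_lift word (abs_tensor_algebra f)" .
qed

lemma clinear_eq_on_words:
  fixes f g :: "'v::complex_vector tensor_algebra \<Rightarrow> 'b::complex_vector"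
  assumes "clinear f" "clinear g" "\<And>vs. f (word vs) = g (word vs)"
  shows "f x = g x"
proof -
  have *: "h x = free_lift (\<lambda>vs. h (word vs)) (rep_tensor_algebra x)"
    if "clinear h" for h :: "'v tensor_algebra \<Rightarrow> 'b"
    by (subst tensor_algebra_expansion) (simp add: word_lift_def free_lift_compose[OF that])
  show ?thesis
    unfolding *[OF assms(1)] *[OF assms(2)] by (simp add: assms(3))
qed

definition word_append :: "'v::complex_vector list \<Rightarrow> 'v list \<Rightarrow> 'v tensor_algebra"
  where "word_append us vs = (if us = [] \<or> vs = [] then 0 else word (us @ vs))"

lemma clinear_word: "clinear (\<lambda>v. word (us @ v # ws))"
  using multilinear_word unfolding multilinear_def by blast

lemma multilinear_word_append: "multilinear (word_append us)"
proof -
  have "clinear (\<lambda>v. word_append us (vs @ v # ws))" for vs ws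
  proof (cases "us = []")
    case True
    then show ?thesis by (simp add: word_append_def clinear_const_0)
  next
    case False
    then show ?thesis
      using clinear_word[of "us @ vs" ws] by (simp add: word_append_def)
  qed
  then show ?thesis
    by (simp add: multilinear_def word_append_def)
qed

lemma multilinear_word_append': "multilinear (\<lambda>us. word_append us vs)"
proof -
  have "clinear (\<lambda>v. word_append (us @ v # ws) vs)" for us ws
  proof (cases "vs = []")
    case True
    then show ?thesis by (simp add: word_append_def clinear_const_0)
  next
    case False
    then show ?thesis
      using clinear_word[of us "ws @ vs"] by (simp add: word_append_def)
  qed
  then show ?thesis
    by (simp add: multilinear_def word_append_def)
qed

instantiation tensor_algebra :: (complex_vector) complex_algebra
begin

definition times_tensor_algebra ::
    "'a tensor_algebra \<Rightarrow> 'a tensor_algebra \<Rightarrow> 'a tensor_algebra"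
  where "x * y = word_lift (\<lambda>us. word_lift (word_append us) y) x"

lemma multilinear_word_lift_append:
  fixes y :: "'b::complex_vector tensor_algebra"
  shows "multilinear (\<lambda>us. word_lift (word_append us) y)"
  unfolding multilinear_def
proof (intro conjI allI clinearI)
  note lin = clinear_word_lift[OF multilinear_word_append]
  note W = multilinear_word_append'[unfolded multilinear_def, THEN conjunct2, rule_format]
  show "word_lift (word_append []) y = (0 :: 'b tensor_algebra)"
    by (simp add: word_lift_def free_lift_def word_append_def)
  fix us ws :: "'b list" and a b c
  show "word_lift (word_append (us @ (a + b) # ws)) y =
      word_lift (word_append (us @ a # ws)) y + word_lift (word_append (us @ b # ws)) y"
    by (rule clinear_eq_on_words[OF lin complex_vector_pair.linear_compose_add[OF lin lin]])
      (simp add: multilinear_word_append clinear_add[OF W])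
  show "word_lift (word_append (us @ (c *\<^sub>C a) # ws)) y = c *\<^sub>C word_lift (word_append (us @ a # ws)) y"
    by (rule clinear_eq_on_words[OF lin complex_vector_pair.linear_compose_scale_right[OF lin]])
      (simp add: multilinear_word_append clinear_scale[OF W])
qed

lemma clinear_mult_right: "clinear (\<lambda>x :: 'a tensor_algebra. x * y)"
  unfolding times_tensor_algebra_def by (rule clinear_word_lift[OF multilinear_word_lift_append])

lemma clinear_mult_left: "clinear (\<lambda>y :: 'a tensor_algebra. x * y)"
proof -
  have *: "x * y = (\<Sum>us\<in>Poly_Mapping.keys (rep_tensor_algebra x).
      Poly_Mapping.lookup (rep_tensor_algebra x) us *\<^sub>C word_lift (word_append us) y)" for y :: "'a tensor_algebra"
    unfolding times_tensor_algebra_def word_lift_def[of _ x] free_lift_def[of _ "rep_tensor_algebra x"] ..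
  show ?thesis
    unfolding *
    by (intro complex_vector_pair.linear_compose_sum ballI
        complex_vector_pair.linear_compose_scale_right clinear_word_lift multilinear_word_append)
qed

lemma word_times_word: "word us * word vs = word_append (us :: 'a list) vs"
  by (simp add: times_tensor_algebra_def multilinear_word_append multilinear_word_append')

instance
proof
  fix x y z :: "'a tensor_algebra" and c
  show "(x + y) * z = x * z + y * z"
    by (rule clinear_add[OF clinear_mult_right])
  show "x * (y + z) = x * y + x * z"
    by (rule clinear_add[OF clinear_mult_left])
  show "(c *\<^sub>C x) * y = c *\<^sub>C (x * y)"
    by (rule clinear_scale[OF clinear_mult_right])
  show "x * (c *\<^sub>C y) = c *\<^sub>C (x * y)"
    by (rule clinear_scale[OF clinear_mult_left])
  have 0: "a * 0 = 0" "0 * a = 0" for a :: "'a tensor_algebra"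
    using complex_vector_pair.linear_0[OF clinear_mult_left[of a]]
      complex_vector_pair.linear_0[OF clinear_mult_right[of a]] by simp_all
  have 1: "(word us * word vs) * word ws = word us * (word vs * word ws)" for us vs ws :: "'a list"
    by (simp add: word_times_word word_append_def 0)
  have 2: "(word us * word vs) * z = word us * (word vs * z)" for us vs
    by (rule clinear_eq_on_words[of "\<lambda>z. (word us * word vs) * z" "\<lambda>z. word us * (word vs * z)"])
      (auto intro: clinear_mult_left clinear_compose[OF clinear_mult_left clinear_mult_left] simp: 1)
  have 3: "(word us * y) * z = word us * (y * z)" for us
    by (rule clinear_eq_on_words[of "\<lambda>y. (word us * y) * z" "\<lambda>y. word us * (y * z)"])
      (auto intro: clinear_compose[OF clinear_mult_left clinear_mult_right]
        clinear_compose[OF clinear_mult_right clinear_mult_left] simp: 2)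
  show "(x * y) * z = x * (y * z)"
    by (rule clinear_eq_on_words[of "\<lambda>x. (x * y) * z" "\<lambda>x. x * (y * z)"])
      (auto intro: clinear_compose[OF clinear_mult_right clinear_mult_right] clinear_mult_right simp: 3)
qed

end

text \<open>The diagonal action
  \<open>h (v\<^sub>0 \<otimes> \<dots> \<otimes> v\<^sub>n) = \<Sum> h\<^sub>0 v\<^sub>0 \<otimes> \<dots> \<otimes> h\<^sub>n v\<^sub>n\<close>, unfolded one letter at a
  time through \<open>\<Delta>\<close>.\<close>

fun word_action ::
    "('h::complex_algebra_1 \<Rightarrow> 'h \<otimes>\<^sub>t 'h) \<Rightarrow> ('h \<Rightarrow> 'v::complex_vector \<Rightarrow> 'v)
      \<Rightarrow> 'v list \<Rightarrow> 'h \<Rightarrow> 'v tensor_algebra"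
  where
    "word_action \<Delta> \<rho> [] h = 0"
  | "word_action \<Delta> \<rho> [v] h = word [\<rho> h v]"
  | "word_action \<Delta> \<rho> (v # w # ws) h =
       tensor_lift (\<lambda>a b. word [\<rho> a v] * word_action \<Delta> \<rho> (w # ws) b) (\<Delta> h)"

definition tensor_action ::
    "('h::complex_algebra_1 \<Rightarrow> 'h \<otimes>\<^sub>t 'h) \<Rightarrow> ('h \<Rightarrow> 'v::complex_vector \<Rightarrow> 'v)
      \<Rightarrow> 'h \<Rightarrow> 'v tensor_algebra \<Rightarrow> 'v tensor_algebra"
  where "tensor_action \<Delta> \<rho> h = word_lift (\<lambda>vs. word_action \<Delta> \<rho> vs h)"

definition cyclic :: "'v::complex_vector tensor_algebra \<Rightarrow> 'v tensor_algebra"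
  where "cyclic = word_lift (\<lambda>vs. word (rotate1 vs))"

definition norm_operator ::
    "('v::complex_vector tensor_algebra \<Rightarrow> 'v tensor_algebra) \<Rightarrow> 'v tensor_algebra \<Rightarrow> 'v tensor_algebra"
  where "norm_operator t = word_lift (\<lambda>vs. \<Sum>i<length vs. (t ^^ i) (word vs))"

text \<open>On a word with homogeneous letters of degrees \<open>ds\<close> the signed permutation multiplies the rotated
  word by the sign of moving the first letter past the others. Arbitrary letters are first
  decomposed into their homogeneous components.\<close>

definition graded_cyclic ::
    "(int \<Rightarrow> 'v::complex_vector set) \<Rightarrow> 'v tensor_algebra \<Rightarrow> 'v tensor_algebra"
  where "graded_cyclic G = word_lift (\<lambda>vs.
    \<Sum>ds | list_all2 (\<lambda>v d. component G v d \<noteq> 0) vs ds.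
      koszul (hd ds) (sum_list (tl ds)) *\<^sub>C word (rotate1 (map2 (component G) vs ds)))"

definition tensor_grading :: "(int \<Rightarrow> 'v::complex_vector set) \<Rightarrow> int \<Rightarrow> 'v tensor_algebra set"
  where "tensor_grading G n =
    cspan {word vs | vs ds. list_all2 (\<lambda>v d. v \<in> G d) vs ds \<and> sum_list ds = n}"


section \<open>Adjoining a unit\<close>

text \<open>\<open>Unitize c r\<close> is \<open>c + r\<close>.\<close>

datatype 'r unitization = Unitize (scalar_part: complex) (algebra_part: 'r)

instantiation unitization :: (complex_algebra) complex_algebra_1
begin

definition "0 = Unitize 0 0"
definition "1 = Unitize 1 0"
definition "x + y = Unitize (scalar_part x + scalar_part y) (algebra_part x + algebra_part y)"
definition "x - y = Unitize (scalar_part x - scalar_part y) (algebra_part x - algebra_part y)"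
definition "- x = Unitize (- scalar_part x) (- algebra_part x)"
definition "c *\<^sub>C x = Unitize (c * scalar_part x) (c *\<^sub>C algebra_part x)"
definition "x * y = Unitize (scalar_part x * scalar_part y)
  (scalar_part x *\<^sub>C algebra_part y + scalar_part y *\<^sub>C algebra_part x + algebra_part x * algebra_part y)"

instance
  by standard (simp_all add: zero_unitization_def one_unitization_def plus_unitization_def
      minus_unitization_def uminus_unitization_def scaleC_unitization_def times_unitization_def
      algebra_simps unitization.expand scaleC_add_left scaleC_add_right scaleC_scaleC scaleC_one
      mult_scaleC_left mult_scaleC_right)

end

definition unitization_action ::
    "('h::complex_algebra_1 \<Rightarrow> complex) \<Rightarrow> ('h \<Rightarrow> 'r::complex_algebra \<Rightarrow> 'r)
      \<Rightarrow> 'h \<Rightarrow> 'r unitization \<Rightarrow> 'r unitization"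
  where "unitization_action \<epsilon> \<rho> h x = Unitize (\<epsilon> h * scalar_part x) (\<rho> h (algebra_part x))"

definition unitization_grading :: "(int \<Rightarrow> 'r::complex_algebra set) \<Rightarrow> int \<Rightarrow> 'r unitization set"
  where "unitization_grading G p = {Unitize c r | c r. r \<in> G p \<and> (p = 0 \<or> c = 0)}"


section \<open>Non-commutative 1-forms and the localized X-complex\<close>

text \<open>\<open>x \<otimes> y\<close> stands for \<open>x dy\<close>.\<close>

type_synonym 'r forms = "'r unitization \<otimes>\<^sub>t 'r"

definition forms_left :: "'r::complex_algebra \<Rightarrow> 'r forms \<Rightarrow> 'r forms"
  where "forms_left r = tensor_lift (\<lambda>x y. (Unitize 0 r * x) \<otimes> y)"

text \<open>By the Leibniz rule, \<open>(x dy) r = x d(yr) - xy dr\<close>.\<close>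

definition forms_right :: "'r::complex_algebra forms \<Rightarrow> 'r \<Rightarrow> 'r forms"
  where "forms_right \<omega> r =
    tensor_lift (\<lambda>x y. x \<otimes> (y * r) - (x * Unitize 0 y) \<otimes> r) \<omega>"

definition forms_grading :: "(int \<Rightarrow> 'r::complex_algebra set) \<Rightarrow> int \<Rightarrow> 'r forms set"
  where "forms_grading G n =
    cspan {x \<otimes> y | x y p q. x \<in> unitization_grading G p \<and> y \<in> G q \<and> p + q = n}"

definition forms_action ::
    "('h::complex_algebra_1 \<Rightarrow> 'h \<otimes>\<^sub>t 'h) \<Rightarrow> ('h \<Rightarrow> complex)
      \<Rightarrow> ('h \<Rightarrow> 'r::complex_algebra \<Rightarrow> 'r) \<Rightarrow> 'h \<Rightarrow> 'r forms \<Rightarrow> 'r forms"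
  where "forms_action \<Delta> \<epsilon> \<rho> = diagonal_action \<Delta> (unitization_action \<epsilon> \<rho>) \<rho>"

definition forms_commutators :: "'r::complex_algebra forms set"
  where "forms_commutators = cspan {forms_right \<omega> r - forms_left r \<omega> | \<omega> r. True}"

definition graded_forms_commutators :: "(int \<Rightarrow> 'r::complex_algebra set) \<Rightarrow> 'r forms set"
  where "graded_forms_commutators G = cspan {forms_right \<omega> r - koszul p q *\<^sub>C forms_left r \<omega> | \<omega> r p q.
    \<omega> \<in> forms_grading G p \<and> r \<in> G q}"

definition commutator :: "'r::complex_algebra \<Rightarrow> 'r \<Rightarrow> 'r"
  where "commutator x y = x * y - y * x"

definition graded_commutator :: "(int \<Rightarrow> 'r::complex_algebra set) \<Rightarrow> 'r \<Rightarrow> 'r \<Rightarrow> 'r"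
  where "graded_commutator G x y = x * y -
    (\<Sum>p | component G x p \<noteq> 0. \<Sum>q | component G y q \<noteq> 0.
      koszul p q *\<^sub>C (component G y q * component G x p))"

text \<open>The subspaces \<open>X0_relations\<close> and \<open>X1_relations\<close> are those divided out of \<open>R\<close> and of the
  1-forms to get \<open>X\<^sup>0\<close> and \<open>X\<^sup>1\<close>; \<open>X_b\<close> and \<open>X_d\<close> are the boundaries before passing to the
  quotients. In \<open>X_b\<close> the scalar part of \<open>x\<close> is dropped since scalars are central of degree \<open>0\<close>.\<close>

definition X0_relations ::
    "('h::complex_algebra_1 \<Rightarrow> complex) \<Rightarrow> ('h \<Rightarrow> 'r::complex_algebra \<Rightarrow> 'r) \<Rightarrow> 'r set"
  where "X0_relations \<delta> \<rho> = coinvariants \<delta> \<rho>"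

definition X1_relations ::
    "('h::complex_algebra_1 \<Rightarrow> 'h \<otimes>\<^sub>t 'h) \<Rightarrow> ('h \<Rightarrow> complex) \<Rightarrow> ('h \<Rightarrow> complex)
      \<Rightarrow> ('h \<Rightarrow> 'r::complex_algebra \<Rightarrow> 'r) \<Rightarrow> 'r forms set"
  where "X1_relations \<Delta> \<epsilon> \<delta> \<rho> = forms_commutators + coinvariants \<delta> (forms_action \<Delta> \<epsilon> \<rho>)"

definition graded_X1_relations ::
    "(int \<Rightarrow> 'r set) \<Rightarrow> ('h::complex_algebra_1 \<Rightarrow> 'h \<otimes>\<^sub>t 'h) \<Rightarrow> ('h \<Rightarrow> complex) \<Rightarrow> ('h \<Rightarrow> complex)
      \<Rightarrow> ('h \<Rightarrow> 'r::complex_algebra \<Rightarrow> 'r) \<Rightarrow> 'r forms set"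
  where "graded_X1_relations G \<Delta> \<epsilon> \<delta> \<rho> =
    graded_forms_commutators G + coinvariants \<delta> (forms_action \<Delta> \<epsilon> \<rho>)"

definition X_b :: "'r::complex_algebra forms \<Rightarrow> 'r"
  where "X_b = tensor_lift (\<lambda>x y. commutator (algebra_part x) y)"

definition graded_X_b :: "(int \<Rightarrow> 'r::complex_algebra set) \<Rightarrow> 'r forms \<Rightarrow> 'r"
  where "graded_X_b G = tensor_lift (\<lambda>x y. graded_commutator G (algebra_part x) y)"

definition X_d :: "'r::complex_algebra \<Rightarrow> 'r forms"
  where "X_d x = 1 \<otimes> x"

text \<open>The isomorphism \<open>(\<Phi>\<^sub>0, \<Phi>\<^sub>1)\<close> from the quotient super-complex
  \<open>b : A\<^sub>1/U\<^sub>1 \<rightleftharpoons> A\<^sub>0/U\<^sub>0 : d\<close> to the quotient super-complex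
  \<open>b' : B\<^sub>1/W\<^sub>1 \<rightleftharpoons> B\<^sub>0/W\<^sub>0 : d'\<close>. The first two lines say that all four boundaries descend.\<close>

definition quotient_supercomplex_iso ::
    "'a0::complex_vector set \<Rightarrow> 'a1::complex_vector set \<Rightarrow> ('a1 \<Rightarrow> 'a0) \<Rightarrow> ('a0 \<Rightarrow> 'a1) \<Rightarrow>
     'b0::complex_vector set \<Rightarrow> 'b1::complex_vector set \<Rightarrow> ('b1 \<Rightarrow> 'b0) \<Rightarrow> ('b0 \<Rightarrow> 'b1) \<Rightarrow>
     ('a0 set \<Rightarrow> 'b0 set) \<Rightarrow> ('a1 set \<Rightarrow> 'b1 set) \<Rightarrow> bool"
  where "quotient_supercomplex_iso U0 U1 b d W0 W1 b' d' \<Phi>0 \<Phi>1 \<longleftrightarrow>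
    b ` U1 \<subseteq> U0 \<and> d ` U0 \<subseteq> U1 \<and>
    b' ` W1 \<subseteq> W0 \<and> d' ` W0 \<subseteq> W1 \<and>
    quotient_iso U0 W0 \<Phi>0 \<and> quotient_iso U1 W1 \<Phi>1 \<and>
    (\<forall>A \<in> quotient_space U1. \<Phi>0 (quotient_map b U0 A) = quotient_map b' W0 (\<Phi>1 A)) \<and>
    (\<forall>A \<in> quotient_space U0. \<Phi>1 (quotient_map d U1 A) = quotient_map d' W1 (\<Phi>0 A))"

end

theory Submission
  imports Defs
begin

text \<open>
  Modulo commutators \<open>x d(v\<^sub>1 \<dots> v\<^sub>n)\<close> equals \<open>\<Sum>\<^sub>i v\<^sub>i\<^sub>+\<^sub>1 \<dots> v\<^sub>n x v\<^sub>1 \<dots> v\<^sub>i\<^sub>-\<^sub>1 dv\<^sub>i\<close>,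
  and \<open>x dv \<mapsto> v x\<close> (with sign) identifies \<open>\<Omega>\<^sup>1(R)\<close> modulo commutators with \<open>T(V)\<close>, through a map \<open>\<Psi>\<close> with section \<open>\<sigma>\<close>. Both maps
  permute tensor factors cyclically, so they need not commute with the diagonal action. What makes
  them respect coinvariants is that in \<open>(M \<otimes> N)\<^sub>\<delta>\<close> one has \<open>h m \<otimes> n = m \<otimes> S\<^sub>\<delta>(h) n\<close>, and hence, as
  \<open>S\<^sub>\<delta>\<close> is an involution, \<open>m \<otimes> h n = S\<^sub>\<delta>(h) m \<otimes> n\<close>; therefore
  \<open>\<Sum> h\<^sub>1 m \<otimes> h\<^sub>0 n = \<Sum> S\<^sub>\<delta>(h\<^sub>0) h\<^sub>1 m \<otimes> n = \<delta>(h) m \<otimes> n\<close>.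
  The ungraded case is the graded one for \<open>V\<close> concentrated in degree \<open>0\<close>.
\<close>

section \<open>Linear and bilinear maps\<close>

text \<open>The exchange of legs concerns two tensor factors, while N and \<Psi> involve long
  rotations. But t carries one letter past the rest, so taking n to be that letter and m the product
  of the others shows that t preserves the coinvariants; powers of t follow. Everything else is
  expressed through t. On homogeneous words, \<Psi>(x dy) is a sum of powers of t applied to the
  product x y, and this product is equivariant. Before any quotient is taken, b = (t - 1) \<Psi>, by
  a telescoping sum closed by a full rotation, and N = \<Psi> d. So both boundaries match as soon as
  \<Psi> and \<sigma> carry the relation spaces into each other.

  The second obstacle is the signs. They make sense only for homogeneous letters, and H turns a word
  into a sum of words. As H acts by operators of degree 0, the list of letter degrees is preserved.
  Hence identities are proved on words with homogeneous letters and extended to the span of all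
  words with the same degree list, where the length and every Koszul sign are constant.\<close>

lemmas clinear_0 = complex_vector_pair.linear_0
  and clinear_diff = complex_vector_pair.linear_diff
  and clinear_sum = complex_vector_pair.linear_sum

lemmas csubspace_cspan = complex_vector.subspace_span

named_theorems clinear_intros

declare clinear_const_0 [clinear_intros]

lemma clinear_ident [clinear_intros]: "clinear (\<lambda>x. x)"
  by (intro clinearI) simp_all

lemma clinear_plus [clinear_intros]: "clinear f \<Longrightarrow> clinear g \<Longrightarrow> clinear (\<lambda>x. f x + g x)"
  by (rule complex_vector_pair.linear_compose_add)

lemma clinear_minus [clinear_intros]: "clinear f \<Longrightarrow> clinear g \<Longrightarrow> clinear (\<lambda>x. f x - g x)"
  by (rule complex_vector_pair.linear_compose_sub)

lemma clinear_setsum [clinear_intros]: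
  "(\<And>i. i \<in> A \<Longrightarrow> clinear (f i)) \<Longrightarrow> clinear (\<lambda>x. \<Sum>i\<in>A. f i x)"
  by (rule complex_vector_pair.linear_compose_sum) blast

lemma clinear_scaleC_right [clinear_intros]: "clinear f \<Longrightarrow> clinear (\<lambda>x. c *\<^sub>C f x)"
  by (rule complex_vector_pair.linear_compose_scale_right)

lemma clinear_scaleC_left [clinear_intros]: "clinear f \<Longrightarrow> clinear (\<lambda>x. f x *\<^sub>C v)"
  by (intro clinearI)
    (simp_all add: clinear_add clinear_scale scaleC_add_left scaleC_scaleC scaleC_complex_def)

lemma clinear_mult_const [clinear_intros]:
  fixes a :: "'a::complex_algebra"
  shows "clinear f \<Longrightarrow> clinear (\<lambda>x. a * f x)" "clinear f \<Longrightarrow> clinear (\<lambda>x. f x * a)"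
  using clinear_compose clinear_times by blast+

lemma clinear_pure_tensor [clinear_intros]:
  "clinear f \<Longrightarrow> clinear (\<lambda>x. a \<otimes> f x)" "clinear f \<Longrightarrow> clinear (\<lambda>x. f x \<otimes> b)"
  using clinear_compose[of f "\<lambda>y. a \<otimes> y"] clinear_compose[of f "\<lambda>y. y \<otimes> b"] cbilinear_pure_tensor
  by (auto simp: cbilinear_def)

lemma clinear_funpow:
  fixes f :: "'a::complex_vector \<Rightarrow> 'a"
  shows "clinear f \<Longrightarrow> clinear (f ^^ n)"
proof (induction n)
  case 0
  have "f ^^ 0 = (\<lambda>x. x)" by (simp add: fun_eq_iff)
  then show ?case by (simp only: clinear_ident)
next
  case (Suc n)
  then show ?case unfolding funpow.simps comp_def by (intro clinear_compose[of "f ^^ n" f])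
qed

lemma clinear_funpow_arg [clinear_intros]:
  fixes f :: "'a::complex_vector \<Rightarrow> 'a"
  shows "clinear f \<Longrightarrow> clinear g \<Longrightarrow> clinear (\<lambda>x. (f ^^ n) (g x))"
  by (rule clinear_compose[OF _ clinear_funpow])

lemma clinear_free_lift_param:
  assumes "\<And>k. clinear (\<lambda>p. F p k)"
  shows "clinear (\<lambda>p. free_lift (F p) f)"
  unfolding free_lift_def by (intro clinear_intros assms)

text \<open>The tensor is fixed and the map varies, so every value is a finite sum over one and the
  same representative.\<close>

lemma clinear_tensor_lift_param [clinear_intros]:
  assumes "\<And>a b. clinear (\<lambda>p. B p a b)"
  shows "clinear (\<lambda>p. tensor_lift (B p) x)"
  unfolding tensor_lift_def by (rule clinear_free_lift_param) (auto simp: assms)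

lemma clinear_word_lift_param [clinear_intros]:
  assumes "\<And>vs. clinear (\<lambda>p. F p vs)"
  shows "clinear (\<lambda>p. word_lift (F p) x)"
  unfolding word_lift_def by (rule clinear_free_lift_param) (auto simp: assms)

lemma clinear_tensor_lift_arg [clinear_intros]:
  "cbilinear B \<Longrightarrow> clinear f \<Longrightarrow> clinear (\<lambda>p. tensor_lift B (f p))"
  by (rule clinear_compose[OF _ clinear_tensor_lift])

lemma clinear_word_lift_arg [clinear_intros]:
  "multilinear F \<Longrightarrow> clinear f \<Longrightarrow> clinear (\<lambda>p. word_lift F (f p))"
  by (rule clinear_compose[OF _ clinear_word_lift])

lemma clinear_word_letter [clinear_intros]:
  assumes "clinear f"
  shows "clinear (\<lambda>x. word (us @ f x # ws))" "clinear (\<lambda>x. word (f x # ws))"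
  using clinear_compose[OF assms clinear_word[of us ws]] clinear_compose[OF assms clinear_word[of "[]" ws]]
  by auto

lemma cbilinearI [clinear_intros]:
  "(\<And>a. clinear (\<lambda>b. B a b)) \<Longrightarrow> (\<And>b. clinear (\<lambda>a. B a b)) \<Longrightarrow> cbilinear B"
  by (simp add: cbilinear_def)

lemma cbilinear_clinear:
  assumes "cbilinear B"
  shows "clinear f \<Longrightarrow> clinear (\<lambda>x. B a (f x))" "clinear g \<Longrightarrow> clinear (\<lambda>x. B (g x) b)"
  using assms clinear_compose[of f "B a"] clinear_compose[of g "\<lambda>a. B a b"] by (auto simp: cbilinear_def)

text \<open>Used in two ways: with \<open>U = {0}\<close> it extends an identity from generators to
  their span, and with a relation space \<open>U\<close> it extends a congruence.\<close>

lemma cspan_image_subset: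
  assumes "clinear f" "csubspace U" "\<And>s. s \<in> A \<Longrightarrow> f s \<in> U" "x \<in> cspan A"
  shows "f x \<in> U"
  using assms(4)
proof (induction rule: complex_vector.span_induct_alt)
  case base
  then show ?case using assms by (simp add: clinear_0 complex_vector.subspace_0)
next
  case (step c s y)
  then show ?case using assms
    by (simp add: clinear_add clinear_scale complex_vector.subspace_add complex_vector.subspace_scale)
qed

lemma cspan_image2_subset:
  assumes "cbilinear B" "csubspace U" "\<And>s t. s \<in> A \<Longrightarrow> t \<in> A' \<Longrightarrow> B s t \<in> U"
    and "x \<in> cspan A" "y \<in> cspan A'"
  shows "B x y \<in> U"
proof (rule cspan_image_subset[of "\<lambda>x. B x y", OF _ assms(2) _ assms(4)])
  show "clinear (\<lambda>x. B x y)" using assms(1) by (simp add: cbilinear_def)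
  fix s assume "s \<in> A"
  then show "B s y \<in> U"
    using assms by (intro cspan_image_subset[of "B s", OF _ assms(2) _ assms(5)]) (auto simp: cbilinear_def)
qed

lemma csubspace_set_plus: "csubspace A \<Longrightarrow> csubspace B \<Longrightarrow> csubspace (A + B)"
proof -
  have "A + B = {x + y |x y. x \<in> A \<and> y \<in> B}" by (auto simp: set_plus_def)
  then show "csubspace A \<Longrightarrow> csubspace B \<Longrightarrow> csubspace (A + B)"
    by (simp add: complex_vector.subspace_sums)
qed


section \<open>Linear maps on tensor products\<close>

lemma free_lift_in_csubspace:
  assumes "csubspace U" "\<And>k. F k \<in> U"
  shows "free_lift F f \<in> U"
  unfolding free_lift_def
  using assms by (intro complex_vector.subspace_sum complex_vector.subspace_scale) auto

lemma tensor_lift_in_csubspace: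
  "csubspace U \<Longrightarrow> (\<And>a b. B a b \<in> U) \<Longrightarrow> tensor_lift B x \<in> U"
  unfolding tensor_lift_def by (rule free_lift_in_csubspace) auto

text \<open>Both sides are the same finite sum over one representative of \<open>x\<close>, with
  \<open>g\<close> moved inside.\<close>

lemma tensor_lift_compose:
  "clinear g \<Longrightarrow> g (tensor_lift B x) = tensor_lift (\<lambda>a b. g (B a b)) x"
  unfolding tensor_lift_def by (simp add: free_lift_compose split_def)

lemma clinear_abs_tensor: "clinear abs_tensor"
  by (rule clinearI) (simp_all add: plus_tensor.abs_eq scaleC_tensor.abs_eq)

lemma tensor_expansion: "x = tensor_lift (\<otimes>) x"
proof (induct x)
  fix f :: "'a \<times> 'b \<Rightarrow>\<^sub>0 complex"
  have "abs_tensor f = abs_tensor (free_lift free f)"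
    using free_expansion[of f] by simp
  also have "\<dots> = free_lift (\<lambda>(a, b). a \<otimes> b) f"
    by (simp add: free_lift_compose[OF clinear_abs_tensor] pure_tensor.abs_eq split_def)
  also have "\<dots> = tensor_lift (\<otimes>) (abs_tensor f)"
    by (simp add: tensor_lift_abs cbilinear_pure_tensor)
  finally show "abs_tensor f = tensor_lift (\<otimes>) (abs_tensor f)" .
qed

lemma clinear_eq_on_tensors:
  assumes "clinear f" "clinear g" "\<And>a b. f (a \<otimes> b) = g (a \<otimes> b)"
  shows "f x = g x"
proof -
  have *: "h x = tensor_lift (\<lambda>a b. h (a \<otimes> b)) x" if "clinear h" for h :: "_ \<Rightarrow> 'c"
    by (subst tensor_expansion) (rule tensor_lift_compose[OF that])
  show ?thesis
    by (subst (1 2) *) (simp_all add: assms)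
qed

lemma tensor_in_cspan: "x \<in> cspan {a \<otimes> b | a b. True}"
proof -
  have "tensor_lift (\<otimes>) x \<in> cspan {a \<otimes> b | a b. True}"
    by (rule tensor_lift_in_csubspace[OF csubspace_cspan]) (blast intro: complex_vector.span_base)
  then show ?thesis by (simp only: tensor_expansion[symmetric])
qed

lemma tensor_map_pure:
  assumes "clinear f" "clinear g"
  shows "tensor_map f g (a \<otimes> b) = f a \<otimes> g b"
  unfolding tensor_map_def
  by (rule tensor_lift_pure) (intro clinear_intros assms)

lemma clinear_tensor_map:
  assumes "clinear f" "clinear g"
  shows "clinear (tensor_map f g)"
  unfolding tensor_map_def
  by (rule clinear_tensor_lift) (intro clinear_intros assms)

lemma tensor_lift_map:
  assumes "clinear f" "clinear g" "cbilinear B"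
  shows "tensor_lift B (tensor_map f g x) = tensor_lift (\<lambda>a b. B (f a) (g b)) x"
proof (rule clinear_eq_on_tensors[of _ _ x])
  have 1: "cbilinear (\<lambda>a b. B (f a) (g b))"
    by (intro clinear_intros cbilinear_clinear[OF assms(3)] assms)
  show "clinear (\<lambda>x. tensor_lift B (tensor_map f g x))" "clinear (tensor_lift (\<lambda>a b. B (f a) (g b)))"
    by (intro clinear_intros clinear_tensor_lift clinear_tensor_map assms 1)+
  show "tensor_lift B (tensor_map f g (a \<otimes> b)) = tensor_lift (\<lambda>a b. B (f a) (g b)) (a \<otimes> b)" for a b
    by (simp add: tensor_map_pure assms 1)
qed

lemma tensor_lift_mult:
  fixes B :: "'a::complex_algebra \<Rightarrow> 'b::complex_algebra \<Rightarrow> 'c::complex_vector"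
  assumes "cbilinear B"
  shows "tensor_lift B (tensor_mult x y) =
    tensor_lift (\<lambda>a b. tensor_lift (\<lambda>a' b'. B (a * a') (b * b')) y) x"
proof -
  have "tensor_lift B (tensor_mult x y) =
      tensor_lift (\<lambda>a b. tensor_lift (\<lambda>a' b'. tensor_lift B ((a * a') \<otimes> (b * b'))) y) x"
    unfolding tensor_mult_def by (simp only: tensor_lift_compose[OF clinear_tensor_lift[OF assms]])
  then show ?thesis by (simp add: assms)
qed

text \<open>Fubini for two independent Sweedler sums.\<close>

lemma tensor_lift_swap:
  assumes "\<And>a b. cbilinear (B a b)" "\<And>a' b'. cbilinear (\<lambda>a b. B a b a' b')"
  shows "tensor_lift (\<lambda>a b. tensor_lift (B a b) y) x = tensor_lift (\<lambda>a' b'. tensor_lift (\<lambda>a b. B a b a' b') x) y"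
proof (rule clinear_eq_on_tensors[of _ _ x])
  have 1: "cbilinear (\<lambda>a b. tensor_lift (B a b) y)"
    by (intro clinear_intros) (use assms(2) in \<open>auto simp: cbilinear_def\<close>)
  show "clinear (tensor_lift (\<lambda>a b. tensor_lift (B a b) y))"
    by (intro clinear_tensor_lift 1)
  show "clinear (\<lambda>x. tensor_lift (\<lambda>a' b'. tensor_lift (\<lambda>a b. B a b a' b') x) y)"
    by (intro clinear_intros assms)
  show "tensor_lift (\<lambda>a b. tensor_lift (B a b) y) (a \<otimes> b) =
      tensor_lift (\<lambda>a' b'. tensor_lift (\<lambda>a b. B a b a' b') (a \<otimes> b)) y" for a b
    by (simp add: 1 assms)
qed

text \<open>Removes \<open>tensor_assoc\<close> from under iterated lifts, which turns the
  coassociativity axiom into a rule for triple Sweedler sums.\<close>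

lemma tensor_lift_assoc:
  assumes "\<And>a b. clinear (F a b)" "\<And>a c. clinear (\<lambda>b. F a b c)" "\<And>b c. clinear (\<lambda>a. F a b c)"
  shows "tensor_lift (\<lambda>a. tensor_lift (F a)) (tensor_assoc x) = tensor_lift (\<lambda>y c. tensor_lift (\<lambda>a b. F a b c) y) x"
proof (rule clinear_eq_on_tensors[of _ _ x])
  let ?L = "tensor_lift (\<lambda>a. tensor_lift (F a))"
  have 1: "cbilinear (\<lambda>a. tensor_lift (F a))" "cbilinear (\<lambda>y c. tensor_lift (\<lambda>a b. F a b c) y)"
    by (intro clinear_intros assms clinear_tensor_lift)+
  have 2: "cbilinear (\<lambda>x c. tensor_lift (\<lambda>a b. a \<otimes> b \<otimes> c) x)"
    by (intro clinear_intros)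
  have 3: "cbilinear (\<lambda>a b. F a b c)" "cbilinear (F a)" for a c
    by (intro clinear_intros assms)+
  show "clinear (\<lambda>x. ?L (tensor_assoc x))"
    unfolding tensor_assoc_def by (intro clinear_intros 1 2)
  show "clinear (tensor_lift (\<lambda>y c. tensor_lift (\<lambda>a b. F a b c) y))"
    by (rule clinear_tensor_lift[OF 1(2)])
  fix y c
  have "?L (tensor_lift (\<lambda>a b. a \<otimes> b \<otimes> c) y) = tensor_lift (\<lambda>a b. ?L (a \<otimes> b \<otimes> c)) y"
    by (rule tensor_lift_compose[OF clinear_tensor_lift[OF 1(1)]])
  then show "?L (tensor_assoc (y \<otimes> c)) = tensor_lift (\<lambda>y c. tensor_lift (\<lambda>a b. F a b c) y) (y \<otimes> c)"
    unfolding tensor_assoc_def by (simp add: 1 2 3)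
qed


section \<open>Coinvariants of a diagonal tensor product\<close>

lemma hmodule_cbilinear: "hmodule \<rho> \<Longrightarrow> cbilinear \<rho>"
  and hmodule_one: "hmodule \<rho> \<Longrightarrow> \<rho> 1 m = m"
  and hmodule_mult: "hmodule \<rho> \<Longrightarrow> \<rho> (g * h) m = \<rho> g (\<rho> h m)"
  by (auto simp: hmodule_def)

lemmas hmodule_clinear = cbilinear_clinear[OF hmodule_cbilinear]

lemma csubspace_coinvariants: "csubspace (coinvariants \<delta> \<rho>)"
  unfolding coinvariants_def by (rule csubspace_cspan)

lemma coinvariants_base: "\<rho> h m - \<delta> h *\<^sub>C m \<in> coinvariants \<delta> \<rho>"
  unfolding coinvariants_def by (rule complex_vector.span_base) blast

section \<open>Sweedler calculus and the twisted antipode\<close>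

locale twisted_hopf_algebra =
  fixes \<Delta> :: "'h::complex_algebra_1 \<Rightarrow> 'h \<otimes>\<^sub>t 'h"
    and \<epsilon> \<delta> :: "'h \<Rightarrow> complex"
    and S :: "'h \<Rightarrow> 'h"
  assumes hopf: "hopf_algebra \<Delta> \<epsilon> S"
    and character: "character \<delta>"
    and involutive: "twisted_antipode \<Delta> S \<delta> \<circ> twisted_antipode \<Delta> S \<delta> = id"
begin

text \<open>Sweedler notation: the sum of F(h_0, h_1).\<close>

abbreviation sweedler :: "('h \<Rightarrow> 'h \<Rightarrow> 'c::complex_vector) \<Rightarrow> 'h \<Rightarrow> 'c"
  where "sweedler F h \<equiv> tensor_lift F (\<Delta> h)"

abbreviation S\<delta> :: "'h \<Rightarrow> 'h"
  where "S\<delta> \<equiv> twisted_antipode \<Delta> S \<delta>"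

lemma clinear_hopf: "clinear \<Delta>" "clinear \<epsilon>" "clinear S" "clinear \<delta>"
  using hopf character by (auto simp: hopf_algebra_def character_def)

lemmas clinear_hopf_arg [clinear_intros] = clinear_hopf[THEN clinear_compose[rotated]]

lemma comult_one: "\<Delta> 1 = 1 \<otimes> 1" and comult_mult: "\<Delta> (g * h) = tensor_mult (\<Delta> g) (\<Delta> h)"
  and counit_one: "\<epsilon> 1 = 1" and counit_mult: "\<epsilon> (g * h) = \<epsilon> g * \<epsilon> h"
  and antipode_left: "sweedler (\<lambda>a b. S a * b) h = \<epsilon> h *\<^sub>C 1"
  and antipode_right: "sweedler (\<lambda>a b. a * S b) h = \<epsilon> h *\<^sub>C 1"
  using hopf by (auto simp: hopf_algebra_def)

lemma counit_left:
  assumes "clinear f"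
  shows "sweedler (\<lambda>a b. \<epsilon> a *\<^sub>C f b) h = f h"
proof -
  have "sweedler (\<lambda>a b. \<epsilon> a *\<^sub>C b) h = h" using hopf by (auto simp: hopf_algebra_def)
  then show ?thesis
    using tensor_lift_compose[OF assms, of "\<lambda>a b. \<epsilon> a *\<^sub>C b" "\<Delta> h"] by (simp add: clinear_scale[OF assms])
qed

lemma counit_right:
  assumes "clinear f"
  shows "sweedler (\<lambda>a b. \<epsilon> b *\<^sub>C f a) h = f h"
proof -
  have "sweedler (\<lambda>a b. \<epsilon> b *\<^sub>C a) h = h" using hopf by (auto simp: hopf_algebra_def)
  then show ?thesis
    using tensor_lift_compose[OF assms, of "\<lambda>a b. \<epsilon> b *\<^sub>C a" "\<Delta> h"] by (simp add: clinear_scale[OF assms])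
qed

text \<open>Both sides are the sum of F(h_0, h_1, h_2); the left one splits the second leg again,
  the right one the first.\<close>

lemma coassoc:
  assumes "\<And>a b. clinear (F a b)" "\<And>a c. clinear (\<lambda>b. F a b c)" "\<And>b c. clinear (\<lambda>a. F a b c)"
  shows "sweedler (\<lambda>a. sweedler (F a)) h = sweedler (\<lambda>y c. sweedler (\<lambda>a b. F a b c) y) h"
proof -
  have 1: "cbilinear (\<lambda>a. tensor_lift (F a))" "cbilinear (\<lambda>y c. tensor_lift (\<lambda>a b. F a b c) y)"
    by (intro clinear_intros assms clinear_tensor_lift)+
  have "sweedler (\<lambda>a. sweedler (F a)) h = tensor_lift (\<lambda>a. tensor_lift (F a)) (tensor_map id \<Delta> (\<Delta> h))"
    using tensor_lift_map[OF _ clinear_hopf(1) 1(1), of id "\<Delta> h"] by (simp add: id_def clinear_ident)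
  also have "tensor_map id \<Delta> (\<Delta> h) = tensor_assoc (tensor_map \<Delta> id (\<Delta> h))"
    using hopf by (auto simp: hopf_algebra_def)
  also have "tensor_lift (\<lambda>a. tensor_lift (F a)) \<dots> =
      tensor_lift (\<lambda>y c. tensor_lift (\<lambda>a b. F a b c) y) (tensor_map \<Delta> id (\<Delta> h))"
    by (rule tensor_lift_assoc[OF assms])
  also have "\<dots> = sweedler (\<lambda>y c. sweedler (\<lambda>a b. F a b c) y) h"
    using tensor_lift_map[OF clinear_hopf(1) _ 1(2), of id "\<Delta> h"] by (simp add: id_def clinear_ident)
  finally show ?thesis .
qed

text \<open>S_\<delta>(h_0) h_1 = \<delta>(h_0) S(h_1) h_2 = \<delta>(h_0) \<epsilon>(h_1) =
  \<delta>(h): coassociativity brings S(h_1) h_2 together, and the counit absorbs what the antipode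
  axiom leaves.\<close>

lemma twisted_antipode_left: "sweedler (\<lambda>a b. S\<delta> a * b) h = \<delta> h *\<^sub>C 1"
proof -
  have "S\<delta> a * b = sweedler (\<lambda>c d. \<delta> c *\<^sub>C (S d * b)) a" for a b
    unfolding twisted_antipode_def
    by (subst tensor_lift_compose[of "\<lambda>x. x * b"]) (simp_all add: clinear_times mult_scaleC_left)
  then have "sweedler (\<lambda>a b. S\<delta> a * b) h = sweedler (\<lambda>a b. sweedler (\<lambda>c d. \<delta> c *\<^sub>C (S d * b)) a) h"
    by simp
  also have "\<dots> = sweedler (\<lambda>a. sweedler (\<lambda>b c. \<delta> a *\<^sub>C (S b * c))) h"
    by (rule coassoc[symmetric]) (intro clinear_intros)+
  also have "\<dots> = sweedler (\<lambda>a b. \<delta> a *\<^sub>C sweedler (\<lambda>b c. S b * c) b) h"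
    by (subst tensor_lift_compose[of "\<lambda>x. _ *\<^sub>C x"]) (intro clinear_intros refl)+
  also have "\<dots> = sweedler (\<lambda>a b. \<epsilon> b *\<^sub>C (\<delta> a *\<^sub>C 1)) h"
    by (simp add: antipode_left scaleC_scaleC mult.commute)
  also have "\<dots> = \<delta> h *\<^sub>C 1"
    by (rule counit_right) (intro clinear_intros)
  finally show ?thesis .
qed

section \<open>Moving the action across a tensor product modulo coinvariants\<close>

context
  fixes \<rho> :: "'h \<Rightarrow> 'm::complex_vector \<Rightarrow> 'm" and \<sigma> :: "'h \<Rightarrow> 'n::complex_vector \<Rightarrow> 'n"
  assumes \<rho>: "hmodule \<rho>" and \<sigma>: "hmodule \<sigma>"
begin

lemma diagonal_action_pure:
  "diagonal_action \<Delta> \<rho> \<sigma> h (m \<otimes> n) = sweedler (\<lambda>a b. \<rho> a m \<otimes> \<sigma> b n) h"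
  unfolding diagonal_action_def
  by (subst tensor_map_pure) (simp_all add: hmodule_clinear[OF \<rho>] hmodule_clinear[OF \<sigma>] clinear_ident)

lemma clinear_diagonal_action: "clinear (diagonal_action \<Delta> \<rho> \<sigma> h)"
  unfolding diagonal_action_def
  by (intro clinear_intros clinear_tensor_map hmodule_clinear[OF \<rho>] hmodule_clinear[OF \<sigma>])

abbreviation (input) "D \<equiv> diagonal_action \<Delta> \<rho> \<sigma>"

text \<open>Integration by parts: h m \<otimes> n is the sum of h_0 m \<otimes> h_1 S(h_2) n, that
  is, of the diagonal h_0 applied to m \<otimes> S(h_1) n. Modulo coinvariants the diagonal h_0
  becomes the scalar \<delta>(h_0), and \<delta>(h_0) S(h_1) is S_\<delta>(h).\<close>

lemma coinvariants_by_parts: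
  "\<rho> h m \<otimes> n - m \<otimes> \<sigma> (S\<delta> h) n \<in> coinvariants \<delta> D"
proof -
  note lin = clinear_intros hmodule_clinear[OF \<rho>] hmodule_clinear[OF \<sigma>]
  have "sweedler (\<lambda>a b. D a (m \<otimes> \<sigma> (S b) n)) h =
      sweedler (\<lambda>y c. sweedler (\<lambda>a b. \<rho> a m \<otimes> \<sigma> (b * S c) n) y) h"
    by (simp add: diagonal_action_pure hmodule_mult[OF \<sigma>])
  also have "\<dots> = sweedler (\<lambda>a. sweedler (\<lambda>b c. \<rho> a m \<otimes> \<sigma> (b * S c) n)) h"
    by (rule coassoc[symmetric]) (intro lin)+
  also have "\<dots> = sweedler (\<lambda>a b. \<rho> a m \<otimes> \<sigma> (sweedler (\<lambda>b c. b * S c) b) n) h"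
    by (subst tensor_lift_compose[of "\<lambda>x. _ \<otimes> \<sigma> x n"]) (intro lin refl)+
  also have "\<dots> = sweedler (\<lambda>a b. \<epsilon> b *\<^sub>C (\<rho> a m \<otimes> n)) h"
    by (simp add: antipode_right clinear_scale[OF hmodule_clinear(2)[OF \<sigma> clinear_ident]]
        clinear_scale[OF clinear_pure_tensor(1)[OF clinear_ident]] hmodule_one[OF \<sigma>])
  also have "\<dots> = \<rho> h m \<otimes> n"
    by (rule counit_right) (intro lin)
  finally have 1: "\<rho> h m \<otimes> n = sweedler (\<lambda>a b. D a (m \<otimes> \<sigma> (S b) n)) h" ..
  have 2: "m \<otimes> \<sigma> (S\<delta> h) n = sweedler (\<lambda>a b. \<delta> a *\<^sub>C (m \<otimes> \<sigma> (S b) n)) h"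
    unfolding twisted_antipode_def
    by (subst tensor_lift_compose[of "\<lambda>x. m \<otimes> \<sigma> x n"])
      (simp_all add: lin clinear_scale[OF hmodule_clinear(2)[OF \<sigma> clinear_ident]]
        clinear_scale[OF clinear_pure_tensor(1)[OF clinear_ident]])
  have "\<rho> h m \<otimes> n - m \<otimes> \<sigma> (S\<delta> h) n =
      sweedler (\<lambda>a b. D a (m \<otimes> \<sigma> (S b) n) - \<delta> a *\<^sub>C (m \<otimes> \<sigma> (S b) n)) h"
    unfolding 1 2 by (simp add: tensor_lift_def free_lift_def split_def sum_subtractf
        complex_vector.scale_right_diff_distrib)
  also have "\<dots> \<in> coinvariants \<delta> D"
    by (intro tensor_lift_in_csubspace csubspace_coinvariants coinvariants_base)
  finally show ?thesis .
qed

text \<open>A substitute for cocommutativity: the legs of the coproduct act in the order opposite to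
  the diagonal action, and modulo coinvariants this still amounts to multiplication by
  \<open>\<delta> h\<close>.\<close>

lemma coinvariants_flip:
  "sweedler (\<lambda>a b. \<rho> b m \<otimes> \<sigma> a n) h - \<delta> h *\<^sub>C (m \<otimes> n) \<in> coinvariants \<delta> D"
proof -
  note lin = clinear_intros hmodule_clinear[OF \<rho>] hmodule_clinear[OF \<sigma>]
  let ?C = "coinvariants \<delta> D"
  \<comment> \<open>Integration by parts for \<open>S\<delta> a\<close>; applying
    \<open>S\<delta>\<close> a second time returns \<open>a\<close>. The involution hypothesis
    enters only here.\<close>
  have 1: "\<rho> (S\<delta> a) m' \<otimes> n - m' \<otimes> \<sigma> a n \<in> ?C" for a m'
    using coinvariants_by_parts[of "S\<delta> a" m' n] involutive by (simp add: fun_eq_iff)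
  have "\<delta> h *\<^sub>C (m \<otimes> n) = \<rho> (sweedler (\<lambda>a b. S\<delta> a * b) h) m \<otimes> n"
    by (simp add: twisted_antipode_left clinear_scale[OF hmodule_clinear(2)[OF \<rho> clinear_ident]]
        clinear_scale[OF clinear_pure_tensor(2)[OF clinear_ident]] hmodule_one[OF \<rho>])
  also have "\<dots> = sweedler (\<lambda>a b. \<rho> (S\<delta> a) (\<rho> b m) \<otimes> n) h"
    unfolding hmodule_mult[OF \<rho>, symmetric]
    by (subst tensor_lift_compose[of "\<lambda>x. \<rho> x m \<otimes> n"]) (intro lin refl)+
  finally have "\<delta> h *\<^sub>C (m \<otimes> n) - sweedler (\<lambda>a b. \<rho> b m \<otimes> \<sigma> a n) h =
      sweedler (\<lambda>a b. \<rho> (S\<delta> a) (\<rho> b m) \<otimes> n - \<rho> b m \<otimes> \<sigma> a n) h"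
    by (simp add: tensor_lift_def free_lift_def split_def sum_subtractf
        complex_vector.scale_right_diff_distrib)
  also have "\<dots> \<in> ?C"
    by (intro tensor_lift_in_csubspace csubspace_coinvariants 1)
  finally show ?thesis
    using complex_vector.subspace_neg[OF csubspace_coinvariants] by fastforce
qed

end

end


section \<open>The tensor algebra as a module algebra\<close>

lemma multilinearI: "F [] = 0 \<Longrightarrow> (\<And>us ws. clinear (\<lambda>v. F (us @ v # ws))) \<Longrightarrow> multilinear F"
  by (simp add: multilinear_def)

lemma multilinear_Nil: "multilinear F \<Longrightarrow> F [] = 0"
  and multilinear_clinear: "multilinear F \<Longrightarrow> clinear (\<lambda>v. F (us @ v # ws))"
  by (auto simp: multilinear_def)

text \<open>Changing a letter does not change the length, so the operator may depend on it.
  \<open>norm_operator\<close>, whose number of summands is the length, has this form.\<close>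

lemma multilinear_of_length:
  assumes "\<And>n. clinear (L n)"
  shows "multilinear (\<lambda>vs. L (length vs) (word vs))"
  by (rule multilinearI)
    (auto simp: clinear_0[OF assms] intro: clinear_compose[OF clinear_word assms])

lemma word_Cons: "vs \<noteq> [] \<Longrightarrow> word (v # vs) = word [v] * word vs"
  by (simp add: word_times_word word_append_def)

lemma word_zero_letter: "0 \<in> set vs \<Longrightarrow> word vs = 0"
  by (metis clinear_0 clinear_word in_set_conv_decomp)

lemma word_in_cspan: "x \<in> cspan (range word)"
proof -
  have "word_lift word x \<in> cspan (range word)"
    unfolding word_lift_def
    by (rule free_lift_in_csubspace[OF csubspace_cspan]) (blast intro: complex_vector.span_base)
  then show ?thesis by (simp only: tensor_algebra_expansion[symmetric])
qed

section \<open>Words in the unitization\<close>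

lemma clinear_unitization [clinear_intros]:
  fixes g :: "_ \<Rightarrow> 'r::complex_algebra"
  shows "clinear k \<Longrightarrow> clinear (\<lambda>x. scalar_part (k x :: 'r unitization))"
    and "clinear k \<Longrightarrow> clinear (\<lambda>x. algebra_part (k x :: 'r unitization))"
    and "clinear f \<Longrightarrow> clinear g \<Longrightarrow> clinear (\<lambda>x. Unitize (f x) (g x))"
  by (auto intro!: clinearI simp: clinear_add clinear_scale plus_unitization_def scaleC_unitization_def
      scaleC_complex_def)

text \<open>In the non-unital algebra the empty word is \<open>0\<close>; as a coefficient of a
  1-form it has to be the unit, so that dv is the case \<open>us = []\<close> of x dv.\<close>

definition uword :: "'v::complex_vector list \<Rightarrow> 'v tensor_algebra unitization"
  where "uword us = (if us = [] then 1 else Unitize 0 (word us))"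

text \<open>The product inside the unitization; it lands in the algebra because the algebra is an
  ideal there. It turns x dy into x y.\<close>

definition umult :: "'r::complex_algebra unitization \<Rightarrow> 'r \<Rightarrow> 'r"
  where "umult x y = scalar_part x *\<^sub>C y + algebra_part x * y"

lemma cbilinear_umult: "cbilinear umult"
  unfolding umult_def[abs_def] by (intro clinear_intros)

lemma umult_uword_word: "vs \<noteq> [] \<Longrightarrow> umult (uword us) (word vs) = word (us @ vs)"
  by (auto simp: umult_def uword_def one_unitization_def scaleC_one word_times_word word_append_def)

locale twisted_hopf_module = twisted_hopf_algebra \<Delta> \<epsilon> \<delta> S
  for \<Delta> :: "'h::complex_algebra_1 \<Rightarrow> 'h \<otimes>\<^sub>t 'h" and \<epsilon> \<delta> :: "'h \<Rightarrow> complex" and S :: "'h \<Rightarrow> 'h" +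
  fixes \<rho> :: "'h \<Rightarrow> 'v::complex_vector \<Rightarrow> 'v"
  assumes module: "hmodule \<rho>"
begin

abbreviation \<tau> :: "'h \<Rightarrow> 'v tensor_algebra \<Rightarrow> 'v tensor_algebra"
  where "\<tau> \<equiv> tensor_action \<Delta> \<rho>"

lemma word_action_Cons:
  "vs \<noteq> [] \<Longrightarrow> word_action \<Delta> \<rho> (v # vs) h = sweedler (\<lambda>a b. word [\<rho> a v] * word_action \<Delta> \<rho> vs b) h"
  by (cases vs) auto

lemma clinear_word_action: "clinear (word_action \<Delta> \<rho> vs)"
proof (induction vs)
  case Nil
  then show ?case by (simp add: clinear_const_0)
next
  case (Cons v vs)
  note lin = clinear_intros hmodule_clinear[OF module] clinear_compose[OF _ Cons.IH]
  show ?case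
  proof (cases "vs = []")
    case True
    then show ?thesis by (simp, intro lin)
  next
    case False
    then show ?thesis
      unfolding word_action_Cons[OF False, abs_def] by (intro lin)
  qed
qed

lemma multilinear_word_action: "multilinear (\<lambda>vs. word_action \<Delta> \<rho> vs h)"
proof (rule multilinearI)
  note lin = clinear_intros hmodule_clinear[OF module] clinear_word_action clinear_compose[OF _ clinear_word_action]
  fix us ws :: "'v list"
  show "clinear (\<lambda>v. word_action \<Delta> \<rho> (us @ v # ws) h)"
  proof (induction us arbitrary: h)
    case Nil
    then show ?case
      by (cases "ws = []") (simp_all add: word_action_Cons, (intro lin)+)
  next
    case (Cons u us)
    show ?case
      by (simp add: word_action_Cons) (intro lin Cons.IH)
  qed
qed simp

lemma tensor_action_word: "\<tau> h (word vs) = word_action \<Delta> \<rho> vs h"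
  by (simp add: tensor_action_def multilinear_word_action)

lemma cbilinear_tensor_action: "cbilinear \<tau>"
  unfolding tensor_action_def[abs_def]
  by (intro clinear_intros multilinear_word_action clinear_word_action)

lemmas clinear_tensor_action = cbilinear_clinear[OF cbilinear_tensor_action]

lemma tensor_action_zero [simp]: "\<tau> h 0 = 0"
  by (rule clinear_0[OF clinear_tensor_action(1)[OF clinear_ident]])

lemma tensor_action_letter: "\<tau> h (word [v]) = word [\<rho> h v]"
  by (simp add: tensor_action_word)

lemma tensor_action_Cons:
  "vs \<noteq> [] \<Longrightarrow> \<tau> h (word (v # vs)) = sweedler (\<lambda>a b. \<tau> a (word [v]) * \<tau> b (word vs)) h"
  by (simp add: tensor_action_word word_action_Cons)

text \<open>The action is defined by splitting off the first letter. Coassociativity makes every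
  other splitting of a word give the same result.\<close>

lemma tensor_action_mult: "\<tau> h (x * y) = sweedler (\<lambda>a b. \<tau> a x * \<tau> b y) h"
proof (rule clinear_eq_on_words[of _ _ x])
  note lin = clinear_intros clinear_tensor_action
  show "clinear (\<lambda>x. \<tau> h (x * y))" "clinear (\<lambda>x. sweedler (\<lambda>a b. \<tau> a x * \<tau> b y) h)"
    by (intro lin)+
  fix us :: "'v list"
  show "\<tau> h (word us * y) = sweedler (\<lambda>a b. \<tau> a (word us) * \<tau> b y) h"
  proof (induction us arbitrary: h)
    case Nil
    have "clinear (\<lambda>x. \<tau> h (x * y))" "clinear (\<lambda>x. sweedler (\<lambda>a b. \<tau> a x * \<tau> b y) h)"
      by (intro lin)+
    from this[THEN clinear_0] show ?case by simp
  next
    case (Cons u us)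
    have letter: "\<tau> h (word [u] * y) = sweedler (\<lambda>a b. \<tau> a (word [u]) * \<tau> b y) h" for h y
    proof (rule clinear_eq_on_words[of _ _ y])
      show "clinear (\<lambda>y. \<tau> h (word [u] * y))" "clinear (\<lambda>y. sweedler (\<lambda>a b. \<tau> a (word [u]) * \<tau> b y) h)"
        by (intro lin)+
      \<comment> \<open>Supplies the value at \<open>0\<close>: the empty word is zero, and the
        splitting rule covers nonempty tails only.\<close>
      have "clinear (\<lambda>y. sweedler (\<lambda>a b. \<tau> a (word [u]) * \<tau> b y) h)" by (intro lin)
      from clinear_0[OF this]
      show "\<tau> h (word [u] * word vs) = sweedler (\<lambda>a b. \<tau> a (word [u]) * \<tau> b (word vs)) h" for vs
        by (cases "vs = []") (simp_all add: tensor_action_Cons flip: word_Cons)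
    qed
    show ?case
    proof (cases "us = []")
      case True
      then show ?thesis by (simp add: letter)
    next
      case False
      have "\<tau> h (word (u # us) * y) = sweedler (\<lambda>a b. \<tau> a (word [u]) * \<tau> b (word us * y)) h"
        by (simp add: word_Cons False mult.assoc letter)
      also have "\<dots> = sweedler (\<lambda>a. sweedler (\<lambda>b c. \<tau> a (word [u]) * \<tau> b (word us) * \<tau> c y)) h"
        unfolding Cons.IH
        by (subst tensor_lift_compose[of "\<lambda>x. _ * x"]) (intro lin | simp add: mult.assoc)+
      also have "\<dots> = sweedler (\<lambda>z c. sweedler (\<lambda>a b. \<tau> a (word [u]) * \<tau> b (word us) * \<tau> c y) z) h"
        by (rule coassoc) (intro lin)+
      also have "\<dots> = sweedler (\<lambda>z c. \<tau> z (word (u # us)) * \<tau> c y) h"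
        unfolding tensor_action_Cons[OF False]
        by (subst tensor_lift_compose[of "\<lambda>x. x * _"]) (intro lin refl)+
      finally show ?thesis .
    qed
  qed
qed

lemma hmodule_tensor_action: "hmodule \<tau>"
  unfolding hmodule_def
proof (intro conjI allI)
  note lin = clinear_intros clinear_tensor_action
  show "cbilinear \<tau>" by (rule cbilinear_tensor_action)
  show "\<tau> 1 x = x" for x
  proof (rule clinear_eq_on_words[of _ _ x])
    show "\<tau> 1 (word vs) = word vs" for vs
    proof (induction vs)
      case Nil
      then show ?case by simp
    next
      case (Cons v vs)
      have "cbilinear (\<lambda>a b. \<tau> a (word [v]) * \<tau> b (word vs))" by (intro lin)
      then show ?case
        by (cases "vs = []")
          (simp_all add: tensor_action_letter hmodule_one[OF module] tensor_action_Cons comult_one Cons flip: word_Cons)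
    qed
  qed (intro lin)+
  show "\<tau> (g * h) x = \<tau> g (\<tau> h x)" for g h x
  proof (rule clinear_eq_on_words[of _ _ x])
    show "\<tau> (g * h) (word vs) = \<tau> g (\<tau> h (word vs))" for vs
    proof (induction vs arbitrary: g h)
      case Nil
      then show ?case by simp
    next
      case (Cons v vs)
      show ?case
      proof (cases "vs = []")
        case True
        then show ?thesis by (simp add: tensor_action_letter hmodule_mult[OF module])
      next
        case False
        have "\<tau> (g * h) (word (v # vs)) = sweedler (\<lambda>a b.
            sweedler (\<lambda>a' b'. \<tau> (a * a') (word [v]) * \<tau> (b * b') (word vs)) h) g"
          unfolding tensor_action_Cons[OF False] comult_mult
          by (rule tensor_lift_mult) (intro lin)
        \<comment> \<open>With the legs of \<open>g\<close> summed innermost,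
          \<open>tensor_action_mult\<close> recognises the action of \<open>g\<close> on each
          product.\<close>
        also have "\<dots> = sweedler (\<lambda>a' b'.
            sweedler (\<lambda>a b. \<tau> (a * a') (word [v]) * \<tau> (b * b') (word vs)) g) h"
          by (rule tensor_lift_swap) (intro lin)+
        also have "\<dots> = sweedler (\<lambda>a' b'. \<tau> g (\<tau> a' (word [v]) * \<tau> b' (word vs))) h"
          unfolding tensor_action_mult by (simp add: Cons.IH tensor_action_letter hmodule_mult[OF module])
        also have "\<dots> = \<tau> g (\<tau> h (word (v # vs)))"
          unfolding tensor_action_Cons[OF False]
          by (rule tensor_lift_compose[symmetric]) (intro lin)
        finally show ?thesis .
      qed
    qed
  qed (intro lin)+
qed

abbreviation \<upsilon> :: "'h \<Rightarrow> 'v tensor_algebra unitization \<Rightarrow> 'v tensor_algebra unitization"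
  where "\<upsilon> \<equiv> unitization_action \<epsilon> \<tau>"

lemma hmodule_unitization_action: "hmodule \<upsilon>"
  unfolding hmodule_def
proof (intro conjI allI)
  show "cbilinear \<upsilon>"
    unfolding unitization_action_def[abs_def] by (intro clinear_intros clinear_tensor_action)
qed (simp_all add: unitization_action_def counit_one counit_mult hmodule_one[OF hmodule_tensor_action]
    hmodule_mult[OF hmodule_tensor_action])

text \<open>Deleting the d from x dy is equivariant: on the scalar part of \<open>x\<close> the
  first leg acts through the counit and disappears, on the algebra part this is the module algebra
  rule.\<close>

lemma tensor_action_umult: "\<tau> h (umult x y) = sweedler (\<lambda>a b. umult (\<upsilon> a x) (\<tau> b y)) h"
proof -
  note lin = clinear_intros clinear_tensor_action
  have "sweedler (\<lambda>a b. umult (\<upsilon> a x) (\<tau> b y)) h =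
      sweedler (\<lambda>a b. \<epsilon> a *\<^sub>C (scalar_part x *\<^sub>C \<tau> b y)) h
      + sweedler (\<lambda>a b. \<tau> a (algebra_part x) * \<tau> b y) h"
    by (simp add: umult_def unitization_action_def scaleC_scaleC tensor_lift_def free_lift_def split_def
        sum.distrib scaleC_add_right)
  also have "\<dots> = scalar_part x *\<^sub>C \<tau> h y + \<tau> h (algebra_part x * y)"
    by (subst counit_left) (intro lin | simp add: tensor_action_mult)+
  also have "\<dots> = \<tau> h (umult x y)"
    unfolding umult_def
    by (simp add: clinear_add[OF clinear_tensor_action(1)[OF clinear_ident]]
        clinear_scale[OF clinear_tensor_action(1)[OF clinear_ident]])
  finally show ?thesis ..
qed

end


section \<open>Gradings\<close>

lemma koszul_add_left: "koszul (p + p') q = koszul p q * koszul p' q"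
  and koszul_add_right: "koszul p (q + q') = koszul p q * koszul p q'"
  by (simp_all add: power_int_add algebra_simps)

lemma koszul_commute: "koszul p q = koszul q p"
  by (simp add: mult.commute)

lemma koszul_square: "koszul p q * koszul p q = 1"
  by (simp flip: power_int_mult_distrib)

text \<open>Projections give existence directly, and uniqueness because applying
  \<open>\<pi> p\<close> to any homogeneous decomposition picks out its term of degree
  \<open>p\<close>.\<close>

lemma is_gradingI:
  assumes sub: "\<And>p. csubspace (G p)" and \<pi>: "\<And>p. clinear (\<pi> p)"
    and in_G: "\<And>p x. \<pi> p x \<in> G p"
    and \<pi>_hom: "\<And>p q x. x \<in> G q \<Longrightarrow> \<pi> p x = (if p = q then x else 0)"
    and decomposition: "\<And>x. \<exists>A. finite A \<and> (\<forall>p. p \<notin> A \<longrightarrow> \<pi> p x = 0) \<and> x = (\<Sum>p\<in>A. \<pi> p x)"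
  shows "is_grading G"
  unfolding is_grading_def
proof (intro conjI allI ex1I)
  fix x
  obtain A where A: "finite A" "\<And>p. p \<notin> A \<Longrightarrow> \<pi> p x = 0" "x = (\<Sum>p\<in>A. \<pi> p x)"
    using decomposition by metis
  have sub_A: "{p. \<pi> p x \<noteq> 0} \<subseteq> A" using A(2) by auto
  show "csubspace (G p)" "\<pi> p x \<in> G p" for p by fact+
  show "finite {p. \<pi> p x \<noteq> 0}" by (rule finite_subset[OF sub_A A(1)])
  show "x = (\<Sum>p | \<pi> p x \<noteq> 0. \<pi> p x)"
    by (subst A(3)) (rule sum.mono_neutral_right[OF A(1) sub_A], auto)
  fix f assume f: "(\<forall>p. f p \<in> G p) \<and> finite {p. f p \<noteq> 0} \<and> x = (\<Sum>p | f p \<noteq> 0. f p)"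
  show "f = (\<lambda>p. \<pi> p x)"
  proof
    fix p
    have "\<pi> p x = (\<Sum>q | f q \<noteq> 0. \<pi> p (f q))"
      using f clinear_sum[OF \<pi>] by metis
    also have "\<dots> = (\<Sum>q | f q \<noteq> 0. if p = q then f q else 0)"
      using f \<pi>_hom by (intro sum.cong) auto
    also have "\<dots> = f p"
      using f by auto
    finally show "f p = \<pi> p x" ..
  qed
qed

section \<open>Homogeneous components\<close>

locale graded_vector_space =
  fixes G :: "int \<Rightarrow> 'v::complex_vector set"
  assumes grading: "is_grading G"
begin

abbreviation comp where "comp \<equiv> component G"

lemma csubspace_grading: "csubspace (G p)"
  using grading by (simp add: is_grading_def)

lemma component_unique:
  assumes "\<And>p. f p \<in> G p" "finite {p. f p \<noteq> 0}" "x = (\<Sum>p | f p \<noteq> 0. f p)"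
  shows "comp x = f"
  unfolding component_def
proof (rule the1_equality)
  show "\<exists>!f. (\<forall>p. f p \<in> G p) \<and> finite {p. f p \<noteq> 0} \<and> x = (\<Sum>p | f p \<noteq> 0. f p)"
    using grading by (simp add: is_grading_def)
qed (use assms in auto)

lemma component_in: "comp x p \<in> G p"
  and finite_component: "finite {p. comp x p \<noteq> 0}"
  and component_sum: "(\<Sum>p | comp x p \<noteq> 0. comp x p) = x"
proof -
  have "\<exists>!f. (\<forall>p. f p \<in> G p) \<and> finite {p. f p \<noteq> 0} \<and> x = (\<Sum>p | f p \<noteq> 0. f p)"
    using grading by (simp add: is_grading_def)
  from theI'[OF this, folded component_def]
  show "comp x p \<in> G p" "finite {p. comp x p \<noteq> 0}" "(\<Sum>p | comp x p \<noteq> 0. comp x p) = x"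
    by auto
qed

lemma component_sum_superset:
  assumes "finite P" "{p. comp x p \<noteq> 0} \<subseteq> P"
  shows "(\<Sum>p\<in>P. comp x p) = x"
  by (subst component_sum[of x, symmetric]) (rule sum.mono_neutral_right[OF assms], auto)

lemma component_uniqueI:
  assumes "\<And>p. f p \<in> G p" "finite P" "\<And>p. p \<notin> P \<Longrightarrow> f p = 0" "x = (\<Sum>p\<in>P. f p)"
  shows "comp x = f"
proof (rule component_unique)
  have P: "{p. f p \<noteq> 0} \<subseteq> P" using assms(3) by auto
  show "finite {p. f p \<noteq> 0}" by (rule finite_subset[OF P assms(2)])
  show "x = (\<Sum>p | f p \<noteq> 0. f p)"
    by (subst assms(4)) (rule sum.mono_neutral_right[OF assms(2) P], auto)
qed (rule assms(1))

lemma clinear_component: "clinear (\<lambda>x. comp x p)"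
proof (rule clinearI)
  fix x y and c :: complex
  let ?P = "{p. comp x p \<noteq> 0} \<union> {p. comp y p \<noteq> 0}"
  have "comp (x + y) = (\<lambda>p. comp x p + comp y p)"
  proof (rule component_uniqueI[of _ ?P])
    show "x + y = (\<Sum>p\<in>?P. comp x p + comp y p)"
      by (simp add: sum.distrib component_sum_superset finite_component)
  qed (auto intro: complex_vector.subspace_add csubspace_grading component_in finite_component)
  then show "comp (x + y) p = comp x p + comp y p" by simp
  have "comp (c *\<^sub>C x) = (\<lambda>p. c *\<^sub>C comp x p)"
  proof (rule component_uniqueI[of _ "{p. comp x p \<noteq> 0}"])
    show "c *\<^sub>C x = (\<Sum>p | comp x p \<noteq> 0. c *\<^sub>C comp x p)"
      by (simp add: component_sum flip: complex_vector.scale_sum_right)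
  qed (auto intro: complex_vector.subspace_scale csubspace_grading component_in finite_component)
  then show "comp (c *\<^sub>C x) p = c *\<^sub>C comp x p" by simp
qed

lemma component_homogeneous:
  assumes "x \<in> G p"
  shows "comp x q = (if q = p then x else 0)"
proof -
  have "comp x = (\<lambda>q. if q = p then x else 0)"
    by (rule component_uniqueI[of _ "{p}"])
      (use assms csubspace_grading complex_vector.subspace_0 in auto)
  then show ?thesis by simp
qed

text \<open>The index set depends on \<open>x\<close>. Linearity is read off after enlarging it to a
  common finite set containing the supports of all vectors involved, the added terms being
  zero.\<close>

lemma clinear_sum_components:
  assumes "\<And>p. clinear (F p)"
  shows "clinear (\<lambda>x. \<Sum>p | comp x p \<noteq> 0. F p (comp x p))"
proof -
  have lin: "clinear (\<lambda>x. \<Sum>p\<in>P. F p (comp x p))" for P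
    by (intro clinear_intros clinear_compose[OF clinear_component assms])
  have eq: "(\<Sum>p | comp x p \<noteq> 0. F p (comp x p)) = (\<Sum>p\<in>P. F p (comp x p))"
    if "finite P" "{p. comp x p \<noteq> 0} \<subseteq> P" for x P
    by (rule sum.mono_neutral_left[OF that]) (simp add: clinear_0[OF assms])
  show ?thesis
  proof (rule clinearI)
    fix x y and c :: complex
    let ?P = "{p. comp x p \<noteq> 0} \<union> {p. comp y p \<noteq> 0} \<union> {p. comp (x + y) p \<noteq> 0}"
    have P: "finite ?P" by (simp add: finite_component)
    show "(\<Sum>p | comp (x + y) p \<noteq> 0. F p (comp (x + y) p)) =
        (\<Sum>p | comp x p \<noteq> 0. F p (comp x p)) + (\<Sum>p | comp y p \<noteq> 0. F p (comp y p))"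
      by (subst (1 2 3) eq[OF P]) (auto simp: clinear_add[OF lin])
    let ?P = "{p. comp x p \<noteq> 0} \<union> {p. comp (c *\<^sub>C x) p \<noteq> 0}"
    have P: "finite ?P" by (simp add: finite_component)
    show "(\<Sum>p | comp (c *\<^sub>C x) p \<noteq> 0. F p (comp (c *\<^sub>C x) p)) =
        c *\<^sub>C (\<Sum>p | comp x p \<noteq> 0. F p (comp x p))"
      by (subst (1 2) eq[OF P]) (auto simp: clinear_scale[OF lin])
  qed
qed

lemma sum_components_homogeneous:
  assumes "x \<in> G p" "F p 0 = 0"
  shows "(\<Sum>q | comp x q \<noteq> 0. F q (comp x q)) = F p x"
  using assms by (cases "x = 0") (simp_all add: component_homogeneous if_distrib[of "\<lambda>x. x \<noteq> 0"] cong: if_cong)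


subsection \<open>Homogeneous words\<close>

abbreviation hom :: "'v list \<Rightarrow> int list \<Rightarrow> bool"
  where "hom \<equiv> list_all2 (\<lambda>v d. v \<in> G d)"

lemma multilinear_zero_letter: "multilinear F \<Longrightarrow> 0 \<in> set vs \<Longrightarrow> F vs = 0"
  by (metis clinear_0 multilinear_clinear in_set_conv_decomp)

text \<open>The general pattern behind \<open>graded_cyclic\<close>: a rule that depends on the
  degrees of the letters is extended to arbitrary words by expanding each letter into
  components.\<close>

definition homogeneous_sum :: "(int list \<Rightarrow> 'v list \<Rightarrow> 'b::complex_vector) \<Rightarrow> 'v list \<Rightarrow> 'b"
  where "homogeneous_sum F vs =
    (\<Sum>ds | list_all2 (\<lambda>v d. comp v d \<noteq> 0) vs ds. F ds (map2 comp vs ds))"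

context
  fixes F :: "int list \<Rightarrow> 'v list \<Rightarrow> 'b::complex_vector"
  assumes F: "\<And>ds. multilinear (F ds)"
begin

lemma map2_component_zero:
  assumes "length ds = length vs" "\<not> list_all2 (\<lambda>v d. comp v d \<noteq> 0) vs ds"
  shows "F ds (map2 comp vs ds) = 0"
proof (rule multilinear_zero_letter[OF F])
  obtain i where "i < length vs" "comp (vs ! i) (ds ! i) = 0"
    using assms by (auto simp: list_all2_conv_all_nth)
  then show "0 \<in> set (map2 comp vs ds)"
    using assms(1) nth_mem[of i "map2 comp vs ds"] by simp
qed

text \<open>Replaces an index set that depends on the letters by a fixed box of degree lists, over
  which multilinearity can be checked term by term.\<close>

lemma homogeneous_sum_superset:
  assumes "finite P" "\<And>v. v \<in> set vs \<Longrightarrow> {d. comp v d \<noteq> 0} \<subseteq> P"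
  shows "homogeneous_sum F vs = (\<Sum>ds | set ds \<subseteq> P \<and> length ds = length vs. F ds (map2 comp vs ds))"
  unfolding homogeneous_sum_def
proof (rule sum.mono_neutral_left)
  show "finite {ds. set ds \<subseteq> P \<and> length ds = length vs}"
    by (rule finite_lists_length_eq[OF assms(1)])
  show "{ds. list_all2 (\<lambda>v d. comp v d \<noteq> 0) vs ds} \<subseteq> {ds. set ds \<subseteq> P \<and> length ds = length vs}"
    using assms(2) by (fastforce simp: list_all2_conv_all_nth in_set_conv_nth)
qed (auto intro: map2_component_zero)

lemma multilinear_homogeneous_sum: "multilinear (homogeneous_sum F)"
proof (rule multilinearI)
  show "homogeneous_sum F [] = 0"
    by (simp add: homogeneous_sum_def multilinear_Nil[OF F])
  fix us ws :: "'v list"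
  define g where "g P v = (\<Sum>ds | set ds \<subseteq> P \<and> length ds = length (us @ v # ws). F ds (map2 comp (us @ v # ws) ds))"
    for P v
  have lin: "clinear (g P)" for P
    unfolding g_def length_append list.size(4)
  proof (intro clinear_setsum)
    fix ds assume "ds \<in> {ds. set ds \<subseteq> P \<and> length ds = length us + (length ws + Suc 0)}"
    \<comment> \<open>\<open>d\<close> is the degree that \<open>ds\<close> assigns to the varying
      letter, which enters the term only through \<open>comp v d\<close>.\<close>
    then obtain d ds' where d: "drop (length us) ds = d # ds'"
      by (cases "drop (length us) ds") auto
    show "clinear (\<lambda>v. F ds (map2 comp (us @ v # ws) ds))"
      by (simp add: zip_append1 d) (rule clinear_compose[OF clinear_component multilinear_clinear[OF F]])
  qed
  have eq: "homogeneous_sum F (us @ v # ws) = g P v"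
    if "finite P" "(\<Union>u\<in>set us \<union> set ws. {d. comp u d \<noteq> 0}) \<subseteq> P" "{d. comp v d \<noteq> 0} \<subseteq> P" for v P
    unfolding g_def by (rule homogeneous_sum_superset) (use that in auto)
  let ?U = "\<Union>u\<in>set us \<union> set ws. {d. comp u d \<noteq> 0}"
  show "clinear (\<lambda>v. homogeneous_sum F (us @ v # ws))"
  proof (rule clinearI)
    fix v w and c :: complex
    let ?P = "?U \<union> {d. comp v d \<noteq> 0} \<union> {d. comp w d \<noteq> 0} \<union> {d. comp (v + w) d \<noteq> 0}"
    have P: "finite ?P" by (simp add: finite_component)
    show "homogeneous_sum F (us @ (v + w) # ws) = homogeneous_sum F (us @ v # ws) + homogeneous_sum F (us @ w # ws)"
      by (subst (1 2 3) eq[OF P]) (auto simp: clinear_add[OF lin])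
    let ?P = "?U \<union> {d. comp v d \<noteq> 0} \<union> {d. comp (c *\<^sub>C v) d \<noteq> 0}"
    have P: "finite ?P" by (simp add: finite_component)
    show "homogeneous_sum F (us @ (c *\<^sub>C v) # ws) = c *\<^sub>C homogeneous_sum F (us @ v # ws)"
      by (subst (1 2) eq[OF P]) (auto simp: clinear_scale[OF lin])
  qed
qed

lemma homogeneous_sum_hom:
  assumes "hom vs ds"
  shows "homogeneous_sum F vs = F ds vs"
proof -
  have len: "length ds = length vs" using assms by (simp add: list_all2_lengthD)
  have mem: "vs ! i \<in> G (ds ! i)" if "i < length vs" for i
    using assms that by (auto simp: list_all2_conv_all_nth)
  \<comment> \<open>Summing over all lists with entries in \<open>set ds\<close> keeps
    \<open>ds\<close> in the index set even when a letter is zero and has empty support.\<close>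
  let ?A = "{ds'. set ds' \<subseteq> set ds \<and> length ds' = length vs}"
  have "homogeneous_sum F vs = (\<Sum>ds'\<in>?A. F ds' (map2 comp vs ds'))"
    by (rule homogeneous_sum_superset)
      (use len in \<open>auto simp: in_set_conv_nth component_homogeneous[OF mem] split: if_splits\<close>)
  also have "\<dots> = (\<Sum>ds'\<in>{ds}. F ds' (map2 comp vs ds'))"
  proof (rule sum.mono_neutral_right)
    show "finite ?A" by (rule finite_lists_length_eq) simp
    show "{ds} \<subseteq> ?A" using len by simp
    show "\<forall>ds'\<in>?A - {ds}. F ds' (map2 comp vs ds') = 0"
    proof
      fix ds' assume ds': "ds' \<in> ?A - {ds}"
      then obtain i where i: "i < length vs" "ds' ! i \<noteq> ds ! i"
        using len nth_equalityI[of ds' ds] by auto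
      then have "comp (vs ! i) (ds' ! i) = 0"
        by (simp add: component_homogeneous[OF mem])
      then show "F ds' (map2 comp vs ds') = 0"
        using ds' i by (intro map2_component_zero) (auto simp: list_all2_conv_all_nth)
    qed
  qed
  also have "map2 comp vs ds = vs"
    using len mem by (auto intro!: nth_equalityI simp: component_homogeneous[OF mem])
  then have "(\<Sum>ds'\<in>{ds}. F ds' (map2 comp vs ds')) = F ds vs" by simp
  finally show ?thesis .
qed

end

text \<open>Letters are expanded one at a time: the homogeneous prefix grows as the arbitrary suffix
  shrinks.\<close>

lemma word_append_in_cspan_hom:
  "hom us ds \<Longrightarrow> word (us @ ws) \<in> cspan {word vs | vs ds. hom vs ds}"
proof (induction ws arbitrary: us ds)
  case Nil
  then show ?case by (auto intro: complex_vector.span_base)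
next
  case (Cons w ws)
  have "word (us @ w # ws) = (\<Sum>p | comp w p \<noteq> 0. word (us @ comp w p # ws))"
    by (subst component_sum[of w, symmetric]) (rule clinear_sum[OF clinear_word])
  also have "\<dots> \<in> cspan {word vs | vs ds. hom vs ds}"
  proof (rule complex_vector.subspace_sum[OF csubspace_cspan])
    fix p
    have "hom (us @ [comp w p]) (ds @ [p])"
      using Cons.prems by (auto intro: list_all2_appendI component_in)
    from Cons.IH[OF this] show "word (us @ comp w p # ws) \<in> cspan {word vs | vs ds. hom vs ds}" by simp
  qed
  finally show ?case .
qed

lemma in_cspan_hom_words: "x \<in> cspan {word vs | vs ds. hom vs ds}"
  by (rule cspan_image_subset[OF clinear_ident csubspace_cspan _ word_in_cspan])
    (use word_append_in_cspan_hom[of "[]" "[]"] in auto)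

lemma clinear_eq_on_hom_words:
  assumes "clinear f" "clinear g" "\<And>vs ds. hom vs ds \<Longrightarrow> f (word vs) = g (word vs)"
  shows "f x = g x"
proof -
  have "f x - g x \<in> {0}"
    by (rule cspan_image_subset[OF _ complex_vector.subspace_single_0 _ in_cspan_hom_words])
      (auto intro: clinear_intros assms(1,2) simp: assms(3))
  then show ?thesis by simp
qed

lemma hom_word_in_tensor_grading: "hom vs ds \<Longrightarrow> word vs \<in> tensor_grading G (sum_list ds)"
  unfolding tensor_grading_def by (intro complex_vector.span_base) blast

lemma csubspace_tensor_grading: "csubspace (tensor_grading G n)"
  unfolding tensor_grading_def by (rule csubspace_cspan)

text \<open>Needed because the graded commutator on T(V) is defined through \<open>component\<close>
  of this grading. The projection to degree \<open>n\<close> expands a word and keeps the terms of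
  total degree \<open>n\<close>.\<close>

lemma is_grading_tensor_grading: "is_grading (tensor_grading G)"
proof -
  \<comment> \<open>The condition is on the degree list and not on the word, so each
    \<open>F n ds\<close> is multilinear.\<close>
  define F :: "int \<Rightarrow> int list \<Rightarrow> 'v list \<Rightarrow> 'v tensor_algebra"
    where "F n ds vs = (if sum_list ds = n then word vs else 0)" for n ds vs
  have F: "multilinear (F n ds)" for n ds
    unfolding F_def using multilinear_word by (auto simp: multilinear_def clinear_const_0)
  define \<pi> where "\<pi> n = word_lift (homogeneous_sum (F n))" for n
  have \<pi>: "clinear (\<pi> n)" for n
    unfolding \<pi>_def by (rule clinear_word_lift[OF multilinear_homogeneous_sum[OF F]])
  have \<pi>_word: "\<pi> n (word vs) = (if sum_list ds = n then word vs else 0)" if "hom vs ds" for n vs ds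
    unfolding \<pi>_def using that
    by (simp add: multilinear_homogeneous_sum[OF F] homogeneous_sum_hom[OF F] F_def)
  show ?thesis
  proof (rule is_gradingI[of _ \<pi>, OF csubspace_tensor_grading \<pi>])
    show "\<pi> p x \<in> tensor_grading G p" for p x
      by (rule cspan_image_subset[OF \<pi> csubspace_tensor_grading _ in_cspan_hom_words])
        (auto simp: \<pi>_word hom_word_in_tensor_grading complex_vector.subspace_0[OF csubspace_tensor_grading])
    show "\<pi> p x = (if p = q then x else 0)" if x: "x \<in> tensor_grading G q" for p q x
    proof -
      have "clinear (\<lambda>x. \<pi> p x - (if p = q then x else 0))"
        by (cases "p = q") (auto intro!: clinear_intros \<pi>)
      then have "\<pi> p x - (if p = q then x else 0) \<in> {0}"
        by (rule cspan_image_subset[OF _ complex_vector.subspace_single_0 _ x[unfolded tensor_grading_def]])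
          (auto simp: \<pi>_word)
      then show ?thesis by simp
    qed
    show "\<exists>A. finite A \<and> (\<forall>p. p \<notin> A \<longrightarrow> \<pi> p x = 0) \<and> x = (\<Sum>p\<in>A. \<pi> p x)" for x
      using in_cspan_hom_words[of x]
    proof (induction rule: complex_vector.span_induct_alt)
      case base
      then show ?case by (intro exI[of _ "{}"]) (simp add: clinear_0[OF \<pi>])
    next
      case (step c w y)
      then obtain vs ds where w: "w = word vs" "hom vs ds" by auto
      obtain A where A: "finite A" "\<And>p. p \<notin> A \<Longrightarrow> \<pi> p y = 0" "y = (\<Sum>p\<in>A. \<pi> p y)"
        using step by blast
      let ?A = "insert (sum_list ds) A"
      have "y = (\<Sum>p\<in>?A. \<pi> p y)"
        using A(1,2) by (subst A(3)) (auto intro!: sum.mono_neutral_left)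
      moreover have "w = (\<Sum>p\<in>?A. \<pi> p w)"
        using A(1) by (simp add: w(1) \<pi>_word[OF w(2)] del: sum.insert)
      ultimately have "c *\<^sub>C w + y = (\<Sum>p\<in>?A. \<pi> p (c *\<^sub>C w + y))"
        unfolding clinear_add[OF \<pi>] clinear_scale[OF \<pi>] sum.distrib
        by (simp only: flip: complex_vector.scale_sum_right)
      moreover have "\<forall>p. p \<notin> ?A \<longrightarrow> \<pi> p (c *\<^sub>C w + y) = 0"
        by (simp add: clinear_add[OF \<pi>] clinear_scale[OF \<pi>] A(2) w(1) \<pi>_word[OF w(2)])
      ultimately show ?case using A(1) by (intro exI[of _ ?A]) simp
    qed
  qed
qed

end


subsection \<open>The graded cyclic permutation\<close>

context graded_vector_space
begin

abbreviation t :: "'v tensor_algebra \<Rightarrow> 'v tensor_algebra"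
  where "t \<equiv> graded_cyclic G"

lemma multilinear_rotate1: "multilinear (\<lambda>vs. c *\<^sub>C word (rotate1 vs))"
proof (rule multilinearI)
  show "clinear (\<lambda>v. c *\<^sub>C word (rotate1 (us @ v # ws)))" for us ws
  proof (cases us)
    case Nil
    then show ?thesis using clinear_word[of ws "[]"] by (auto intro: clinear_intros)
  next
    case (Cons u us')
    then show ?thesis using clinear_word[of us' "ws @ [u]"] by (auto intro: clinear_intros)
  qed
qed simp

lemma graded_cyclic_eq: "t = word_lift (homogeneous_sum
    (\<lambda>ds vs. koszul (hd ds) (sum_list (tl ds)) *\<^sub>C word (rotate1 vs)))"
  unfolding graded_cyclic_def
  by (simp add: homogeneous_sum_def[abs_def])

lemma clinear_t: "clinear t"
  unfolding graded_cyclic_eq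
  by (intro clinear_word_lift multilinear_homogeneous_sum multilinear_rotate1)

lemmas clinear_t_arg = clinear_compose[OF _ clinear_t]

lemma t_Cons:
  assumes "hom (v # vs) (d # ds)"
  shows "t (word (v # vs)) = koszul d (sum_list ds) *\<^sub>C word (vs @ [v])"
  unfolding graded_cyclic_eq
  by (simp add: multilinear_homogeneous_sum[OF multilinear_rotate1]
      homogeneous_sum_hom[OF multilinear_rotate1 assms])

text \<open>The block \<open>us\<close> passes \<open>vs\<close> letter by letter. Each pair of
  letters inside \<open>us\<close> is exchanged twice on the way, so those signs cancel and only the
  sign between the two blocks remains.\<close>

lemma t_append:
  assumes "hom us ds" "hom vs es"
  shows "(t ^^ length us) (word (us @ vs)) = koszul (sum_list ds) (sum_list es) *\<^sub>C word (vs @ us)"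
  using assms
proof (induction us arbitrary: ds vs es)
  case Nil
  then show ?case by (simp add: scaleC_one)
next
  case (Cons u us)
  then obtain d ds' where ds: "ds = d # ds'" "u \<in> G d" "hom us ds'"
    by (auto simp: list_all2_Cons1)
  let ?d = "sum_list ds'" and ?e = "sum_list es"
  have "(t ^^ length (u # us)) (word ((u # us) @ vs)) = (t ^^ length us) (t (word (u # us @ vs)))"
    by (simp add: funpow_swap1)
  also have "t (word (u # us @ vs)) = koszul d (?d + ?e) *\<^sub>C word (us @ vs @ [u])"
    using ds Cons.prems by (subst t_Cons[of _ _ _ "ds' @ es"]) (auto intro: list_all2_appendI)
  also have "(t ^^ length us) \<dots> = koszul d (?d + ?e) *\<^sub>C (t ^^ length us) (word (us @ vs @ [u]))"
    by (rule clinear_scale[OF clinear_funpow[OF clinear_t]])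
  also have "(t ^^ length us) (word (us @ vs @ [u])) = koszul ?d (?e + d) *\<^sub>C word ((vs @ [u]) @ us)"
    using ds Cons.prems Cons.IH[of ds' "vs @ [u]" "es @ [d]"] by (auto intro: list_all2_appendI)
  also have "koszul d (?d + ?e) *\<^sub>C koszul ?d (?e + d) *\<^sub>C word ((vs @ [u]) @ us) =
      koszul (d + ?d) ?e *\<^sub>C word (vs @ u # us)"
  proof -
    have "koszul d (?d + ?e) * koszul ?d (?e + d) = (koszul d ?d * koszul d ?d) * koszul (d + ?d) ?e"
      unfolding koszul_add_left koszul_add_right koszul_commute[of ?d d] by (simp only: mult_ac)
    then show ?thesis unfolding scaleC_scaleC koszul_square by simp
  qed
  finally show ?case by (simp add: ds(1))
qed

lemma t_full_rotation: "hom us ds \<Longrightarrow> (t ^^ length us) (word us) = word us"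
  using t_append[of us ds "[]" "[]"] by (simp add: scaleC_one)

end

section \<open>Graded commutators\<close>

lemma cbilinear_graded_commutator:
  fixes G :: "int \<Rightarrow> 'r::complex_algebra set"
  assumes "is_grading G"
  shows "cbilinear (graded_commutator G)"
proof -
  interpret graded_vector_space G by unfold_locales fact
  show ?thesis
    unfolding graded_commutator_def[abs_def]
  proof (rule cbilinearI)
    fix x y :: 'r
    show "clinear (\<lambda>b. x * b - (\<Sum>p | comp x p \<noteq> 0. \<Sum>q | comp b q \<noteq> 0.
        koszul p q *\<^sub>C (comp b q * comp x p)))"
      by (intro clinear_minus clinear_mult_const clinear_setsum clinear_ident
          clinear_sum_components[of "\<lambda>q z. koszul _ q *\<^sub>C (z * _)"])
        (intro clinear_intros)
    show "clinear (\<lambda>a. a * y - (\<Sum>p | comp a p \<noteq> 0. \<Sum>q | comp y q \<noteq> 0.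
        koszul p q *\<^sub>C (comp y q * comp a p)))"
      by (intro clinear_minus clinear_mult_const clinear_ident clinear_sum_components
          [of "\<lambda>p z. \<Sum>q | comp y q \<noteq> 0. koszul p q *\<^sub>C (comp y q * z)"])
        (intro clinear_intros)
  qed
qed

lemma graded_commutator_homogeneous:
  fixes G :: "int \<Rightarrow> 'r::complex_algebra set"
  assumes "is_grading G" "x \<in> G p" "y \<in> G q"
  shows "graded_commutator G x y = x * y - koszul p q *\<^sub>C (y * x)"
proof -
  interpret graded_vector_space G by unfold_locales fact
  have "(\<Sum>p | comp x p \<noteq> 0. \<Sum>q | comp y q \<noteq> 0. koszul p q *\<^sub>C (comp y q * comp x p))
      = (\<Sum>q | comp y q \<noteq> 0. koszul p q *\<^sub>C (comp y q * x))"
    by (rule sum_components_homogeneous[OF assms(2)]) simp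
  also have "\<dots> = koszul p q *\<^sub>C (y * x)"
    by (rule sum_components_homogeneous[OF assms(3)]) simp
  finally show ?thesis by (simp add: graded_commutator_def)
qed


section \<open>The X-complex of the tensor algebra\<close>

lemma coinvariants_equivariant:
  assumes "clinear f" "\<And>h m. f (\<rho> h m) = \<sigma> h (f m)" "x \<in> coinvariants \<delta> \<rho>"
  shows "f x \<in> coinvariants \<delta> \<sigma>"
  by (rule cspan_image_subset[OF assms(1) csubspace_coinvariants _ assms(3)[unfolded coinvariants_def]])
    (auto simp: clinear_diff[OF assms(1)] clinear_scale[OF assms(1)] assms(2) coinvariants_base)

lemma coinvariants_mapI:
  assumes "clinear f" "csubspace U" "\<And>h m. f (\<rho> h m - \<delta> h *\<^sub>C m) \<in> U" "x \<in> coinvariants \<delta> \<rho>"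
  shows "f x \<in> U"
  by (rule cspan_image_subset[OF assms(1,2) _ assms(4)[unfolded coinvariants_def]]) (use assms(3) in auto)

lemma sum_lessThan_add: "(\<Sum>i<m + n. f i) = (\<Sum>i<m. f i) + (\<Sum>i<n. f (m + i :: nat))"
  by (induction n) (simp_all add: add.assoc)

lemma multilinear_word_lift_param:
  assumes "\<And>vs. multilinear (\<lambda>us. K us vs)"
  shows "multilinear (\<lambda>us. word_lift (K us) y)"
proof (rule multilinearI)
  show "word_lift (K []) y = 0"
    by (simp add: word_lift_def free_lift_def multilinear_Nil[OF assms])
qed (intro clinear_intros multilinear_clinear[OF assms])

lemma cbilinear_forms_right: "cbilinear (forms_right :: 'r::complex_algebra forms \<Rightarrow> 'r \<Rightarrow> 'r forms)"
  unfolding forms_right_def[abs_def] by (intro clinear_intros)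

lemma cbilinear_forms_left: "cbilinear (forms_left :: 'r::complex_algebra \<Rightarrow> 'r forms \<Rightarrow> 'r forms)"
  unfolding forms_left_def[abs_def] by (intro clinear_intros)

lemmas clinear_forms_right = cbilinear_clinear[OF cbilinear_forms_right]
lemmas clinear_forms_left = cbilinear_clinear[OF cbilinear_forms_left]

lemma pure_tensor_zero [simp]: "0 \<otimes> b = 0" "a \<otimes> 0 = 0"
  using clinear_0[OF clinear_pure_tensor(1)[OF clinear_ident]]
    clinear_0[OF clinear_pure_tensor(2)[OF clinear_ident]] by auto

lemma pure_tensor_scale: "(c *\<^sub>C a) \<otimes> b = c *\<^sub>C (a \<otimes> b)" "a \<otimes> (c *\<^sub>C b) = c *\<^sub>C (a \<otimes> b)"
  using clinear_scale[OF clinear_pure_tensor(1)[OF clinear_ident]]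
    clinear_scale[OF clinear_pure_tensor(2)[OF clinear_ident]] by auto

lemma forms_right_pure:
  "forms_right (x \<otimes> y) r = x \<otimes> (y * r) - (x * Unitize 0 y) \<otimes> r"
  unfolding forms_right_def by (rule tensor_lift_pure) (intro clinear_intros)

lemma forms_left_pure: "forms_left r (x \<otimes> y) = (Unitize 0 r * x) \<otimes> y"
  unfolding forms_left_def by (rule tensor_lift_pure) (intro clinear_intros)

lemma Unitize_zero: "Unitize 0 0 = 0"
  by (simp add: zero_unitization_def)

lemma uword_mult_word: "vs \<noteq> [] \<Longrightarrow> uword us * Unitize 0 (word vs) = uword (us @ vs)"
  by (auto simp: uword_def times_unitization_def one_unitization_def scaleC_one word_times_word word_append_def)

lemma word_mult_uword: "vs \<noteq> [] \<Longrightarrow> Unitize 0 (word vs) * uword us = uword (vs @ us)"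
  by (auto simp: uword_def times_unitization_def one_unitization_def scaleC_one word_times_word word_append_def)

lemma forms_right_word:
  "vs \<noteq> [] \<Longrightarrow> ws \<noteq> [] \<Longrightarrow>
    forms_right (uword us \<otimes> word vs) (word ws) = uword us \<otimes> word (vs @ ws) - uword (us @ vs) \<otimes> word ws"
  by (simp add: forms_right_pure uword_mult_word word_times_word word_append_def)

lemma forms_left_word:
  "ws \<noteq> [] \<Longrightarrow> forms_left (word ws) (uword us \<otimes> word vs) = uword (ws @ us) \<otimes> word vs"
  by (simp add: forms_left_pure word_mult_uword)

section \<open>Words with a prescribed degree list, and the maps between 1-forms and T(V)\<close>

context graded_vector_space
begin

text \<open>The whole list is recorded, not only its sum: it fixes the word length and every Koszul
  sign met while rotating.\<close>

definition hwords :: "int list \<Rightarrow> 'v tensor_algebra set"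
  where "hwords ds = cspan {word vs | vs. hom vs ds}"

definition huwords :: "int list \<Rightarrow> 'v tensor_algebra unitization set"
  where "huwords ds = cspan {uword vs | vs. hom vs ds}"

abbreviation TG where "TG \<equiv> tensor_grading G"

lemma csubspace_hwords: "csubspace (hwords ds)" and csubspace_huwords: "csubspace (huwords ds)"
  unfolding hwords_def huwords_def by (rule csubspace_cspan)+

lemma word_in_hwords: "hom vs ds \<Longrightarrow> word vs \<in> hwords ds"
  and uword_in_huwords: "hom vs ds \<Longrightarrow> uword vs \<in> huwords ds"
  unfolding hwords_def huwords_def by (blast intro: complex_vector.span_base)+

lemma hwords_mult:
  assumes "x \<in> hwords ds" "y \<in> hwords es"
  shows "x * y \<in> hwords (ds @ es)"
proof (rule cspan_image2_subset[OF _ csubspace_hwords _ assms[unfolded hwords_def]])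
  show "cbilinear (\<lambda>x y. x * y :: 'v tensor_algebra)" by (intro clinear_intros)
  fix x y assume "x \<in> {word vs | vs. hom vs ds}" "y \<in> {word vs | vs. hom vs es}"
  then obtain us vs where *: "x = word us" "y = word vs" "hom us ds" "hom vs es" by blast
  then show "x * y \<in> hwords (ds @ es)"
    using complex_vector.subspace_0[OF csubspace_hwords]
    by (auto simp: word_times_word word_append_def intro: word_in_hwords list_all2_appendI)
qed

lemma t_letter: "hom [v] ds \<Longrightarrow> t (word [v]) = word [v]"
  by (auto simp: list_all2_Cons1 t_Cons[of _ "[]" _ "[]"] scaleC_one)

text \<open>Extends the rule for words to sums of words, which is what a word becomes under the
  action.\<close>

lemma t_mult:
  assumes "x \<in> hwords [d]" "y \<in> hwords ds"
  shows "t (x * y) = koszul d (sum_list ds) *\<^sub>C (y * x)"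
proof -
  have "t (x * y) - koszul d (sum_list ds) *\<^sub>C (y * x) \<in> {0}"
  proof (rule cspan_image2_subset[OF _ complex_vector.subspace_single_0 _ assms[unfolded hwords_def],
        of "\<lambda>x y. t (x * y) - koszul d (sum_list ds) *\<^sub>C (y * x)"])
    show "cbilinear (\<lambda>x y. t (x * y) - koszul d (sum_list ds) *\<^sub>C (y * x))"
      by (intro clinear_intros clinear_t_arg)
    fix x y assume "x \<in> {word vs | vs. hom vs [d]}" "y \<in> {word vs | vs. hom vs ds}"
    then obtain v vs where *: "x = word [v]" "y = word vs" "hom (v # vs) (d # ds)"
      by (auto simp: list_all2_Cons2)
    show "t (x * y) - koszul d (sum_list ds) *\<^sub>C (y * x) \<in> {0}"
      using t_Cons[OF *(3)] clinear_0[OF clinear_t]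
      by (cases "vs = []") (simp_all add: *(1,2) word_times_word word_append_def)
  qed
  then show ?thesis by simp
qed

text \<open>On \<open>v\<^sub>1 \<dots> v\<^sub>m d(w\<^sub>1 \<dots> w\<^sub>n)\<close> this is the sum of those rotations of the full word that move a letter
  \<open>w\<^sub>i\<close> to the front: the Leibniz rule followed by cyclic reordering modulo commutators.\<close>

definition rotation_sum :: "'v list \<Rightarrow> 'v list \<Rightarrow> 'v tensor_algebra"
  where "rotation_sum us vs = (\<Sum>i<length vs. (t ^^ (length us + i)) (word_append us vs))"

text \<open>The scalar part of the coefficient has its own summand because
  \<open>rotation_sum\<close> vanishes on the empty prefix; a multiple of dy has to go to that
  multiple of N y.\<close>

definition \<Psi> :: "'v tensor_algebra forms \<Rightarrow> 'v tensor_algebra"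
  where "\<Psi> = tensor_lift (\<lambda>x y. scalar_part x *\<^sub>C norm_operator t y
    + word_lift (\<lambda>us. word_lift (rotation_sum us) y) (algebra_part x))"

lemma clinear_norm_operator: "clinear (norm_operator t)"
  unfolding norm_operator_def
  by (intro clinear_word_lift multilinear_of_length[of "\<lambda>n x. \<Sum>i<n. (t ^^ i) x"] clinear_intros clinear_t)

lemma norm_operator_word: "norm_operator t (word vs) = (\<Sum>i<length vs. (t ^^ i) (word vs))"
  unfolding norm_operator_def
  by (rule word_lift_word) (intro multilinear_of_length[of "\<lambda>n x. \<Sum>i<n. (t ^^ i) x"] clinear_intros clinear_t)

lemma multilinear_rotation_sum: "multilinear (rotation_sum us)"
  by (rule multilinearI)
    (auto simp: rotation_sum_def intro!: clinear_intros clinear_t multilinear_clinear[OF multilinear_word_append])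

lemma multilinear_rotation_sum': "multilinear (\<lambda>us. rotation_sum us vs)"
proof (rule multilinearI)
  show "rotation_sum [] vs = 0"
    by (simp add: rotation_sum_def word_append_def clinear_0[OF clinear_funpow[OF clinear_t]])
  show "clinear (\<lambda>v. rotation_sum (us @ v # ws) vs)" for us ws
    unfolding rotation_sum_def length_append list.size
    by (intro clinear_intros clinear_t multilinear_clinear[OF multilinear_word_append'])
qed

lemma word_lift_rotation_sum:
  "word_lift (\<lambda>us. word_lift (rotation_sum us) (word vs)) (word us) = rotation_sum us vs"
  by (subst word_lift_word[OF multilinear_word_lift_param[OF multilinear_rotation_sum']])
    (rule word_lift_word[OF multilinear_rotation_sum])

lemma cbilinear_\<Psi>: "cbilinear (\<lambda>x y. scalar_part x *\<^sub>C norm_operator t y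
    + word_lift (\<lambda>us. word_lift (rotation_sum us) y) (algebra_part x))"
  by (intro clinear_intros clinear_compose[OF _ clinear_norm_operator]
      multilinear_word_lift_param multilinear_rotation_sum multilinear_rotation_sum')

lemma clinear_\<Psi>: "clinear \<Psi>"
  unfolding \<Psi>_def by (rule clinear_tensor_lift[OF cbilinear_\<Psi>])

lemma \<Psi>_pure: "\<Psi> (x \<otimes> y) = scalar_part x *\<^sub>C norm_operator t y
    + word_lift (\<lambda>us. word_lift (rotation_sum us) y) (algebra_part x)"
  unfolding \<Psi>_def by (rule tensor_lift_pure[OF cbilinear_\<Psi>])

text \<open>In dx no prefix stands before the differentiated word, so each letter in turn is moved
  to the front: d becomes N exactly, not merely modulo relations.\<close>

lemma \<Psi>_d: "\<Psi> (X_d x) = norm_operator t x"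
  unfolding X_d_def \<Psi>_pure
  by (simp add: one_unitization_def scaleC_one
      clinear_0[OF clinear_word_lift[OF multilinear_word_lift_param[OF multilinear_rotation_sum']]])

lemma \<Psi>_word: "\<Psi> (uword us \<otimes> word vs) = (\<Sum>i<length vs. (t ^^ (length us + i)) (word (us @ vs)))"
proof (cases "us = [] \<or> vs = []")
  case True
  then show ?thesis
    using \<Psi>_d[of "word vs"] clinear_0[OF clinear_\<Psi>]
    by (auto simp: X_d_def uword_def norm_operator_word)
next
  case False
  then show ?thesis
    by (simp add: \<Psi>_pure uword_def word_lift_rotation_sum rotation_sum_def word_append_def)
qed

text \<open>The exponents depend on lengths alone and the rest is the equivariant product, which
  reduces the behaviour of \<open>\<Psi>\<close> under the action to that of
  \<open>t\<close>.\<close>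

lemma \<Psi>_homogeneous:
  assumes "x \<in> huwords ds" "y \<in> hwords es"
  shows "\<Psi> (x \<otimes> y) = (\<Sum>i<length es. (t ^^ (length ds + i)) (umult x y))"
proof -
  let ?B = "\<lambda>x y. \<Psi> (x \<otimes> y) - (\<Sum>i<length es. (t ^^ (length ds + i)) (umult x y))"
  have "?B x y \<in> {0}"
  proof (rule cspan_image2_subset[of ?B, OF _ complex_vector.subspace_single_0 _
        assms[unfolded hwords_def huwords_def]])
    show "cbilinear ?B"
      by (intro clinear_intros clinear_t cbilinear_clinear[OF cbilinear_umult] clinear_compose[OF _ clinear_\<Psi>])
    fix x y assume "x \<in> {uword vs | vs. hom vs ds}" "y \<in> {word vs | vs. hom vs es}"
    then obtain us vs where *: "x = uword us" "y = word vs" "hom us ds" "hom vs es" by blast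
    then have len: "length us = length ds" "length vs = length es" by (auto dest: list_all2_lengthD)
    show "?B x y \<in> {0}"
      by (cases "vs = []")
        (use len(2) in \<open>simp_all add: *(1,2) \<Psi>_word umult_uword_word clinear_0[OF clinear_\<Psi>] flip: len\<close>)
  qed
  then show ?thesis by simp
qed

text \<open>With a single letter under d only one rotation is left, namely the one that moves
  \<open>v\<close> in front of \<open>r\<close>.\<close>

lemma \<Psi>_letter:
  assumes "v \<in> G p" "r \<in> TG q"
  shows "\<Psi> (Unitize c r \<otimes> word [v]) = c *\<^sub>C word [v] + koszul p q *\<^sub>C (word [v] * r)"
proof -
  let ?f = "\<lambda>r. \<Psi> (Unitize c r \<otimes> word [v]) - (c *\<^sub>C word [v] + koszul p q *\<^sub>C (word [v] * r))"
  let ?g = "\<lambda>r. word_lift (\<lambda>us. word_lift (rotation_sum us) (word [v])) r - koszul p q *\<^sub>C (word [v] * r)"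
  have lin: "clinear ?g"
    by (intro clinear_intros multilinear_word_lift_param multilinear_rotation_sum')
  have "?g r \<in> {0}"
  proof (rule cspan_image_subset[of ?g, OF lin complex_vector.subspace_single_0 _
        assms(2)[unfolded tensor_grading_def]])
    fix s assume "s \<in> {word vs |vs ds. hom vs ds \<and> sum_list ds = q}"
    then obtain us ds where us: "s = word us" "hom us ds" "sum_list ds = q" by blast
    show "?g s \<in> {0}"
    proof (cases "us = []")
      case True
      then show ?thesis using clinear_0[OF lin] by (simp add: us(1))
    next
      case False
      have "(t ^^ length us) (word (us @ [v])) = koszul q p *\<^sub>C word ([v] @ us)"
        using t_append[OF us(2), of "[v]" "[p]"] us(3) assms(1) by simp
      then show ?thesis
        using False unfolding us(1) word_lift_rotation_sum
        by (simp add: rotation_sum_def word_append_def word_times_word mult.commute)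
    qed
  qed
  then show ?thesis
    by (simp add: \<Psi>_pure norm_operator_word)
qed

section \<open>Spanning 1-forms by homogeneous words\<close>

definition hom_forms :: "int \<Rightarrow> 'v tensor_algebra forms set"
  where "hom_forms p = {uword us \<otimes> word vs | us vs ds es. hom us ds \<and> hom vs es \<and> sum_list ds + sum_list es = p}"

lemma unitization_grading_subset:
  assumes "x \<in> unitization_grading TG p"
  shows "x \<in> cspan {uword us | us ds. hom us ds \<and> sum_list ds = p}"
proof -
  let ?U = "cspan {uword us | us ds. hom us ds \<and> sum_list ds = p}"
  obtain c r where x: "x = Unitize c r" "r \<in> TG p" "p = 0 \<or> c = 0"
    using assms by (auto simp: unitization_grading_def)
  have "clinear (\<lambda>r. Unitize 0 r)" by (intro clinear_intros)
  then have "Unitize 0 r \<in> ?U"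
  proof (rule cspan_image_subset[OF _ csubspace_cspan _ x(2)[unfolded tensor_grading_def]])
    fix s assume "s \<in> {word vs |vs ds. hom vs ds \<and> sum_list ds = p}"
    then obtain us ds where us: "s = word us" "hom us ds" "sum_list ds = p" by blast
    have "uword us \<in> ?U" using us by (blast intro: complex_vector.span_base)
    then show "Unitize 0 s \<in> ?U"
      using us(1) by (cases "us = []") (auto simp: uword_def Unitize_zero complex_vector.span_zero)
  qed
  \<comment> \<open>A nonzero scalar forces \<open>p = 0\<close>, which is the degree of the empty
    word.\<close>
  moreover have "c *\<^sub>C 1 \<in> ?U"
  proof (cases "c = 0")
    case False
    then have "hom [] [] \<and> sum_list [] = p" using x(3) by simp
    then have "uword [] \<in> ?U" by (blast intro: complex_vector.span_base)
    then show ?thesis by (simp add: uword_def complex_vector.span_scale)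
  qed (simp add: complex_vector.span_zero)
  ultimately have "c *\<^sub>C 1 + Unitize 0 r \<in> ?U" by (rule complex_vector.span_add[rotated])
  then show ?thesis by (simp add: x(1) one_unitization_def scaleC_unitization_def plus_unitization_def)
qed

lemma uword_in_unitization_grading:
  assumes "hom us ds" shows "uword us \<in> unitization_grading TG (sum_list ds)"
  using assms hom_word_in_tensor_grading[OF assms] complex_vector.subspace_0[OF csubspace_tensor_grading]
  by (auto simp: unitization_grading_def uword_def one_unitization_def)

lemma hom_form_in_forms_grading:
  assumes "hom us ds" "hom vs es"
  shows "uword us \<otimes> word vs \<in> forms_grading TG (sum_list ds + sum_list es)"
  unfolding forms_grading_def
  using uword_in_unitization_grading[OF assms(1)] hom_word_in_tensor_grading[OF assms(2)]
  by (blast intro: complex_vector.span_base)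

lemma forms_grading_subset:
  assumes "\<omega> \<in> forms_grading TG n"
  shows "\<omega> \<in> cspan (hom_forms n)"
proof (rule cspan_image_subset[OF clinear_ident csubspace_cspan _ assms[unfolded forms_grading_def]])
  fix s assume "s \<in> {x \<otimes> y |x y p q. x \<in> unitization_grading TG p \<and> y \<in> TG q \<and> p + q = n}"
  then obtain x y p q where s: "s = x \<otimes> y" "x \<in> unitization_grading TG p" "y \<in> TG q" "p + q = n" by blast
  show "s \<in> cspan (hom_forms n)"
    unfolding s(1)
    by (rule cspan_image2_subset[OF cbilinear_pure_tensor csubspace_cspan _
          unitization_grading_subset[OF s(2)] s(3)[unfolded tensor_grading_def]])
      (use s(4) in \<open>auto simp: hom_forms_def intro!: complex_vector.span_base\<close>)
qed

lemma in_cspan_hom_forms: "\<omega> \<in> cspan {uword us \<otimes> word vs | us vs ds es. hom us ds \<and> hom vs es}"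
  (is "_ \<in> ?U")
proof (rule cspan_image_subset[OF clinear_ident csubspace_cspan _ tensor_in_cspan])
  fix s :: "'v tensor_algebra forms" assume "s \<in> {a \<otimes> b | a b. True}"
  then obtain x y where "s = x \<otimes> y" by blast
  then obtain c r where s: "s = Unitize c r \<otimes> y" by (cases x) auto
  have 1: "Unitize 0 r \<in> cspan {uword us | us ds. hom us ds}"
  proof (rule cspan_image_subset[OF _ csubspace_cspan _ in_cspan_hom_words])
    show "clinear (Unitize 0 :: 'v tensor_algebra \<Rightarrow> _)"
      using clinear_unitization(3)[OF clinear_const_0 clinear_ident] .
    fix s assume "s \<in> {word vs |vs ds. hom vs ds}"
    then obtain us ds where us: "s = word us" "hom us ds" by blast
    have "uword us \<in> cspan {uword us | us ds. hom us ds}" using us by (blast intro: complex_vector.span_base)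
    then show "Unitize 0 s \<in> cspan {uword us | us ds. hom us ds}"
      using us(1) by (cases "us = []") (auto simp: uword_def Unitize_zero complex_vector.span_zero)
  qed
  have "hom [] []" by simp
  then have "uword [] \<in> cspan {uword us | us ds. hom us ds}" by (blast intro: complex_vector.span_base)
  then have "c *\<^sub>C uword [] + Unitize 0 r \<in> cspan {uword us | us ds. hom us ds}"
    by (intro complex_vector.span_add complex_vector.span_scale 1)
  then have 2: "Unitize c r \<in> cspan {uword us | us ds. hom us ds}"
    by (simp add: uword_def one_unitization_def scaleC_unitization_def plus_unitization_def)
  show "s \<in> ?U"
    unfolding s
    by (rule cspan_image2_subset[OF cbilinear_pure_tensor csubspace_cspan _ 2 in_cspan_hom_words])
      (auto intro!: complex_vector.span_base)
qed

lemma clinear_hom_forms_in_subspace: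
  assumes "clinear f" "csubspace U" "\<And>us vs ds es. hom us ds \<Longrightarrow> hom vs es \<Longrightarrow> f (uword us \<otimes> word vs) \<in> U"
  shows "f \<omega> \<in> U"
  by (rule cspan_image_subset[OF assms(1,2) _ in_cspan_hom_forms]) (use assms(3) in blast)

text \<open>For \<omega> = us d(vs) and r = ws, the Leibniz rule gives \<omega> r = us d(vs ws) - us
  vs d(ws). Its image consists of the rotations led by letters of \<open>vs\<close> or
  \<open>ws\<close>, minus those led by letters of \<open>ws\<close>. What remains are the rotations
  led by letters of \<open>vs\<close>, which are also those coming from r \<omega> = ws us
  d(vs).\<close>

lemma \<Psi>_commutator:
  assumes "\<omega> \<in> forms_grading TG p" "r \<in> TG q"
  shows "\<Psi> (forms_right \<omega> r - koszul p q *\<^sub>C forms_left r \<omega>) = 0"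
proof -
  let ?B = "\<lambda>\<omega> r. \<Psi> (forms_right \<omega> r - koszul p q *\<^sub>C forms_left r \<omega>)"
  note lin = clinear_compose[OF _ clinear_\<Psi>] clinear_minus clinear_scaleC_right
    clinear_forms_right clinear_forms_left clinear_ident
  have "?B \<omega> r \<in> {0}"
  proof (rule cspan_image2_subset[of ?B, OF _ complex_vector.subspace_single_0 _
        forms_grading_subset[OF assms(1)] assms(2)[unfolded tensor_grading_def]])
    show bil: "cbilinear ?B"
      by (intro cbilinearI lin)
    fix \<omega> r assume "\<omega> \<in> hom_forms p" "r \<in> {word vs |vs ds. hom vs ds \<and> sum_list ds = q}"
    then obtain us vs ws ds es fs where *: "\<omega> = uword us \<otimes> word vs" "r = word ws"
        "hom us ds" "hom vs es" "hom ws fs" "sum_list ds + sum_list es = p" "sum_list fs = q"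
      unfolding hom_forms_def by blast
    show "?B \<omega> r \<in> {0}"
    proof (cases "vs = [] \<or> ws = []")
      case True
      have "?B 0 r = 0" "?B \<omega> 0 = 0"
        using bil clinear_0 unfolding cbilinear_def by blast+
      then show ?thesis using True by (auto simp: *(1,2))
    next
      case False
      let ?m = "length us" and ?n = "length vs" and ?k = "length ws" and ?w = "word (us @ vs @ ws)"
      \<comment> \<open>Rotating \<open>ws\<close> to the end turns the word of r \<omega> into the
        word of \<omega> r at the cost of one Koszul sign, which later cancels against the sign in
        the commutator.\<close>
      have "(t ^^ ?k) (word (ws @ us @ vs)) = koszul q p *\<^sub>C ?w"
        using t_append[OF *(5) list_all2_appendI[OF *(3,4)]] *(6,7) by simp
      then have rot: "(t ^^ (?k + ?m + i)) (word (ws @ us @ vs)) = koszul q p *\<^sub>C (t ^^ (?m + i)) ?w" for i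
        using clinear_scale[OF clinear_funpow[OF clinear_t]]
        by (simp add: add.assoc add.commute[of ?k] funpow_add)
      have "\<Psi> (forms_right \<omega> r) = (\<Sum>i<?n + ?k. (t ^^ (?m + i)) ?w) - (\<Sum>i<?k. (t ^^ (?m + ?n + i)) ?w)"
        using False by (simp add: *(1,2) forms_right_word clinear_diff[OF clinear_\<Psi>] \<Psi>_word)
      also have "(\<Sum>i<?n + ?k. (t ^^ (?m + i)) ?w) =
          (\<Sum>i<?n. (t ^^ (?m + i)) ?w) + (\<Sum>i<?k. (t ^^ (?m + ?n + i)) ?w)"
        by (simp add: sum_lessThan_add add.assoc)
      also have "\<dots> - (\<Sum>i<?k. (t ^^ (?m + ?n + i)) ?w) = koszul p q *\<^sub>C \<Psi> (forms_left r \<omega>)"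
        using False
        by (simp add: *(1,2) forms_left_word \<Psi>_word rot complex_vector.scale_sum_right scaleC_scaleC
            koszul_commute[of q p] koszul_square scaleC_one)
      finally show ?thesis
        by (simp add: clinear_diff[OF clinear_\<Psi>] clinear_scale[OF clinear_\<Psi>])
    qed
  qed
  then show ?thesis by simp
qed

lemma \<Psi>_graded_commutators:
  assumes "\<omega> \<in> graded_forms_commutators TG"
  shows "\<Psi> \<omega> = 0"
proof -
  have "\<Psi> \<omega> \<in> {0}"
    by (rule cspan_image_subset[OF clinear_\<Psi> complex_vector.subspace_single_0 _
          assms[unfolded graded_forms_commutators_def]]) (auto simp: \<Psi>_commutator)
  then show ?thesis by simp
qed

text \<open>Differentiates the last letter. Composing with \<open>t\<close> in
  \<open>\<sigma>\<close> first moves the leading letter there and supplies the Koszul sign, so that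
  v x goes to x dv up to that sign.\<close>

definition \<sigma>0 :: "'v tensor_algebra \<Rightarrow> 'v tensor_algebra forms"
  where "\<sigma>0 = word_lift (\<lambda>vs. if vs = [] then 0 else uword (butlast vs) \<otimes> word [last vs])"

abbreviation \<sigma> :: "'v tensor_algebra \<Rightarrow> 'v tensor_algebra forms"
  where "\<sigma> x \<equiv> \<sigma>0 (t x)"

lemma multilinear_\<sigma>0: "multilinear (\<lambda>vs :: 'v list. if vs = [] then 0 else uword (butlast vs) \<otimes> word [last vs])"
proof (rule multilinearI)
  fix us ws :: "'v list"
  show "clinear (\<lambda>v. if us @ v # ws = [] then 0 else uword (butlast (us @ v # ws)) \<otimes> word [last (us @ v # ws)])"
  proof (cases "ws = []")
    case True
    then show ?thesis by (simp, intro clinear_intros)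
  next
    case False
    then have "butlast (us @ v # ws) = us @ v # butlast ws" "last (us @ v # ws) = last ws" for v
      by (simp_all add: butlast_append)
    then show ?thesis
      by (simp add: uword_def) (intro clinear_intros)
  qed
qed simp

lemma \<sigma>0_word: "\<sigma>0 (word (us @ [v])) = uword us \<otimes> word [v]"
  unfolding \<sigma>0_def by (simp add: multilinear_\<sigma>0)

lemma clinear_\<sigma>0: "clinear \<sigma>0"
  unfolding \<sigma>0_def by (rule clinear_word_lift[OF multilinear_\<sigma>0])

lemma clinear_\<sigma>: "clinear \<sigma>"
  by (rule clinear_compose[OF clinear_t clinear_\<sigma>0])

lemma \<sigma>_word:
  assumes "hom (v # us) (d # ds)"
  shows "\<sigma> (word (v # us)) = koszul d (sum_list ds) *\<^sub>C (uword us \<otimes> word [v])"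
  by (simp add: t_Cons[OF assms] clinear_scale[OF clinear_\<sigma>0] \<sigma>0_word)

text \<open>The leading letter goes to the end and back to the front; the same sign occurs
  twice.\<close>

lemma \<Psi>_\<sigma>: "\<Psi> (\<sigma> x) = x"
proof (rule clinear_eq_on_hom_words[of _ _ x])
  show "clinear (\<lambda>x. \<Psi> (\<sigma> x))" by (rule clinear_compose[OF clinear_\<sigma> clinear_\<Psi>])
  show "clinear (\<lambda>x :: 'v tensor_algebra. x)" by (rule clinear_ident)
  fix vs ds assume hom: "hom vs ds"
  show "\<Psi> (\<sigma> (word vs)) = word vs"
  proof (cases vs)
    case Nil
    then show ?thesis by (simp add: clinear_0[OF clinear_\<Psi>] clinear_0[OF clinear_\<sigma>])
  next
    case (Cons v us)
    then obtain d es where ds: "ds = d # es" "v \<in> G d" "hom us es" using hom by (auto simp: list_all2_Cons1)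
    have "\<Psi> (\<sigma> (word vs)) = koszul d (sum_list es) *\<^sub>C (t ^^ length us) (word (us @ [v]))"
      using \<sigma>_word[of v us d es] hom by (simp add: Cons ds(1) clinear_scale[OF clinear_\<Psi>] \<Psi>_word)
    also have "\<dots> = word vs"
      using ds(2) by (subst t_append[OF ds(3), of "[v]" "[d]"])
        (simp_all add: Cons scaleC_scaleC koszul_commute[of _ d] koszul_square scaleC_one)
    finally show ?thesis .
  qed
qed

lemma \<sigma>_\<Psi>_letter:
  assumes "hom us ds" "hom [v] [d]"
  shows "\<sigma> (\<Psi> (uword us \<otimes> word [v])) = uword us \<otimes> word [v]"
proof -
  have "\<Psi> (uword us \<otimes> word [v]) = koszul (sum_list ds) d *\<^sub>C word (v # us)"
    using t_append[OF assms] by (simp add: \<Psi>_word)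
  then show ?thesis
    using \<sigma>_word[of v us d ds] assms
    by (simp add: clinear_scale[OF clinear_\<sigma>] scaleC_scaleC koszul_commute[of _ d] koszul_square scaleC_one)
qed

lemma csubspace_graded_forms_commutators: "csubspace (graded_forms_commutators TG)"
  unfolding graded_forms_commutators_def by (rule csubspace_cspan)

text \<open>By the Leibniz rule, us d(v vs) = (us dv) vs + us v d(vs). One commutator replaces the
  first term by a multiple of vs us dv, where a single letter is differentiated and the claim is an
  equality. The second term has a shorter differentiated word, hence the induction over all prefixes
  \<open>us\<close>.\<close>

lemma \<sigma>_\<Psi>_word:
  "hom us ds \<Longrightarrow> hom vs es \<Longrightarrow> \<sigma> (\<Psi> (uword us \<otimes> word vs)) - uword us \<otimes> word vs \<in> graded_forms_commutators TG"
proof (induction vs arbitrary: us ds es)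
  case Nil
  then show ?case
    by (simp add: clinear_0[OF clinear_\<sigma>] clinear_0[OF clinear_\<Psi>]
        complex_vector.subspace_0[OF csubspace_graded_forms_commutators])
next
  case (Cons v vs)
  let ?C = "graded_forms_commutators TG"
  obtain d fs where es: "es = d # fs" "hom [v] [d]" "hom vs fs"
    using Cons.prems by (auto simp: list_all2_Cons1)
  show ?case
  proof (cases "vs = []")
    case True
    then show ?thesis
      by (simp add: \<sigma>_\<Psi>_letter[OF Cons.prems(1) es(2)]
          complex_vector.subspace_0[OF csubspace_graded_forms_commutators])
  next
    case False
    define k where "k = koszul (sum_list ds + sum_list [d]) (sum_list fs)"
    define l where "l = uword (vs @ us) \<otimes> word [v]"
    define m where "m = uword (us @ [v]) \<otimes> word vs"
    define c where "c = forms_right (uword us \<otimes> word [v]) (word vs) - k *\<^sub>C forms_left (word vs) (uword us \<otimes> word [v])"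
    have "c \<in> ?C"
      unfolding graded_forms_commutators_def c_def k_def
      using hom_form_in_forms_grading[OF Cons.prems(1) es(2)] hom_word_in_tensor_grading[OF es(3)]
      by (blast intro: complex_vector.span_base)
    have split: "uword us \<otimes> word (v # vs) = c + (k *\<^sub>C l + m)"
      using False by (simp add: c_def l_def m_def forms_right_word forms_left_word)
    have "\<sigma> (\<Psi> c) = 0"
      by (simp add: \<Psi>_graded_commutators[OF \<open>c \<in> ?C\<close>] clinear_0[OF clinear_\<sigma>])
    moreover have "\<sigma> (\<Psi> l) = l"
      unfolding l_def by (rule \<sigma>_\<Psi>_letter[OF list_all2_appendI[OF es(3) Cons.prems(1)] es(2)])
    ultimately have "\<sigma> (\<Psi> (uword us \<otimes> word (v # vs))) - uword us \<otimes> word (v # vs) = (\<sigma> (\<Psi> m) - m) - c"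
      unfolding split
      by (simp add: clinear_add[OF clinear_\<sigma>] clinear_add[OF clinear_\<Psi>] clinear_scale[OF clinear_\<sigma>]
          clinear_scale[OF clinear_\<Psi>])
    also have "\<dots> \<in> ?C"
      unfolding m_def
      by (intro complex_vector.subspace_diff[OF csubspace_graded_forms_commutators] \<open>c \<in> ?C\<close>
          Cons.IH[OF list_all2_appendI[OF Cons.prems(1) es(2)] es(3)])
    finally show ?thesis .
  qed
qed

lemma \<sigma>_\<Psi>: "\<sigma> (\<Psi> \<omega>) - \<omega> \<in> graded_forms_commutators TG"
proof (rule clinear_hom_forms_in_subspace[of "\<lambda>\<omega>. \<sigma> (\<Psi> \<omega>) - \<omega>", OF _ csubspace_graded_forms_commutators])
  show "clinear (\<lambda>\<omega>. \<sigma> (\<Psi> \<omega>) - \<omega>)"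
    by (intro clinear_minus clinear_ident clinear_compose[OF clinear_\<Psi> clinear_\<sigma>])
qed (rule \<sigma>_\<Psi>_word)

section \<open>The boundary b in terms of t\<close>

lemma cbilinear_graded_X_b: "cbilinear (\<lambda>x y. graded_commutator TG (algebra_part x) y)"
  by (intro clinear_intros cbilinear_clinear[OF cbilinear_graded_commutator[OF is_grading_tensor_grading]])

lemma clinear_graded_X_b: "clinear (graded_X_b TG)"
  unfolding graded_X_b_def by (rule clinear_tensor_lift[OF cbilinear_graded_X_b])

text \<open>For us d(vs) with m and n letters, t - 1 telescopes the sum of powers in
  \<open>\<Psi>\<close> to t^(m+n) - t^m. The first power is a full rotation, hence the identity;
  the second exchanges \<open>us\<close> and \<open>vs\<close> with sign. The difference is the
  graded commutator.\<close>

lemma graded_X_b_eq: "graded_X_b TG \<omega> = t (\<Psi> \<omega>) - \<Psi> \<omega>"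
proof -
  let ?f = "\<lambda>\<omega>. graded_X_b TG \<omega> - (t (\<Psi> \<omega>) - \<Psi> \<omega>)"
  have "?f \<omega> \<in> {0}"
  proof (rule clinear_hom_forms_in_subspace[OF _ complex_vector.subspace_single_0])
    show "clinear ?f"
      by (intro clinear_minus clinear_graded_X_b clinear_\<Psi> clinear_compose[OF clinear_\<Psi> clinear_t])
    fix us vs ds es assume *: "hom us ds" "hom vs es"
    let ?w = "word (us @ vs)" and ?m = "length us" and ?n = "length vs"
    have "t (\<Psi> (uword us \<otimes> word vs)) - \<Psi> (uword us \<otimes> word vs) =
        (\<Sum>i<?n. (t ^^ (?m + Suc i)) ?w - (t ^^ (?m + i)) ?w)"
      by (simp add: \<Psi>_word clinear_sum[OF clinear_t] sum_subtractf)
    also have "\<dots> = (t ^^ length (us @ vs)) ?w - (t ^^ ?m) ?w"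
      using sum_lessThan_telescope[of "\<lambda>i. (t ^^ (?m + i)) ?w" ?n] by simp
    also have "\<dots> = ?w - koszul (sum_list ds) (sum_list es) *\<^sub>C word (vs @ us)"
      unfolding t_full_rotation[OF list_all2_appendI[OF *]] t_append[OF *] ..
    also have "\<dots> = graded_X_b TG (uword us \<otimes> word vs)"
    proof (cases "us = []")
      \<comment> \<open>With an empty prefix both sides vanish: b drops the scalar coefficient, and
        the two words coincide with trivial sign.\<close>
      case True
      have "clinear (\<lambda>x. graded_commutator TG x (word vs))"
        using cbilinear_graded_commutator[OF is_grading_tensor_grading] by (simp add: cbilinear_def)
      from clinear_0[OF this] show ?thesis
        using True *(1) by (simp add: graded_X_b_def cbilinear_graded_X_b uword_def one_unitization_def scaleC_one)
    next
      case False
      then show ?thesis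
        using graded_commutator_homogeneous[OF is_grading_tensor_grading
            hom_word_in_tensor_grading[OF *(1)] hom_word_in_tensor_grading[OF *(2)]] *
          clinear_0[OF clinear_graded_X_b]
        by (cases "vs = []")
            (simp_all add: graded_X_b_def cbilinear_graded_X_b uword_def word_times_word word_append_def scaleC_one)
    qed
    finally show "?f (uword us \<otimes> word vs) \<in> {0}" by simp
  qed
  then show ?thesis by simp
qed

end


section \<open>Compatibility with the Hopf algebra action\<close>

lemma scaleC_diff_scaleC:
  fixes x y :: "'a::complex_vector"
  shows "c *\<^sub>C x - d *\<^sub>C c *\<^sub>C y = c *\<^sub>C (x - d *\<^sub>C y)"
  by (simp add: complex_vector.scale_right_diff_distrib scaleC_scaleC mult.commute)

locale graded_twisted_hopf_module = twisted_hopf_module \<Delta> \<epsilon> \<delta> S \<rho> + graded_vector_space G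
  for \<Delta> :: "'h::complex_algebra_1 \<Rightarrow> 'h \<otimes>\<^sub>t 'h" and \<epsilon> \<delta> :: "'h \<Rightarrow> complex" and S :: "'h \<Rightarrow> 'h"
    and \<rho> :: "'h \<Rightarrow> 'v::complex_vector \<Rightarrow> 'v" and G :: "int \<Rightarrow> 'v set" +
  assumes action_degree: "v \<in> G p \<Longrightarrow> \<rho> h v \<in> G p"
begin

abbreviation W :: "'v tensor_algebra set"
  where "W \<equiv> coinvariants \<delta> \<tau>"

abbreviation U1 :: "'v tensor_algebra forms set"
  where "U1 \<equiv> graded_X1_relations TG \<Delta> \<epsilon> \<delta> \<tau>"

text \<open>Each letter is acted on by an operator of degree 0, so the degree list survives although
  the word becomes a sum of words.\<close>

lemma tensor_action_hwords_word: "hom vs ds \<Longrightarrow> \<tau> h (word vs) \<in> hwords ds"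
proof (induction vs arbitrary: ds h)
  case Nil
  then show ?case by (simp add: complex_vector.subspace_0[OF csubspace_hwords])
next
  case (Cons v vs)
  then obtain d es where ds: "ds = d # es" "v \<in> G d" "hom vs es" by (auto simp: list_all2_Cons1)
  have v: "\<tau> a (word [v]) \<in> hwords [d]" for a
    unfolding tensor_action_letter by (rule word_in_hwords) (simp add: action_degree ds(2))
  show ?case
  proof (cases "vs = []")
    case True
    then show ?thesis using ds v by simp
  next
    case False
    show ?thesis
      unfolding tensor_action_Cons[OF False] ds(1)
      using hwords_mult[OF v Cons.IH[OF ds(3)]]
      by (intro tensor_lift_in_csubspace csubspace_hwords) simp
  qed
qed

lemma unitization_action_huwords:
  assumes "hom us ds" shows "\<upsilon> h (uword us) \<in> huwords ds"
proof (cases "us = []")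
  case True
  then have "\<upsilon> h (uword us) = \<epsilon> h *\<^sub>C uword us"
    by (simp add: uword_def unitization_action_def one_unitization_def scaleC_unitization_def)
  then show ?thesis
    by (simp add: uword_in_huwords assms complex_vector.subspace_scale[OF csubspace_huwords])
next
  case False
  have "clinear (\<lambda>r :: 'v tensor_algebra. Unitize 0 r)" by (intro clinear_intros)
  then have "Unitize 0 (\<tau> h (word us)) \<in> huwords ds"
  proof (rule cspan_image_subset[OF _ csubspace_huwords _ tensor_action_hwords_word[OF assms, unfolded hwords_def]])
    fix s assume "s \<in> {word vs | vs. hom vs ds}"
    then obtain vs where vs: "s = word vs" "hom vs ds" by blast
    then have "vs \<noteq> []" using False assms by auto
    then show "Unitize 0 s \<in> huwords ds"
      using uword_in_huwords[OF vs(2)] by (simp add: vs(1) uword_def)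
  qed
  then show ?thesis using False by (simp add: uword_def unitization_action_def)
qed

text \<open>The exchange of legs on the tensor square of T(V), pushed forward along multiplication,
  which is equivariant by \<open>tensor_action_mult\<close>.\<close>

lemma coinvariants_flip_mult:
  "sweedler (\<lambda>a b. \<tau> b y * \<tau> a x) h - \<delta> h *\<^sub>C (y * x) \<in> W"
proof -
  let ?\<mu> = "tensor_lift (\<lambda>x y. x * y) :: 'v tensor_algebra \<otimes>\<^sub>t 'v tensor_algebra \<Rightarrow> _"
  have mult: "cbilinear (\<lambda>x y. x * y :: 'v tensor_algebra)" by (intro clinear_intros)
  note \<mu> = clinear_tensor_lift[OF mult]
  let ?D = "diagonal_action \<Delta> \<tau> \<tau>"
  have "?\<mu> (?D h z) = \<tau> h (?\<mu> z)" for h z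
  proof (rule clinear_eq_on_tensors[of _ _ z])
    show "clinear (\<lambda>z. ?\<mu> (?D h z))" "clinear (\<lambda>z. \<tau> h (?\<mu> z))"
      by (intro clinear_intros clinear_tensor_action mult
          clinear_diagonal_action[OF hmodule_tensor_action hmodule_tensor_action])+
    show "?\<mu> (?D h (a \<otimes> b)) = \<tau> h (?\<mu> (a \<otimes> b))" for a b
      unfolding diagonal_action_pure[OF hmodule_tensor_action hmodule_tensor_action] tensor_lift_compose[OF \<mu>]
      by (simp add: mult tensor_action_mult)
  qed
  from coinvariants_equivariant[where f = ?\<mu>, OF \<mu> this
      coinvariants_flip[OF hmodule_tensor_action hmodule_tensor_action, of y x h]]
  show ?thesis
    unfolding clinear_diff[OF \<mu>] clinear_scale[OF \<mu>] tensor_lift_compose[OF \<mu>] by (simp add: mult)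
qed

text \<open>Up to a constant sign, t sends h (v us) to the sum of (h_1 us)(h_0 v), with the legs in
  the wrong order; \<open>coinvariants_flip_mult\<close> repairs this.\<close>

lemma t_coinvariants:
  assumes "x \<in> W" shows "t x \<in> W"
proof (rule coinvariants_mapI[OF clinear_t csubspace_coinvariants _ assms])
  fix h w
  show "t (\<tau> h w - \<delta> h *\<^sub>C w) \<in> W"
  proof (rule cspan_image_subset[of "\<lambda>w. t (\<tau> h w - \<delta> h *\<^sub>C w)", OF _ csubspace_coinvariants _ in_cspan_hom_words])
    show "clinear (\<lambda>w. t (\<tau> h w - \<delta> h *\<^sub>C w))"
      by (intro clinear_intros clinear_t_arg clinear_tensor_action)
    fix s assume "s \<in> {word vs |vs ds. hom vs ds}"
    then obtain vs ds where vs: "s = word vs" "hom vs ds" by blast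
    show "t (\<tau> h s - \<delta> h *\<^sub>C s) \<in> W"
    proof (cases vs)
      case Nil
      then show ?thesis
        by (simp add: vs(1) clinear_0[OF clinear_t] complex_vector.subspace_0[OF csubspace_coinvariants])
    next
      case (Cons v us)
      then obtain d es where ds: "ds = d # es" "v \<in> G d" "hom us es" using vs(2) by (auto simp: list_all2_Cons1)
      have v: "hom [v] [d]" using ds(2) by simp
      show ?thesis
      proof (cases "us = []")
        \<comment> \<open>A single letter is fixed by \<open>t\<close>; the action splits into two
          factors only on longer words.\<close>
        case True
        have hv: "hom [\<rho> h v] [d]" by (simp add: action_degree ds(2))
        then have "t (\<tau> h s - \<delta> h *\<^sub>C s) = \<tau> h s - \<delta> h *\<^sub>C s"
          by (simp add: vs(1) Cons True tensor_action_letter clinear_diff[OF clinear_t]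
              clinear_scale[OF clinear_t] t_letter[OF v] t_letter[OF hv])
        then show ?thesis by (simp add: coinvariants_base)
      next
        case False
        let ?k = "koszul d (sum_list es)"
        let ?F = "sweedler (\<lambda>a b. \<tau> b (word us) * \<tau> a (word [v])) h - \<delta> h *\<^sub>C (word us * word [v])"
        have "t (\<tau> h s) = sweedler (\<lambda>a b. t (\<tau> a (word [v]) * \<tau> b (word us))) h"
          unfolding vs(1) Cons tensor_action_Cons[OF False] by (rule tensor_lift_compose[OF clinear_t])
        also have "\<dots> = sweedler (\<lambda>a b. ?k *\<^sub>C (\<tau> b (word us) * \<tau> a (word [v]))) h"
          by (simp only: t_mult[OF tensor_action_hwords_word[OF v] tensor_action_hwords_word[OF ds(3)]])
        also have "\<dots> = ?k *\<^sub>C sweedler (\<lambda>a b. \<tau> b (word us) * \<tau> a (word [v])) h"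
          by (rule tensor_lift_compose[symmetric]) (intro clinear_intros)
        finally have 1: "t (\<tau> h s) = ?k *\<^sub>C sweedler (\<lambda>a b. \<tau> b (word us) * \<tau> a (word [v])) h" .
        have 2: "t s = ?k *\<^sub>C (word us * word [v])"
          unfolding vs(1) Cons word_Cons[OF False]
          by (rule t_mult[OF word_in_hwords[OF v] word_in_hwords[OF ds(3)]])
        have "t (\<tau> h s - \<delta> h *\<^sub>C s) = ?k *\<^sub>C ?F"
          unfolding clinear_diff[OF clinear_t] clinear_scale[OF clinear_t] 1 2 by (rule scaleC_diff_scaleC)
        then show ?thesis
          by (simp only: complex_vector.subspace_scale[OF csubspace_coinvariants] coinvariants_flip_mult)
      qed
    qed
  qed
qed

lemma t_power_coinvariants: "x \<in> W \<Longrightarrow> (t ^^ n) x \<in> W"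
  by (induction n) (auto intro: t_coinvariants)

section \<open>Exchange of relation spaces between 1-forms and T(V)\<close>

lemma csubspace_U1: "csubspace U1"
  unfolding graded_X1_relations_def
  by (intro csubspace_set_plus csubspace_graded_forms_commutators csubspace_coinvariants)

lemma commutators_in_U1: "\<omega> \<in> graded_forms_commutators TG \<Longrightarrow> \<omega> \<in> U1"
  using set_plus_intro[OF _ complex_vector.subspace_0[OF csubspace_coinvariants]]
  by (simp add: graded_X1_relations_def)

lemma coinvariants_in_U1: "\<omega> \<in> coinvariants \<delta> (forms_action \<Delta> \<epsilon> \<tau>) \<Longrightarrow> \<omega> \<in> U1"
  using set_plus_intro[OF complex_vector.subspace_0[OF csubspace_graded_forms_commutators]]
  by (simp add: graded_X1_relations_def)

lemma clinear_forms_action: "clinear (forms_action \<Delta> \<epsilon> \<tau> h)"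
  unfolding forms_action_def
  by (rule clinear_diagonal_action[OF hmodule_unitization_action hmodule_tensor_action])

lemma forms_action_pure:
  "forms_action \<Delta> \<epsilon> \<tau> h (x \<otimes> y) = sweedler (\<lambda>a b. \<upsilon> a x \<otimes> \<tau> b y) h"
  unfolding forms_action_def
  by (rule diagonal_action_pure[OF hmodule_unitization_action hmodule_tensor_action])

text \<open>With w = x y, the image of h \<omega> - \<delta>(h) \<omega> is a sum of powers of t
  applied to h w - \<delta>(h) w, and these powers preserve \<open>W\<close>.\<close>

lemma \<Psi>_coinvariants:
  assumes "\<omega> \<in> coinvariants \<delta> (forms_action \<Delta> \<epsilon> \<tau>)"
  shows "\<Psi> \<omega> \<in> W"
proof (rule coinvariants_mapI[OF clinear_\<Psi> csubspace_coinvariants _ assms])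
  fix h \<omega>
  let ?f = "\<lambda>\<omega>. \<Psi> (forms_action \<Delta> \<epsilon> \<tau> h \<omega> - \<delta> h *\<^sub>C \<omega>)"
  show "?f \<omega> \<in> W"
  proof (rule clinear_hom_forms_in_subspace[of ?f, OF _ csubspace_coinvariants])
    show "clinear ?f"
      by (intro clinear_compose[OF _ clinear_\<Psi>] clinear_minus clinear_forms_action clinear_scaleC_right clinear_ident)
    fix us vs ds es assume *: "hom us ds" "hom vs es"
    let ?w = "umult (uword us) (word vs)"
    have "\<Psi> (forms_action \<Delta> \<epsilon> \<tau> h (uword us \<otimes> word vs)) =
        sweedler (\<lambda>a b. \<Psi> (\<upsilon> a (uword us) \<otimes> \<tau> b (word vs))) h"
      unfolding forms_action_pure by (rule tensor_lift_compose[OF clinear_\<Psi>])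
    also have "\<dots> = sweedler (\<lambda>a b. \<Sum>i<length es. (t ^^ (length ds + i)) (umult (\<upsilon> a (uword us)) (\<tau> b (word vs)))) h"
      by (simp only: \<Psi>_homogeneous[OF unitization_action_huwords[OF *(1)] tensor_action_hwords_word[OF *(2)]])
    also have "\<dots> = (\<Sum>i<length es. (t ^^ (length ds + i)) (\<tau> h ?w))"
      unfolding tensor_action_umult
      by (rule tensor_lift_compose[symmetric]) (intro clinear_intros clinear_t)
    finally have "?f (uword us \<otimes> word vs) = (\<Sum>i<length es. (t ^^ (length ds + i)) (\<tau> h ?w - \<delta> h *\<^sub>C ?w))"
      using \<Psi>_homogeneous[OF uword_in_huwords[OF *(1)] word_in_hwords[OF *(2)]]
      by (simp add: clinear_diff[OF clinear_\<Psi>] clinear_scale[OF clinear_\<Psi>] complex_vector.scale_sum_right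
          clinear_diff[OF clinear_funpow[OF clinear_t]] clinear_scale[OF clinear_funpow[OF clinear_t]] sum_subtractf)
    also have "\<dots> \<in> W"
      by (intro complex_vector.subspace_sum[OF csubspace_coinvariants] t_power_coinvariants coinvariants_base)
    finally show "?f (uword us \<otimes> word vs) \<in> W" .
  qed
qed

lemma \<Psi>_U1: "\<omega> \<in> U1 \<Longrightarrow> \<Psi> \<omega> \<in> W"
  unfolding graded_X1_relations_def
  by (auto elim!: set_plus_elim simp: clinear_add[OF clinear_\<Psi>] \<Psi>_graded_commutators \<Psi>_coinvariants)

text \<open>The leading letter ends up under d and to the right of its coefficient, so the first leg
  of the coproduct acts on the second factor. This is the form to which
  \<open>coinvariants_flip\<close> applies.\<close>

lemma \<sigma>_mult_letter:
  assumes "hom (v # us) (d # ds)"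
  shows "\<sigma> (\<tau> h (word (v # us))) =
    koszul d (sum_list ds) *\<^sub>C sweedler (\<lambda>a b. \<upsilon> b (uword us) \<otimes> \<tau> a (word [v])) h"
proof -
  have v: "hom [v] [d]" "v \<in> G d" and us: "hom us ds" using assms by auto
  show ?thesis
  proof (cases "us = []")
    \<comment> \<open>Here the coefficient is the unit; the second leg acts on it by the counit and
      is absorbed.\<close>
    case True
    have "sweedler (\<lambda>a b. \<upsilon> b (uword us) \<otimes> \<tau> a (word [v])) h =
        sweedler (\<lambda>a b. \<epsilon> b *\<^sub>C (uword us \<otimes> \<tau> a (word [v]))) h"
      using True by (simp add: uword_def unitization_action_def one_unitization_def scaleC_unitization_def
          flip: pure_tensor_scale(1))
    also have "\<dots> = uword us \<otimes> \<tau> h (word [v])"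
      by (rule counit_right) (intro clinear_intros clinear_tensor_action)
    also have "\<dots> = \<sigma> (\<tau> h (word [v]))"
      using \<sigma>_word[of "\<rho> h v" "[]" d "[]"] True action_degree[OF v(2)]
      by (simp add: tensor_action_letter scaleC_one)
    finally show ?thesis using True us by (simp add: scaleC_one)
  next
    case False
    let ?k = "koszul d (sum_list ds)"
    \<comment> \<open>Stated on spans of words because the action does not return single
      words.\<close>
    have "\<sigma> (x * y) = ?k *\<^sub>C (Unitize 0 y \<otimes> x)" if "x \<in> hwords [d]" "y \<in> hwords ds" for x y
    proof -
      let ?B = "\<lambda>x y. \<sigma> (x * y) - ?k *\<^sub>C (Unitize 0 y \<otimes> x)"
      have "?B x y \<in> {0}"
      proof (rule cspan_image2_subset[of ?B, OF _ complex_vector.subspace_single_0 _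
            that[unfolded hwords_def]])
        show "cbilinear ?B"
          by (intro clinear_intros clinear_compose[OF _ clinear_\<sigma>])
        fix x y assume "x \<in> {word vs | vs. hom vs [d]}" "y \<in> {word vs | vs. hom vs ds}"
        then obtain w ws where *: "x = word [w]" "y = word ws" "hom (w # ws) (d # ds)"
          by (auto simp: list_all2_Cons2)
        moreover have "ws \<noteq> []" using * us False by auto
        ultimately show "?B x y \<in> {0}"
          using \<sigma>_word[OF *(3)] by (simp add: word_Cons uword_def)
      qed
      then show ?thesis by simp
    qed
    then have *: "\<sigma> (\<tau> a (word [v]) * \<tau> b (word us)) = ?k *\<^sub>C (\<upsilon> b (uword us) \<otimes> \<tau> a (word [v]))" for a b
      using tensor_action_hwords_word[OF v(1)] tensor_action_hwords_word[OF us] False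
      by (simp add: uword_def unitization_action_def)
    have "\<sigma> (\<tau> h (word (v # us))) = sweedler (\<lambda>a b. ?k *\<^sub>C (\<upsilon> b (uword us) \<otimes> \<tau> a (word [v]))) h"
      unfolding tensor_action_Cons[OF False] tensor_lift_compose[OF clinear_\<sigma>] * ..
    also have "\<dots> = ?k *\<^sub>C sweedler (\<lambda>a b. \<upsilon> b (uword us) \<otimes> \<tau> a (word [v])) h"
      by (rule tensor_lift_compose[symmetric]) (intro clinear_intros)
    finally show ?thesis .
  qed
qed

text \<open>The exchange of legs is applied to the diagonal action on 1-forms itself, so the error
  consists of coinvariants alone and no commutator appears.\<close>

lemma \<sigma>_coinvariants:
  assumes "x \<in> W" shows "\<sigma> x \<in> U1"
proof (rule coinvariants_mapI[OF clinear_\<sigma> csubspace_U1 _ assms])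
  fix h w
  let ?f = "\<lambda>w. \<sigma> (\<tau> h w - \<delta> h *\<^sub>C w)"
  show "?f w \<in> U1"
  proof (rule cspan_image_subset[of ?f, OF _ csubspace_U1 _ in_cspan_hom_words])
    show lin: "clinear ?f"
      by (intro clinear_intros clinear_compose[OF _ clinear_\<sigma>] clinear_tensor_action)
    fix s assume "s \<in> {word vs |vs ds. hom vs ds}"
    then obtain vs ds where vs: "s = word vs" "hom vs ds" by blast
    show "?f s \<in> U1"
    proof (cases vs)
      case Nil
      then show ?thesis using clinear_0[OF lin] by (simp add: vs(1) complex_vector.subspace_0[OF csubspace_U1])
    next
      case (Cons v us)
      then obtain d es where hom: "hom (v # us) (d # es)" using vs(2) by (auto simp: list_all2_Cons1)
      have "?f s = koszul d (sum_list es) *\<^sub>C (sweedler (\<lambda>a b. \<upsilon> b (uword us) \<otimes> \<tau> a (word [v])) h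
          - \<delta> h *\<^sub>C (uword us \<otimes> word [v]))"
        unfolding vs(1) Cons clinear_diff[OF clinear_\<sigma>] clinear_scale[OF clinear_\<sigma>] \<sigma>_word[OF hom] \<sigma>_mult_letter[OF hom]
        by (rule scaleC_diff_scaleC)
      also have "\<dots> \<in> U1"
        by (intro complex_vector.subspace_scale[OF csubspace_U1] coinvariants_in_U1, unfold forms_action_def,
            rule coinvariants_flip[OF hmodule_unitization_action hmodule_tensor_action])
      finally show ?thesis .
    qed
  qed
qed

text \<open>d is equivariant: the first leg acts on the unit by the counit.\<close>

lemma X_d_coinvariants:
  assumes "x \<in> W" shows "X_d x \<in> U1"
proof (rule coinvariants_in_U1, rule coinvariants_equivariant[OF _ _ assms])
  show "clinear (X_d :: 'v tensor_algebra \<Rightarrow> _)"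
    unfolding X_d_def[abs_def] by (intro clinear_intros)
  fix h and w :: "'v tensor_algebra"
  have "forms_action \<Delta> \<epsilon> \<tau> h (1 \<otimes> w) = sweedler (\<lambda>a b. \<epsilon> a *\<^sub>C (1 \<otimes> \<tau> b w)) h"
    unfolding forms_action_pure
    by (simp add: unitization_action_def one_unitization_def scaleC_unitization_def flip: pure_tensor_scale(1))
  also have "\<dots> = 1 \<otimes> \<tau> h w"
    by (rule counit_left) (intro clinear_intros clinear_tensor_action)
  finally show "X_d (\<tau> h w) = forms_action \<Delta> \<epsilon> \<tau> h (X_d w)"
    by (simp add: X_d_def)
qed

end


section \<open>Quotient spaces\<close>

lemma coset_eq_iff:
  assumes "csubspace U"
  shows "x +o U = y +o U \<longleftrightarrow> x - y \<in> U"
proof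
  assume "x +o U = y +o U"
  then have "x \<in> y +o U"
    using set_zero_plus2[of 0] complex_vector.subspace_0[OF assms] by (force simp: elt_set_plus_def)
  then show "x - y \<in> U" by (auto simp: elt_set_plus_def)
next
  assume xy: "x - y \<in> U"
  have "a +o U \<subseteq> b +o U" if "a - b \<in> U" for a b
    unfolding elt_set_plus_def
    using complex_vector.subspace_add[OF assms that] by (force simp: algebra_simps)
  then show "x +o U = y +o U"
    using xy complex_vector.subspace_neg[OF assms xy] by (intro equalityI) auto
qed

lemma coset_plus:
  assumes "csubspace U"
  shows "(x +o U) + (y +o U) = (x + y) +o U"
proof -
  have "U + U = U"
    using complex_vector.subspace_0[OF assms] complex_vector.subspace_add[OF assms]
    by (force simp: set_plus_def)
  then show ?thesis by (simp add: set_plus_rearrange)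
qed

lemma quotient_map_coset:
  assumes "clinear f" "csubspace U" "csubspace W" "f ` U \<subseteq> W"
  shows "quotient_map f W (x +o U) = f x +o W"
proof -
  have "f ` (x +o U) + W \<subseteq> f x +o W"
  proof
    fix y assume "y \<in> f ` (x +o U) + W"
    then obtain u w where y: "y = f (x + u) + w" "u \<in> U" "w \<in> W"
      by (auto simp: elt_set_plus_def elim!: set_plus_elim)
    have "f u + w \<in> W"
      using assms(4) y(2,3) complex_vector.subspace_add[OF assms(3)] by blast
    then show "y \<in> f x +o W"
      using set_plus_intro2[of "f u + w" W "f x"] by (simp add: y(1) clinear_add[OF assms(1)] add.assoc)
  qed
  moreover have "f x +o W \<subseteq> f ` (x +o U) + W"
  proof
    fix y assume "y \<in> f x +o W"
    then obtain w where y: "y = f x + w" "w \<in> W" by (auto simp: elt_set_plus_def)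
    have "x \<in> x +o U"
      using set_plus_intro2[OF complex_vector.subspace_0[OF assms(2)], of x] by simp
    then show "y \<in> f ` (x +o U) + W"
      unfolding y(1) by (intro set_plus_intro imageI y(2))
  qed
  ultimately show ?thesis
    by (simp add: quotient_map_def)
qed

text \<open>An inverse up to relations is enough, which suits \<open>\<sigma>\<close>: following
  \<open>\<Psi>\<close> it gives the identity only modulo commutators.\<close>

lemma quotient_isoI:
  assumes lin: "clinear f" and sub: "csubspace U" "csubspace W"
    and f: "f ` U \<subseteq> W" and g: "\<And>x y. x - y \<in> W \<Longrightarrow> g x - g y \<in> U"
    and gf: "\<And>x. g (f x) - x \<in> U" and fg: "\<And>y. f (g y) - y \<in> W"
  shows "quotient_iso U W (quotient_map f W)"
  unfolding quotient_iso_def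
proof (intro conjI ballI allI)
  note map = quotient_map_coset[OF lin sub f]
  note scale = quotient_map_coset[OF clinear_scaleC_right[OF clinear_ident]]
  show "bij_betw (quotient_map f W) (quotient_space U) (quotient_space W)"
  proof (rule bij_betwI')
    fix A B assume "A \<in> quotient_space U" "B \<in> quotient_space U"
    then obtain x y where AB: "A = x +o U" "B = y +o U" by (auto simp: quotient_space_def)
    have "x - y \<in> U" if "f x - f y \<in> W"
    proof -
      have "(g (f x) - g (f y)) - (g (f x) - x) + (g (f y) - y) \<in> U"
        by (intro complex_vector.subspace_add complex_vector.subspace_diff sub g that gf)
      then show ?thesis by (simp add: algebra_simps)
    qed
    moreover have "f x - f y \<in> W" if "x - y \<in> U"
      using f that by (auto simp flip: clinear_diff[OF lin])
    ultimately show "quotient_map f W A = quotient_map f W B \<longleftrightarrow> A = B"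
      unfolding AB map coset_eq_iff[OF sub(1)] coset_eq_iff[OF sub(2)] by blast
  next
    show "quotient_map f W A \<in> quotient_space W" if "A \<in> quotient_space U" for A
      using that by (auto simp: quotient_space_def map)
  next
    fix B assume "B \<in> quotient_space W"
    then obtain y where "B = y +o W" by (auto simp: quotient_space_def)
    also have "\<dots> = quotient_map f W (g y +o U)"
      unfolding map coset_eq_iff[OF sub(2)]
      using complex_vector.subspace_neg[OF sub(2) fg[of y]] by simp
    finally show "\<exists>A\<in>quotient_space U. B = quotient_map f W A"
      by (auto simp: quotient_space_def)
  qed
  show "quotient_map f W (A + B) = quotient_map f W A + quotient_map f W B"
    if "A \<in> quotient_space U" "B \<in> quotient_space U" for A B
    using that by (auto simp: quotient_space_def map coset_plus sub clinear_add[OF lin])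
  show "quotient_map f W (quotient_map ((*\<^sub>C) c) U A) = quotient_map ((*\<^sub>C) c) W (quotient_map f W A)"
    if "A \<in> quotient_space U" for c A
  proof -
    have "(*\<^sub>C) c ` U \<subseteq> U" "(*\<^sub>C) c ` W \<subseteq> W"
      using complex_vector.subspace_scale[OF sub(1)] complex_vector.subspace_scale[OF sub(2)] by auto
    then show ?thesis
      using that by (auto simp: quotient_space_def map scale sub clinear_scale[OF lin])
  qed
qed

lemma quotient_map_id: "csubspace W \<Longrightarrow> quotient_map (\<lambda>x. x) W (x +o W) = x +o W"
  by (rule quotient_map_coset) (auto intro: clinear_ident)

section \<open>Assembly of the isomorphism of super-complexes\<close>

context graded_twisted_hopf_module
begin

lemma graded_X_complex_iso:
  shows "t ` W \<subseteq> W"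
    and "quotient_supercomplex_iso W U1 (graded_X_b TG) X_d W W (\<lambda>w. t w - w) (norm_operator t)
      (quotient_map (\<lambda>x. x) W) (quotient_map \<Psi> W)"
    and "v \<in> G p \<Longrightarrow> r \<in> TG q \<Longrightarrow> quotient_map \<Psi> W (Unitize c r \<otimes> word [v] +o U1) =
      (c *\<^sub>C word [v] + koszul p q *\<^sub>C (word [v] * r)) +o W"
proof -
  show tW: "t ` W \<subseteq> W" using t_coinvariants by blast
  note W = csubspace_coinvariants[of \<delta> \<tau>]
  have \<Psi>U: "\<Psi> ` U1 \<subseteq> W" using \<Psi>_U1 by blast
  \<comment> \<open>Already on forms b is t - 1 after \<open>\<Psi>\<close>, so it descends because
    \<open>\<Psi>\<close> and \<open>t\<close> do.\<close>
  have b: "graded_X_b TG ` U1 \<subseteq> W"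
    using \<Psi>_U1 t_coinvariants complex_vector.subspace_diff[OF W] by (auto simp: graded_X_b_eq)
  have d: "X_d ` W \<subseteq> U1" using X_d_coinvariants by blast
  have b': "(\<lambda>w. t w - w) ` W \<subseteq> W"
    using t_coinvariants complex_vector.subspace_diff[OF W] by auto
  \<comment> \<open>N is \<open>\<Psi>\<close> after \<open>X_d\<close> and inherits its descent
    from these two maps.\<close>
  have N: "norm_operator t ` W \<subseteq> W"
    using \<Psi>_U1 X_d_coinvariants by (auto simp flip: \<Psi>_d)
  have lin_b': "clinear (\<lambda>w. t w - w)" by (intro clinear_minus clinear_ident clinear_t)
  have lin_d: "clinear (X_d :: 'v tensor_algebra \<Rightarrow> _)" unfolding X_d_def[abs_def] by (intro clinear_intros)
  note map_\<Psi> = quotient_map_coset[OF clinear_\<Psi> csubspace_U1 W \<Psi>U]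
  show "quotient_supercomplex_iso W U1 (graded_X_b TG) X_d W W (\<lambda>w. t w - w) (norm_operator t)
      (quotient_map (\<lambda>x. x) W) (quotient_map \<Psi> W)"
    unfolding quotient_supercomplex_iso_def
  proof (intro conjI b d b' N ballI)
    show "quotient_iso W W (quotient_map (\<lambda>x. x) W)"
      by (rule quotient_isoI[where g = "\<lambda>x. x"])
        (auto intro: clinear_ident simp: W complex_vector.subspace_0[OF W])
    show "quotient_iso U1 W (quotient_map \<Psi> W)"
    proof (rule quotient_isoI[where g = \<sigma>, OF clinear_\<Psi> csubspace_U1 W \<Psi>U])
      show "\<sigma> x - \<sigma> y \<in> U1" if "x - y \<in> W" for x y
        using \<sigma>_coinvariants[OF that] by (simp add: clinear_diff[OF clinear_\<sigma>])
      show "\<sigma> (\<Psi> \<omega>) - \<omega> \<in> U1" for \<omega> by (rule commutators_in_U1[OF \<sigma>_\<Psi>])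
      show "\<Psi> (\<sigma> x) - x \<in> W" for x by (simp add: \<Psi>_\<sigma> complex_vector.subspace_0[OF W])
    qed
    show "quotient_map (\<lambda>x. x) W (quotient_map (graded_X_b TG) W A) =
        quotient_map (\<lambda>w. t w - w) W (quotient_map \<Psi> W A)" if "A \<in> quotient_space U1" for A
      using that by (auto simp: quotient_space_def map_\<Psi> quotient_map_coset[OF clinear_graded_X_b csubspace_U1 W b]
          quotient_map_coset[OF lin_b' W W b'] quotient_map_id W graded_X_b_eq)
    show "quotient_map \<Psi> W (quotient_map X_d U1 A) =
        quotient_map (norm_operator t) W (quotient_map (\<lambda>x. x) W A)" if "A \<in> quotient_space W" for A
      using that by (auto simp: quotient_space_def map_\<Psi> quotient_map_coset[OF lin_d W csubspace_U1 d]
          quotient_map_coset[OF clinear_norm_operator W W N] quotient_map_id W \<Psi>_d)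
  qed
  show "quotient_map \<Psi> W (Unitize c r \<otimes> word [v] +o U1) =
      (c *\<^sub>C word [v] + koszul p q *\<^sub>C (word [v] * r)) +o W" if "v \<in> G p" "r \<in> TG q"
    by (simp add: map_\<Psi> \<Psi>_letter[OF that])
qed

end


section \<open>The trivial grading\<close>

definition trivial_grading :: "int \<Rightarrow> 'v::complex_vector set"
  where "trivial_grading p = (if p = 0 then UNIV else {0})"

lemma is_grading_trivial: "is_grading (trivial_grading :: int \<Rightarrow> 'v::complex_vector set)"
proof (rule is_gradingI[of _ "\<lambda>p x. if p = 0 then x else 0"])
  show "clinear (\<lambda>x :: 'v. if p = 0 then x else 0)" for p :: int
    by (cases "p = 0") (simp_all add: clinear_ident clinear_const_0)
  show "\<exists>A. finite A \<and> (\<forall>p. p \<notin> A \<longrightarrow> (if p = 0 then x else 0) = 0) \<and>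
      x = (\<Sum>p\<in>A. if p = 0 then x else 0)" for x :: 'v
    by (intro exI[of _ "{0}"]) auto
qed (auto simp: trivial_grading_def complex_vector.subspace_single_0 split: if_splits)

lemma graded_hmodule_trivial: "hmodule \<rho> \<Longrightarrow> graded_hmodule \<rho> trivial_grading"
  using clinear_0[OF hmodule_clinear(1)[OF _ clinear_ident], of \<rho>]
  by (auto simp: graded_hmodule_def is_grading_trivial trivial_grading_def)

text \<open>Zero lies in every degree, so a nonzero degree can occur in the list, but only at a zero
  letter; the word then vanishes and its signs are immaterial.\<close>

lemma hom_trivial:
  "list_all2 (\<lambda>v d. v \<in> trivial_grading d) vs ds \<Longrightarrow> 0 \<in> set vs \<or> set ds \<subseteq> {0}"
  by (induction rule: list_all2_induct) (auto simp: trivial_grading_def split: if_splits)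

lemma sum_list_zero: "set ds \<subseteq> {0 :: int} \<Longrightarrow> sum_list ds = 0"
  by (induction ds) auto

interpretation trivial: graded_vector_space trivial_grading
  by unfold_locales (rule is_grading_trivial)

text \<open>The induced grading on T(V) is trivial again, so the comparisons of graded with ungraded
  notions can be proved for any algebra with trivial grading.\<close>

lemma tensor_grading_trivial:
  "tensor_grading trivial_grading = (trivial_grading :: int \<Rightarrow> 'v::complex_vector tensor_algebra set)"
proof
  fix n :: int
  let ?W = "{word vs | vs ds. trivial.hom vs ds \<and> sum_list ds = n} :: 'v::complex_vector tensor_algebra set"
  show "tensor_grading trivial_grading n = (trivial_grading n :: 'v tensor_algebra set)"
  proof (cases "n = 0")
    case True
    have "word vs \<in> ?W" for vs :: "'v list"
    proof -
      have "trivial.hom vs (replicate (length vs) 0)"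
        by (simp add: list_all2_conv_all_nth trivial_grading_def)
      then show ?thesis using True by (force simp: sum_list_replicate)
    qed
    then have "cspan (range word) \<subseteq> cspan ?W"
      by (intro complex_vector.span_mono) blast
    then have "cspan ?W = UNIV" using word_in_cspan by blast
    then show ?thesis
      using True by (simp only: tensor_grading_def trivial_grading_def[of 0] if_True refl)
  next
    case False
    have "?W \<subseteq> {0}"
      using False by (auto dest!: hom_trivial simp: word_zero_letter sum_list_zero)
    then have "cspan ?W \<subseteq> {0}"
      by (intro complex_vector.span_minimal complex_vector.subspace_single_0)
    then have "cspan ?W = {0}" using complex_vector.span_zero[of ?W] by blast
    then show ?thesis
      using False by (simp only: tensor_grading_def trivial_grading_def[of n] if_False refl)
  qed
qed

lemma multilinear_word_rotate1: "multilinear (\<lambda>vs. word (rotate1 vs))"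
  using trivial.multilinear_rotate1[of 1] by (simp add: scaleC_one)

lemma graded_cyclic_trivial: "graded_cyclic trivial_grading = cyclic"
proof
  fix x :: "'v::complex_vector tensor_algebra"
  show "graded_cyclic trivial_grading x = cyclic x"
  proof (rule trivial.clinear_eq_on_hom_words[OF trivial.clinear_t])
    show "clinear (cyclic :: 'v tensor_algebra \<Rightarrow> _)"
      unfolding cyclic_def by (rule clinear_word_lift[OF multilinear_word_rotate1])
    fix vs :: "'v list" and ds assume hom: "trivial.hom vs ds"
    show "graded_cyclic trivial_grading (word vs) = cyclic (word vs)"
    proof (cases vs)
      case Nil
      then show ?thesis
        by (simp add: cyclic_def clinear_0[OF trivial.clinear_t]
            clinear_0[OF clinear_word_lift[OF multilinear_word_rotate1]])
    next
      case (Cons v us)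
      then obtain d es where ds: "trivial.hom (v # us) (d # es)" using hom by (auto simp: list_all2_Cons1)
      have "0 \<in> set (us @ [v]) \<or> d = 0" using hom_trivial[OF ds] by auto
      then show ?thesis
        using trivial.t_Cons[OF ds] word_zero_letter[of "us @ [v]"]
        by (auto simp: Cons cyclic_def multilinear_word_rotate1 scaleC_one)
    qed
  qed
qed

lemma forms_grading_trivial: "forms_grading trivial_grading 0 = (UNIV :: 'r::complex_algebra forms set)"
proof -
  have "{a \<otimes> b | a b. True} \<subseteq>
      {x \<otimes> y | (x :: 'r unitization) (y :: 'r) p q.
        x \<in> unitization_grading trivial_grading p \<and> y \<in> trivial_grading q \<and> p + q = 0}"
  proof clarify
    fix a :: "'r unitization" and b :: 'r
    have "a \<in> unitization_grading trivial_grading 0" "b \<in> trivial_grading 0" "0 + 0 = (0::int)"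
      by (cases a; auto simp: unitization_grading_def trivial_grading_def)+
    then show "\<exists>x y p q. a \<otimes> b = x \<otimes> y \<and> x \<in> unitization_grading trivial_grading p \<and> y \<in> trivial_grading q \<and> p + q = 0"
      by blast
  qed
  then show ?thesis
    using complex_vector.span_mono tensor_in_cspan unfolding forms_grading_def by blast
qed

lemma graded_forms_commutators_trivial:
  "graded_forms_commutators trivial_grading = (forms_commutators :: 'r::complex_algebra forms set)"
proof -
  let ?A = "{forms_right \<omega> r - koszul p q *\<^sub>C forms_left r \<omega> | (\<omega> :: 'r forms) r p q.
    \<omega> \<in> forms_grading trivial_grading p \<and> r \<in> trivial_grading q}"
  let ?B = "{forms_right \<omega> r - forms_left r \<omega> | (\<omega> :: 'r forms) r. True}"
  have "?B \<subseteq> ?A"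
  proof clarify
    fix \<omega> :: "'r forms" and r :: 'r
    have "forms_right \<omega> r - forms_left r \<omega> = forms_right \<omega> r - koszul 0 0 *\<^sub>C forms_left r \<omega>"
      "\<omega> \<in> forms_grading trivial_grading 0" "r \<in> trivial_grading 0"
      by (simp_all add: scaleC_one forms_grading_trivial trivial_grading_def)
    then show "\<exists>\<omega>' r' p q. forms_right \<omega> r - forms_left r \<omega> = forms_right \<omega>' r' - koszul p q *\<^sub>C forms_left r' \<omega>' \<and>
        \<omega>' \<in> forms_grading trivial_grading p \<and> r' \<in> trivial_grading q"
      by blast
  qed
  moreover have "?A \<subseteq> cspan ?B"
  proof clarify
    fix \<omega> :: "'r forms" and r :: 'r and p q :: int
    assume r: "r \<in> trivial_grading q"
    show "forms_right \<omega> r - koszul p q *\<^sub>C forms_left r \<omega> \<in> cspan ?B"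
    proof (cases "q = 0")
      \<comment> \<open>\<open>q = 0\<close> makes the sign \<open>1\<close> for every
        \<open>p\<close>.\<close>
      case True
      then show ?thesis by (auto simp: scaleC_one intro: complex_vector.span_base)
    next
      case False
      have "forms_right \<omega> 0 = 0" "forms_left 0 \<omega> = 0"
        using clinear_0[OF clinear_forms_right(1)[OF clinear_ident]]
          clinear_0[OF clinear_forms_left(2)[OF clinear_ident]]
        by auto
      then show ?thesis using r False by (simp add: trivial_grading_def complex_vector.span_zero)
    qed
  qed
  ultimately show ?thesis
    unfolding graded_forms_commutators_def forms_commutators_def
    by (intro equalityI complex_vector.span_minimal complex_vector.span_mono csubspace_cspan)
qed

lemma graded_X_b_trivial: "graded_X_b trivial_grading = (X_b :: 'r::complex_algebra forms \<Rightarrow> 'r)"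
proof -
  have "graded_commutator trivial_grading x y = commutator x y" for x y :: 'r
    using graded_commutator_homogeneous[OF is_grading_trivial, of x 0 y 0]
    by (simp add: trivial_grading_def commutator_def scaleC_one)
  then show ?thesis by (simp add: graded_X_b_def X_b_def)
qed

text \<open>The values on forms x dv pin down the second isomorphism: by
  \<open>\<sigma>_\<Psi>\<close> such forms span all 1-forms modulo commutators.\<close>

theorem proposition3p4:
  fixes \<Delta> :: "'h::complex_algebra_1 \<Rightarrow> 'h \<otimes>\<^sub>t 'h"
    and \<epsilon> \<delta> :: "'h \<Rightarrow> complex"
    and S :: "'h \<Rightarrow> 'h"
    and \<rho> :: "'h \<Rightarrow> 'v::complex_vector \<Rightarrow> 'v"
  assumes "hopf_algebra \<Delta> \<epsilon> S"
    and "character \<delta>"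
    and "twisted_antipode \<Delta> S \<delta> \<circ> twisted_antipode \<Delta> S \<delta> = id"
    and "hmodule \<rho>"
  shows
    "let \<tau> = tensor_action \<Delta> \<rho>;
         W = coinvariants \<delta> \<tau>;
         U0 = X0_relations \<delta> \<tau>
     in
       (let U1 = X1_relations \<Delta> \<epsilon> \<delta> \<tau>;
            t = cyclic
        in t ` W \<subseteq> W \<and>
           (\<exists>\<Phi>0 \<Phi>1.
              quotient_supercomplex_iso U0 U1 X_b X_d
                W W (\<lambda>w. t w - w) (norm_operator t) \<Phi>0 \<Phi>1 \<and>
              (\<forall>w. \<Phi>0 (w +o U0) = w +o W) \<and>
              (\<forall>c r v. \<Phi>1 (Unitize c r \<otimes> word [v] +o U1) =
                (c *\<^sub>C word [v] + word [v] * r) +o W))) \<and>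
       (\<forall>G. graded_hmodule \<rho> G \<longrightarrow>
         (let TG = tensor_grading G;
              U1 = graded_X1_relations TG \<Delta> \<epsilon> \<delta> \<tau>;
              t = graded_cyclic G
          in t ` W \<subseteq> W \<and>
             (\<exists>\<Phi>0 \<Phi>1.
                quotient_supercomplex_iso U0 U1 (graded_X_b TG) X_d
                  W W (\<lambda>w. t w - w) (norm_operator t) \<Phi>0 \<Phi>1 \<and>
                (\<forall>w. \<Phi>0 (w +o U0) = w +o W) \<and>
                (\<forall>p q c r v. v \<in> G p \<longrightarrow> r \<in> TG q \<longrightarrow>
                  \<Phi>1 (Unitize c r \<otimes> word [v] +o U1) =
                    (c *\<^sub>C word [v] + koszul p q *\<^sub>C (word [v] * r)) +o W))))"
proof -
  let ?\<tau> = "tensor_action \<Delta> \<rho>"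
  let ?W = "coinvariants \<delta> ?\<tau>"
  have graded: "graded_cyclic G ` ?W \<subseteq> ?W \<and> (\<exists>\<Phi>0 \<Phi>1.
      quotient_supercomplex_iso ?W (graded_X1_relations (tensor_grading G) \<Delta> \<epsilon> \<delta> ?\<tau>)
        (graded_X_b (tensor_grading G)) X_d ?W ?W (\<lambda>w. graded_cyclic G w - w)
        (norm_operator (graded_cyclic G)) \<Phi>0 \<Phi>1 \<and>
      (\<forall>w. \<Phi>0 (w +o ?W) = w +o ?W) \<and>
      (\<forall>p q c r v. v \<in> G p \<longrightarrow> r \<in> tensor_grading G q \<longrightarrow>
        \<Phi>1 (Unitize c r \<otimes> word [v] +o graded_X1_relations (tensor_grading G) \<Delta> \<epsilon> \<delta> ?\<tau>) =
          (c *\<^sub>C word [v] + koszul p q *\<^sub>C (word [v] * r)) +o ?W))"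
    if "graded_hmodule \<rho> G" for G
  proof -
    interpret graded_twisted_hopf_module \<Delta> \<epsilon> \<delta> S \<rho> G
      by unfold_locales (use assms that in \<open>auto simp: graded_hmodule_def\<close>)
    show ?thesis
      by (intro conjI exI[of _ "quotient_map (\<lambda>x. x) ?W"] exI[of _ "quotient_map \<Psi> ?W"] allI impI
          graded_X_complex_iso quotient_map_id[OF csubspace_coinvariants])
  qed
  have ungraded: "cyclic ` ?W \<subseteq> ?W \<and> (\<exists>\<Phi>0 \<Phi>1.
      quotient_supercomplex_iso ?W (X1_relations \<Delta> \<epsilon> \<delta> ?\<tau>) X_b X_d ?W ?W (\<lambda>w. cyclic w - w)
        (norm_operator cyclic) \<Phi>0 \<Phi>1 \<and>
      (\<forall>w. \<Phi>0 (w +o ?W) = w +o ?W) \<and>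
      (\<forall>c r v. \<Phi>1 (Unitize c r \<otimes> word [v] +o X1_relations \<Delta> \<epsilon> \<delta> ?\<tau>) =
          (c *\<^sub>C word [v] + word [v] * r) +o ?W))"
  proof -
    have U1: "graded_X1_relations trivial_grading \<Delta> \<epsilon> \<delta> ?\<tau> = X1_relations \<Delta> \<epsilon> \<delta> ?\<tau>"
      by (simp add: graded_X1_relations_def X1_relations_def graded_forms_commutators_trivial)
    \<comment> \<open>Stated for an arbitrary space, as it serves both the letter \<open>v\<close>
      and the coefficient \<open>r\<close>.\<close>
    have deg: "v \<in> trivial_grading 0" for v :: "'a::complex_vector"
      by (simp add: trivial_grading_def)
    obtain \<Phi>0 \<Phi>1 where \<Phi>:
      "quotient_supercomplex_iso ?W (X1_relations \<Delta> \<epsilon> \<delta> ?\<tau>) X_b X_d ?W ?W (\<lambda>w. cyclic w - w)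
        (norm_operator cyclic) \<Phi>0 \<Phi>1" "\<forall>w. \<Phi>0 (w +o ?W) = w +o ?W"
      "\<And>p q c r v. v \<in> trivial_grading p \<Longrightarrow> r \<in> trivial_grading q \<Longrightarrow>
        \<Phi>1 (Unitize c r \<otimes> word [v] +o X1_relations \<Delta> \<epsilon> \<delta> ?\<tau>) =
          (c *\<^sub>C word [v] + koszul p q *\<^sub>C (word [v] * r)) +o ?W"
      using graded[OF graded_hmodule_trivial[OF assms(4)]]
      unfolding tensor_grading_trivial graded_cyclic_trivial graded_X_b_trivial U1 by blast
    have "\<Phi>1 (Unitize c r \<otimes> word [v] +o X1_relations \<Delta> \<epsilon> \<delta> ?\<tau>) =
        (c *\<^sub>C word [v] + word [v] * r) +o ?W" for c r v
      using \<Phi>(3)[OF deg deg, of c r v] by (simp add: scaleC_one)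
    moreover have "cyclic ` ?W \<subseteq> ?W"
      using graded[OF graded_hmodule_trivial[OF assms(4)]] unfolding graded_cyclic_trivial by blast
    ultimately show ?thesis using \<Phi>(1,2) by blast
  qed
  show ?thesis
    unfolding Let_def X0_relations_def using graded ungraded by blast
qed

end
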